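(* Fix $\varepsilon>0$. Let $c\in\mathscr{K}$ satisfy the minimal amplitude hypothesis with respect to $\mathscr{A}^c_\varepsilon$. For any $(\mu_k,\lambda)\in\mathscr{A}^c_\varepsilon$ let $v_\lambda(x',y)=\phi_k(x')u_{\lambda,k}(y)$ be an associated eigenfunction of $A=-\nabla\cdot\tilde c\,\nabla$. Let $\omega=\omega'\times(a,b)\subseteq\Omega$ be a nonempty open set. If $\omega'\ne\Omega'$, assume that the family $\{\phi_k\}_{k=1}^\infty$ of eigenfunctions of the Laplacian in $\Omega'$ does not concentrate in $\Omega'\setminus\omega'$, i.e. $\liminf_{k\to\infty}\|\phi_k\|^2_{L^2(\omega')}/\|\phi_k\|^2_{L^2(\Omega')}>0$. Then there exists a constant $C_\omega>0$ such that $$0<C_\omega\le\inf_{(\mu_k,\lambda)\in\mathscr{A}^c_\varepsilon}\frac{\|v_\lambda\|_{L^2(\omega)}}{\|v_\lambda\|_{L^2(\Omega)}}\le1.$$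
   Context: $\Omega'\subset\mathbb{R}^d$ ($d\ge1$) is a fixed bounded smooth open domain, $H>0$ is fixed, $\Omega=\Omega'\times(0,H)$ with coordinates $x=(x',y)$. $\{(\mu_k^2,\phi_k)\}_{k\ge1}$ is the sequence of eigenvalues (nondecreasing, with multiplicity, $\mu_k>0$) and $L^2$-normalized eigenfunctions (forming an orthonormal basis of $L^2(\Omega')$) of the Dirichlet Laplacian $-\Delta_{x'}$ in $L^2(\Omega')$. Fix $0<c_m<c_M$; $\mathscr{K}$ is the set of all $c\in L^\infty([0,H])$ with $\operatorname{ess\,inf}c=c_m$ and $\operatorname{ess\,sup}c=c_M$. Set $\tilde c(x',y)=c(y)$; $A=-\nabla\cdot\tilde c\,\nabla$ is the self-adjoint operator in $L^2(\Omega)$ with homogeneous Dirichlet boundary conditions. By separation of variables $A$ is unitarily equivalent to $\bigoplus_{k\ge1}A_k$ on $\bigoplus_k L^2(0,H)$, where $$A_k=c(y)\mu_k^2-\frac{d}{dy}c(y)\frac{d}{dy},\qquad D(A_k)=\{u\in H^1_0(0,H):\ cu'\in H^1(0,H)\}.$$ The (simple) eigenvalues of $A_k$ in increasing order are $\beta_{k,1}<\beta_{k,2}<\cdots$. If $\lambda=\beta_{k,\ell}$, $u_{\lambda,k}$ denotes the (real) eigenfunction of $A_k$ for $\lambda$, normalized in $L^2(0,H)$. $\mathscr{A}^c_\varepsilon=\bigcup_{k\ge1}\{(\mu_k,\lambda):\ \lambda=\beta_{k,\ell}\text{ for some }\ell\ge1,\ \lambda\ge(c_M+\varepsilon)\mu_k^2\}$.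 The function $c$ satisfies the minimal amplitude hypothesis with respect to $\mathscr{A}^c_\varepsilon$ if $\mathfrak{r}_{c,\varepsilon}>0$, where $\mathfrak{r}_{c,\varepsilon}\ge0$ is defined by $$\mathfrak{r}_{c,\varepsilon}^2=\inf_{y\in[0,H],\ (\mu_k,\lambda)\in\mathscr{A}^c_\varepsilon}\big[u_{\lambda,k}(y)^2+(c(y)u_{\lambda,k}'(y))^2\big],$$ $cu_{\lambda,k}'$ being understood as its continuous representative. *)

theory Defs
  imports "HOL-Analysis.Analysis" "HOL-Probability.Essential_Supremum"
begin

section \<open>Smooth functions and smooth domains\<close>

primrec higher_differentiable_on ::
    "'a::real_normed_vector set \<Rightarrow> ('a \<Rightarrow> 'b::real_normed_vector) \<Rightarrow> nat \<Rightarrow> bool" where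
  "higher_differentiable_on S f 0 \<longleftrightarrow> continuous_on S f"
| "higher_differentiable_on S f (Suc n) \<longleftrightarrow>
     (\<forall>x\<in>S. f differentiable (at x)) \<and>
     (\<forall>v. higher_differentiable_on S (\<lambda>x. frechet_derivative f (at x) v) n)"

text \<open>Meant for open \<open>S\<close> only (the derivatives are two-sided).\<close>
definition smooth_on ::
    "'a::real_normed_vector set \<Rightarrow> ('a \<Rightarrow> 'b::real_normed_vector) \<Rightarrow> bool" where
  "smooth_on S f \<longleftrightarrow> (\<forall>n. higher_differentiable_on S f n)"

text \<open>The boundary is smooth if the set is locally, on one side of its boundary, the negativity
  set of a smooth function without critical points.\<close>
definition smooth_boundary :: "'a::euclidean_space set \<Rightarrow> bool" where
  "smooth_boundary S \<longleftrightarrow>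
     (\<forall>p\<in>frontier S. \<exists>U (\<rho> :: 'a \<Rightarrow> real).
        open U \<and> p \<in> U \<and> smooth_on U \<rho> \<and>
        (\<forall>x\<in>U. frechet_derivative \<rho> (at x) \<noteq> (\<lambda>v. 0)) \<and>
        S \<inter> U = {x\<in>U. \<rho> x < 0})"

definition bounded_smooth_domain :: "'a::euclidean_space set \<Rightarrow> bool" where
  "bounded_smooth_domain S \<longleftrightarrow>
     open S \<and> connected S \<and> S \<noteq> {} \<and> bounded S \<and> smooth_boundary S"

section \<open>$L^2$ and Sobolev spaces\<close>

text \<open>Elements of $L^2(S)$ are represented by functions; nothing below depends on the
  representative or on values outside \<open>S\<close>.\<close>

definition L2 :: "'a::euclidean_space set \<Rightarrow> ('a \<Rightarrow> 'b::euclidean_space) \<Rightarrow> bool" where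
  "L2 S f \<longleftrightarrow> f \<in> borel_measurable (lebesgue_on S) \<and>
     integrable (lebesgue_on S) (\<lambda>x. (norm (f x))\<^sup>2)"

definition L2_norm :: "'a::euclidean_space set \<Rightarrow> ('a \<Rightarrow> 'b::euclidean_space) \<Rightarrow> real" where
  "L2_norm S f = sqrt (LINT x|lebesgue_on S. (norm (f x))\<^sup>2)"

definition L2_inner ::
    "'a::euclidean_space set \<Rightarrow> ('a \<Rightarrow> complex) \<Rightarrow> ('a \<Rightarrow> complex) \<Rightarrow> complex" where
  "L2_inner S f g = (LINT x|lebesgue_on S. f x * cnj (g x))"

definition orthonormal_basis_L2 ::
    "'a::euclidean_space set \<Rightarrow> (nat \<Rightarrow> 'a \<Rightarrow> complex) \<Rightarrow> bool" where
  "orthonormal_basis_L2 S \<phi> \<longleftrightarrow>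
     (\<forall>k. L2 S (\<phi> k)) \<and>
     (\<forall>j k. L2_inner S (\<phi> j) (\<phi> k) = (if j = k then 1 else 0)) \<and>
     (\<forall>f. L2 S f \<longrightarrow>
        (\<lambda>n. L2_norm S (\<lambda>x. f x - (\<Sum>k<n. L2_inner S f (\<phi> k) * \<phi> k x))) \<longlonglongrightarrow> 0)"

definition test_function ::
    "'a::euclidean_space set \<Rightarrow> ('a \<Rightarrow> 'b::euclidean_space) \<Rightarrow> bool" where
  "test_function S \<psi> \<longleftrightarrow> smooth_on UNIV \<psi> \<and>
     compact (closure {x. \<psi> x \<noteq> 0}) \<and> closure {x. \<psi> x \<noteq> 0} \<subseteq> S"

text \<open>Both functions are required to be in $L^2$, so that the integrals are genuine. Real test
  functions suffice, also for vector-valued \<open>f\<close>.\<close>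
definition has_weak_pderiv ::
    "'a::euclidean_space set \<Rightarrow> 'a \<Rightarrow> ('a \<Rightarrow> 'b::euclidean_space) \<Rightarrow> ('a \<Rightarrow> 'b) \<Rightarrow> bool" where
  "has_weak_pderiv S b f g \<longleftrightarrow> L2 S f \<and> L2 S g \<and>
     (\<forall>\<psi> :: 'a \<Rightarrow> real. test_function S \<psi> \<longrightarrow>
        (LINT x|lebesgue_on S. frechet_derivative \<psi> (at x) b *\<^sub>R f x) =
        - (LINT x|lebesgue_on S. \<psi> x *\<^sub>R g x))"

definition weak_pderiv ::
    "'a::euclidean_space set \<Rightarrow> 'a \<Rightarrow> ('a \<Rightarrow> 'b::euclidean_space) \<Rightarrow> 'a \<Rightarrow> 'b" where
  "weak_pderiv S b f = (SOME g. has_weak_pderiv S b f g)"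

definition H1 :: "'a::euclidean_space set \<Rightarrow> ('a \<Rightarrow> 'b::euclidean_space) \<Rightarrow> bool" where
  "H1 S f \<longleftrightarrow> L2 S f \<and> (\<forall>b\<in>Basis. \<exists>g. has_weak_pderiv S b f g)"

text \<open>$H^1_0(S)$ is the closure of $C_c^\infty(S)$ in $H^1(S)$.\<close>
definition H10 :: "'a::euclidean_space set \<Rightarrow> ('a \<Rightarrow> 'b::euclidean_space) \<Rightarrow> bool" where
  "H10 S f \<longleftrightarrow> H1 S f \<and>
     (\<forall>e>0. \<exists>\<psi>. test_function S \<psi> \<and>
        L2_norm S (\<lambda>x. f x - \<psi> x) < e \<and>
        (\<forall>b\<in>Basis. L2_norm S (\<lambda>x. weak_pderiv S b f x - frechet_derivative \<psi> (at x) b) < e))"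

section \<open>The Dirichlet Laplacian\<close>

text \<open>Graph of the operator $-\Delta$ with domain
  $\{u \in H^1_0(S) : \Delta u \in L^2(S)\}$.\<close>
definition dirichlet_laplacian ::
    "'a::euclidean_space set \<Rightarrow> ('a \<Rightarrow> complex) \<Rightarrow> ('a \<Rightarrow> complex) \<Rightarrow> bool" where
  "dirichlet_laplacian S u f \<longleftrightarrow> H10 S u \<and> L2 S f \<and>
     (\<forall>\<psi> :: 'a \<Rightarrow> real. test_function S \<psi> \<longrightarrow>
        (\<Sum>b\<in>Basis. LINT x|lebesgue_on S.
            frechet_derivative \<psi> (at x) b *\<^sub>R weak_pderiv S b u x) =
        (LINT x|lebesgue_on S. \<psi> x *\<^sub>R f x))"

text \<open>All sequences are indexed from 0: \<open>\<mu> k\<close>, \<open>\<phi> k\<close> stand for $\mu_{k+1}$, $\phi_{k+1}$, and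
  \<open>\<beta> k l\<close> below for $\beta_{k+1,l+1}$. Because the eigenfunctions form a basis, \<open>\<mu>\<close> runs through
  all eigenvalues with their multiplicities.\<close>
definition dirichlet_eigensystem ::
    "'a::euclidean_space set \<Rightarrow> (nat \<Rightarrow> real) \<Rightarrow> (nat \<Rightarrow> 'a \<Rightarrow> complex) \<Rightarrow> bool" where
  "dirichlet_eigensystem S \<mu> \<phi> \<longleftrightarrow>
     mono \<mu> \<and> (\<forall>k. 0 < \<mu> k) \<and> orthonormal_basis_L2 S \<phi> \<and>
     (\<forall>k. dirichlet_laplacian S (\<phi> k) (\<lambda>x. of_real ((\<mu> k)\<^sup>2) * \<phi> k x))"

section \<open>The class of coefficients and the reduced operators\<close>

definition essinf :: "'a measure \<Rightarrow> ('a \<Rightarrow> ereal) \<Rightarrow> ereal" where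
  "essinf M f = - esssup M (\<lambda>x. - f x)"

definition coeff_class :: "real \<Rightarrow> real \<Rightarrow> real \<Rightarrow> (real \<Rightarrow> real) set" where
  "coeff_class H c\<^sub>m c\<^sub>M = {c. c \<in> borel_measurable (lebesgue_on {0..H}) \<and>
     essinf (lebesgue_on {0..H}) (\<lambda>y. ereal (c y)) = ereal c\<^sub>m \<and>
     esssup (lebesgue_on {0..H}) (\<lambda>y. ereal (c y)) = ereal c\<^sub>M}"

abbreviation wderiv :: "real \<Rightarrow> (real \<Rightarrow> real) \<Rightarrow> real \<Rightarrow> real" where
  "wderiv H \<equiv> weak_pderiv {0<..<H} 1"

definition dom_A :: "real \<Rightarrow> (real \<Rightarrow> real) \<Rightarrow> (real \<Rightarrow> real) \<Rightarrow> bool" where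
  "dom_A H c u \<longleftrightarrow> H10 {0<..<H} u \<and> H1 {0<..<H} (\<lambda>y. c y * wderiv H u y)"

text \<open>The operator $A_k$, with \<open>m\<close> in the place of $\mu_k$.\<close>
definition op_A :: "real \<Rightarrow> (real \<Rightarrow> real) \<Rightarrow> real \<Rightarrow> (real \<Rightarrow> real) \<Rightarrow> real \<Rightarrow> real" where
  "op_A H c m u = (\<lambda>y. c y * m\<^sup>2 * u y - wderiv H (\<lambda>z. c z * wderiv H u z) y)"

definition eigenfunction_A ::
    "real \<Rightarrow> (real \<Rightarrow> real) \<Rightarrow> real \<Rightarrow> real \<Rightarrow> (real \<Rightarrow> real) \<Rightarrow> bool" where
  "eigenfunction_A H c m lam u \<longleftrightarrow> dom_A H c u \<and>
     \<not> (AE y in lebesgue_on {0<..<H}. u y = 0) \<and>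
     (AE y in lebesgue_on {0<..<H}. op_A H c m u y = lam * u y)"

text \<open>The operators are self-adjoint with real coefficients, so real numbers and real
  eigenfunctions give the full point spectrum.\<close>
definition eigenvalues_A :: "real \<Rightarrow> (real \<Rightarrow> real) \<Rightarrow> real \<Rightarrow> real set" where
  "eigenvalues_A H c m = {lam. \<exists>u. eigenfunction_A H c m lam u}"

section \<open>The minimal amplitude hypothesis\<close>

definition spectral_pairs ::
    "(nat \<Rightarrow> real) \<Rightarrow> (nat \<Rightarrow> nat \<Rightarrow> real) \<Rightarrow> real \<Rightarrow> real \<Rightarrow> (real \<times> real) set" where
  "spectral_pairs \<mu> \<beta> c\<^sub>M \<epsilon> =
     (\<Union>k. {(\<mu> k, lam) | lam. (\<exists>l. lam = \<beta> k l) \<and> lam \<ge> (c\<^sub>M + \<epsilon>) * (\<mu> k)\<^sup>2})"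

definition continuous_rep :: "real \<Rightarrow> (real \<Rightarrow> real) \<Rightarrow> real \<Rightarrow> real" where
  "continuous_rep H f =
     (SOME g. continuous_on {0..H} g \<and> (AE y in lebesgue_on {0..H}. g y = f y))"

definition min_amplitude ::
    "real \<Rightarrow> (real \<Rightarrow> real) \<Rightarrow> (nat \<Rightarrow> real) \<Rightarrow> (nat \<Rightarrow> nat \<Rightarrow> real) \<Rightarrow>
     (nat \<Rightarrow> real \<Rightarrow> real \<Rightarrow> real) \<Rightarrow> real \<Rightarrow> real \<Rightarrow> real" where
  "min_amplitude H c \<mu> \<beta> u c\<^sub>M \<epsilon> =
     sqrt (Inf {(continuous_rep H (u k lam) y)\<^sup>2 +
                (continuous_rep H (\<lambda>z. c z * wderiv H (u k lam) z) y)\<^sup>2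
               | y k lam. y \<in> {0..H} \<and> (\<mu> k, lam) \<in> spectral_pairs \<mu> \<beta> c\<^sub>M \<epsilon>})"

definition minimal_amplitude_hypothesis ::
    "real \<Rightarrow> (real \<Rightarrow> real) \<Rightarrow> (nat \<Rightarrow> real) \<Rightarrow> (nat \<Rightarrow> nat \<Rightarrow> real) \<Rightarrow>
     (nat \<Rightarrow> real \<Rightarrow> real \<Rightarrow> real) \<Rightarrow> real \<Rightarrow> real \<Rightarrow> bool" where
  "minimal_amplitude_hypothesis H c \<mu> \<beta> u c\<^sub>M \<epsilon> \<longleftrightarrow> min_amplitude H c \<mu> \<beta> u c\<^sub>M \<epsilon> > 0"

definition does_not_concentrate ::
    "'a::euclidean_space set \<Rightarrow> 'a set \<Rightarrow> (nat \<Rightarrow> 'a \<Rightarrow> complex) \<Rightarrow> bool" where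
  "does_not_concentrate S S' \<phi> \<longleftrightarrow>
     liminf (\<lambda>k. ereal ((L2_norm S' (\<phi> k))\<^sup>2 / (L2_norm S (\<phi> k))\<^sup>2)) > 0"

end

theory Submission
  imports Defs "HOL-Computational_Algebra.Polynomial" "HOL-Real_Asymp.Real_Asymp"
    "HOL-Complex_Analysis.Great_Picard"
begin

text \<open>On a product $\omega' \times (a,b)$ the norm of $v_\lambda = \phi_k u_{\lambda,k}$ factorizes, and
$\|\phi_k\| = \|u_{\lambda,k}\| = 1$ on the full domains. It therefore suffices to bound
$\|\phi_k\|_{L^2(\omega')}$ and $\|u_{\lambda,k}\|_{L^2(a,b)}$ from below, uniformly in all pairs.

\<^bold>\<open>The factor \<open>\<phi>\<close>.\<close> Non-concentration bounds all but finitely many of the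
norms, and each single norm is positive by unique continuation: an eigenfunction that vanishes on
an open subset of a connected domain vanishes. This is proved for weak solutions and without
regularity theory. Testing the equation on a ball of radius $\rho$ with
$(\xi\cdot x)^k s^j$, $s = \rho^2 - |x|^2$, relates the moments
$\int \phi\,(\xi\cdot x)^k s^j$ for fixed $k$ and consecutive $j$ by a three-term recurrence (and
to moments with $k-2$, which are zero by induction). If $\phi$ vanishes near the centre, these
moments are at most of order $(\rho^2-\delta^2)^j$, but a nonzero solution of the recurrence
cannot decay faster than about $\rho^{2j}$. So all moments are zero, $\phi s$ is orthogonal to all
exponentials, and $\phi = 0$ on the whole ball (\<open>unique_continuation_ball\<close>);
connectedness spreads this over the domain (\<open>unique_continuation\<close>).

\<^bold>\<open>The factor \<open>u\<close>.\<close> With $W = cu'$ and $V = W/\sqrt\lambda$ the eigenvalue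
equation becomes the system $u' = \sqrt\lambda\, V/c$, $V' = -\sqrt\lambda\,(1 - c\mu_k^2/\lambda)\,u$,
whose coefficients, by $\lambda \ge (c_M+\varepsilon)\mu_k^2$, lie between positive constants that
do not depend on the pair. In the time scale $\sqrt\lambda\, y$ this is a uniformly nondegenerate
oscillator. On an interval of bounded rescaled length, the mass of $u^2$ is comparable to the
length times the square of the largest value of $|u|$ and $|V|$ there (\<open>oscillator_mass\<close>),
because a large $V$ forces $u$ to move. That largest value is bounded below by the
minimal amplitude $r$: if the rescaled interval is long, $V$ has a zero in it
(\<open>oscillator_zero\<close>), and there $u^2 \ge r^2$; if $\lambda$ is bounded, $u^2 + \lambda V^2 \ge r^2$
suffices. Cutting $(a,b)$ into intervals of rescaled length of order one gives the
bound (\<open>oscillator_uniform_mass\<close>).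

The infimum must also be taken over a nonempty set. The eigenvalues of $A_1$ are unbounded, since
otherwise its orthonormal eigenfunctions would be bounded in $H^1(0,H)$ and a subsequence would
converge uniformly (\<open>eigenvalues_unbounded\<close>).\<close>

section \<open>Smooth functions and test functions\<close>

lemma higher_differentiable_mono:
  "higher_differentiable_on UNIV f (Suc n) \<Longrightarrow> higher_differentiable_on UNIV f n"
proof (induction n arbitrary: f)
  case 0
  then show ?case by (auto intro!: continuous_at_imp_continuous_on differentiable_imp_continuous_within)
next
  case (Suc n)
  then show ?case by (metis higher_differentiable_on.simps(2))
qed

lemma higher_differentiable_const: "higher_differentiable_on UNIV (\<lambda>x. c) n"
  by (induction n arbitrary: c) (auto simp: frechet_derivative_const)

lemma higher_differentiable_add:
  "higher_differentiable_on UNIV f n \<Longrightarrow> higher_differentiable_on UNIV g n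
    \<Longrightarrow> higher_differentiable_on UNIV (\<lambda>x. f x + g x) n"
proof (induction n arbitrary: f g)
  case 0
  then show ?case by (auto intro: continuous_intros)
next
  case (Suc n)
  then have "frechet_derivative (\<lambda>x. f x + g x) (at x) =
      (\<lambda>v. frechet_derivative f (at x) v + frechet_derivative g (at x) v)" for x
    by (intro frechet_derivative_at[symmetric] has_derivative_add)
       (auto simp: frechet_derivative_works[symmetric])
  with Suc show ?case by simp
qed

lemma higher_differentiable_mult:
  fixes f g :: "'a::real_normed_vector \<Rightarrow> real"
  shows "higher_differentiable_on UNIV f n \<Longrightarrow> higher_differentiable_on UNIV g n
    \<Longrightarrow> higher_differentiable_on UNIV (\<lambda>x. f x * g x) n"
proof (induction n arbitrary: f g)
  case 0
  then show ?case by (auto intro: continuous_intros)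
next
  case (Suc n)
  then have "frechet_derivative (\<lambda>x. f x * g x) (at x) =
      (\<lambda>v. f x * frechet_derivative g (at x) v + frechet_derivative f (at x) v * g x)" for x
    by (intro frechet_derivative_at[symmetric] has_derivative_mult)
       (auto simp: frechet_derivative_works[symmetric])
  moreover have "higher_differentiable_on UNIV f n" "higher_differentiable_on UNIV g n"
    using Suc.prems by (blast intro: higher_differentiable_mono)+
  ultimately show ?case
    using Suc by (simp add: higher_differentiable_add)
qed

text \<open>The derivative of $g \circ f$ in direction \<open>v\<close> is the product of the directional derivative of
\<open>f\<close> and $g' \circ f$. The induction hypothesis applies to $g'$ in place of \<open>g\<close>, with the
same \<open>f\<close>.\<close>

lemma higher_differentiable_compose:
  fixes f :: "'a::real_normed_vector \<Rightarrow> real" and g :: "real \<Rightarrow> real"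
  shows "higher_differentiable_on UNIV g n \<Longrightarrow> higher_differentiable_on UNIV f n
    \<Longrightarrow> higher_differentiable_on UNIV (\<lambda>x. g (f x)) n"
proof (induction n arbitrary: g)
  case 0
  then show ?case by (auto intro: continuous_on_compose2)
next
  case (Suc n)
  have D: "frechet_derivative (\<lambda>x. g (f x)) (at x) v =
      frechet_derivative f (at x) v * frechet_derivative g (at (f x)) 1" for x v
  proof -
    have g: "(g has_derivative frechet_derivative g (at (f x))) (at (f x))"
      and f: "(f has_derivative frechet_derivative f (at x)) (at x)"
      using Suc.prems by (auto simp: frechet_derivative_works[symmetric])
    have "frechet_derivative (\<lambda>x. g (f x)) (at x) v = frechet_derivative g (at (f x)) (frechet_derivative f (at x) v)"
      using frechet_derivative_at[OF has_derivative_compose[OF f g]] by metis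
    also have "\<dots> = frechet_derivative g (at (f x)) (frechet_derivative f (at x) v *\<^sub>R 1)"
      by simp
    finally show ?thesis
      using linear_scale[OF has_derivative_linear[OF g], of "frechet_derivative f (at x) v" 1] by simp
  qed
  have "(\<lambda>x. g (f x)) differentiable at x" for x
    using Suc.prems differentiable_compose[of g f x UNIV] by simp
  moreover have "higher_differentiable_on UNIV f n"
    using Suc.prems by (blast intro: higher_differentiable_mono)
  ultimately show ?case
    using Suc by (auto simp: D intro!: higher_differentiable_mult)
qed

lemma smooth_const: "smooth_on UNIV (\<lambda>x. c)"
  by (simp add: smooth_on_def higher_differentiable_const)

lemma smooth_add: "smooth_on UNIV f \<Longrightarrow> smooth_on UNIV g \<Longrightarrow> smooth_on UNIV (\<lambda>x. f x + g x)"
  by (simp add: smooth_on_def higher_differentiable_add)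

lemma smooth_mult:
  fixes f g :: "'a::real_normed_vector \<Rightarrow> real"
  shows "smooth_on UNIV f \<Longrightarrow> smooth_on UNIV g \<Longrightarrow> smooth_on UNIV (\<lambda>x. f x * g x)"
  by (simp add: smooth_on_def higher_differentiable_mult)

lemma smooth_power:
  fixes f :: "'a::real_normed_vector \<Rightarrow> real"
  shows "smooth_on UNIV f \<Longrightarrow> smooth_on UNIV (\<lambda>x. f x ^ k)"
  by (induction k) (auto intro: smooth_const smooth_mult)

lemma smooth_compose:
  fixes f :: "'a::real_normed_vector \<Rightarrow> real" and g :: "real \<Rightarrow> real"
  shows "smooth_on UNIV g \<Longrightarrow> smooth_on UNIV f \<Longrightarrow> smooth_on UNIV (\<lambda>x. g (f x))"
  by (simp add: smooth_on_def higher_differentiable_compose)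

lemma smooth_deriv: "smooth_on UNIV f \<Longrightarrow> smooth_on UNIV (\<lambda>x. frechet_derivative f (at x) v)"
  unfolding smooth_on_def by (metis higher_differentiable_on.simps(2))

lemma smooth_imp_continuous: "smooth_on UNIV f \<Longrightarrow> continuous_on UNIV f"
  unfolding smooth_on_def by (metis higher_differentiable_on.simps(1))

lemma smooth_if_derivatives_smooth:
  assumes "\<And>x. (f has_derivative f' x) (at x)" "\<And>v. smooth_on UNIV (\<lambda>x. f' x v)"
  shows "smooth_on UNIV f"
  unfolding smooth_on_def
proof
  fix n
  have "higher_differentiable_on UNIV f (Suc n)"
    using assms frechet_derivative_at[OF assms(1)]
    by (auto simp: smooth_on_def differentiable_def)
  then show "higher_differentiable_on UNIV f n"
    by (rule higher_differentiable_mono)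
qed

lemma smooth_inner:
  fixes v z :: "'a::real_inner"
  shows "smooth_on UNIV (\<lambda>y. v \<bullet> (y - z))"
  by (rule smooth_if_derivatives_smooth[where f'="\<lambda>_ w. v \<bullet> w"])
     (auto intro!: derivative_eq_intros smooth_const)

lemma smooth_norm_square:
  fixes z :: "'a::real_inner"
  shows "smooth_on UNIV (\<lambda>y. (y - z) \<bullet> (y - z))"
proof (rule smooth_if_derivatives_smooth[where f'="\<lambda>y w. 2 * (w \<bullet> (y - z))"])
  show "((\<lambda>y. (y - z) \<bullet> (y - z)) has_derivative (\<lambda>w. 2 * (w \<bullet> (x - z)))) (at x)" for x
    by (auto intro!: derivative_eq_intros simp: inner_commute)
  show "smooth_on UNIV (\<lambda>x. 2 * (v \<bullet> (x - z)))" for v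
    by (intro smooth_mult smooth_const smooth_inner)
qed

text \<open>Coinductive smoothness: a class of functions whose derivatives stay in the class consists of
smooth functions. It replaces formulas for the higher derivatives of the concrete functions below.\<close>

lemma smooth_on_derivative_closed_class:
  fixes C :: "(real \<Rightarrow> real) set"
  assumes C: "\<And>g. g \<in> C \<Longrightarrow> \<exists>g'\<in>C. \<forall>t. (g has_real_derivative g' t) (at t)" and "g \<in> C"
  shows "smooth_on UNIV g"
proof -
  have "higher_differentiable_on UNIV g n" if "g \<in> C" for g n
    using that
  proof (induction n arbitrary: g)
    case 0
    then show ?case
      using C by (metis continuous_at_imp_continuous_on DERIV_isCont higher_differentiable_on.simps(1))
  next
    case (Suc n)
    obtain g' where g': "g' \<in> C" "\<And>t. (g has_real_derivative g' t) (at t)"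
      using C Suc.prems by blast
    have "frechet_derivative g (at t) v = v * g' t" for t v
      using frechet_derivative_at[OF g'(2)[unfolded has_field_derivative_def]] by (metis mult.commute)
    moreover have "g differentiable at t" for t
      using g'(2) by (meson real_differentiable_def)
    ultimately show ?case
      using Suc.IH[OF g'(1)] by (simp add: higher_differentiable_mult higher_differentiable_const)
  qed
  then show ?thesis
    using assms(2) by (simp add: smooth_on_def)
qed

text \<open>\<open>flat \<eta> 1\<close> is the standard smooth function $e^{-\eta/t}$ that vanishes to infinite order at $0$
and is zero for $t \le 0$. The polynomial in $1/t$ makes the class closed under differentiation.\<close>

definition flat :: "real \<Rightarrow> real poly \<Rightarrow> real \<Rightarrow> real" where
  "flat \<eta> P t = (if t \<le> 0 then 0 else poly P (1 / t) * exp (- \<eta> / t))"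

lemma flat_tendsto_0:
  assumes "\<eta> > 0"
  shows "(flat \<eta> P \<longlongrightarrow> 0) (at 0)"
proof (rule filterlim_split_at)
  have "\<forall>\<^sub>F t in at_left 0. flat \<eta> P t = 0"
    by (auto simp: flat_def eventually_at_filter)
  then show "(flat \<eta> P \<longlongrightarrow> 0) (at_left 0)"
    by (simp add: tendsto_eventually)
next
  have 1: "((\<lambda>x. x ^ k * exp (- (\<eta> * x))) \<longlongrightarrow> 0) at_top" for k
  proof -
    have "((\<lambda>x. (\<eta> * x) ^ k / exp (\<eta> * x)) \<longlongrightarrow> 0) at_top"
      by (rule filterlim_compose[OF tendsto_power_div_exp_0])
         (use assms in \<open>auto intro!: filterlim_tendsto_pos_mult_at_top filterlim_ident\<close>)
    then have "((\<lambda>x. (1 / \<eta> ^ k) * ((\<eta> * x) ^ k / exp (\<eta> * x))) \<longlongrightarrow> (1 / \<eta> ^ k) * 0) at_top"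
      by (rule tendsto_mult_left)
    then show ?thesis
      using assms by (simp add: power_mult_distrib exp_minus field_simps)
  qed
  have "((\<lambda>x. \<Sum>i\<le>degree P. coeff P i * (x ^ i * exp (- (\<eta> * x)))) \<longlongrightarrow> (\<Sum>i\<le>degree P. coeff P i * 0)) at_top"
    by (intro tendsto_sum tendsto_mult tendsto_const 1)
  then have "((\<lambda>x. poly P x * exp (- (\<eta> * x))) \<longlongrightarrow> 0) at_top"
    by (simp add: poly_altdef sum_distrib_right mult.assoc)
  from filterlim_compose[OF this filterlim_inverse_at_top_right]
  have "((\<lambda>t. poly P (1 / t) * exp (- \<eta> / t)) \<longlongrightarrow> 0) (at_right 0)"
    by (simp add: field_simps)
  then show "(flat \<eta> P \<longlongrightarrow> 0) (at_right 0)"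
    by (rule Lim_transform_eventually) (auto simp: flat_def eventually_at_filter)
qed

lemma flat_has_derivative:
  assumes "\<eta> > 0"
  shows "(flat \<eta> P has_real_derivative flat \<eta> ([:0, 0, 1:] * (smult \<eta> P - pderiv P)) t) (at t)"
proof -
  consider "t < 0" | "t = 0" | "t > 0" by linarith
  then show ?thesis
  proof cases
    case 1
    have "((\<lambda>_. 0) has_real_derivative 0) (at t)" by simp
    then have "(flat \<eta> P has_real_derivative 0) (at t)"
      by (rule has_field_derivative_transform_within_open[of _ _ _ "{..<0}"])
         (use 1 in \<open>auto simp: flat_def\<close>)
    with 1 show ?thesis by (simp add: flat_def)
  next
    case 2
    have "((\<lambda>h. (flat \<eta> P (0 + h) - flat \<eta> P 0) / h) \<longlongrightarrow> 0) (at 0)"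
      using flat_tendsto_0[OF assms, of "[:0, 1:] * P"]
      by (rule Lim_transform_eventually) (auto simp: flat_def eventually_at_filter)
    with 2 show ?thesis
      by (simp add: DERIV_def flat_def)
  next
    case 3
    have "((\<lambda>t. poly P (1 / t) * exp (- \<eta> / t)) has_real_derivative
        flat \<eta> ([:0, 0, 1:] * (smult \<eta> P - pderiv P)) t) (at t)"
      using 3 by (auto intro!: derivative_eq_intros DERIV_chain2[OF poly_DERIV]
          simp: flat_def field_simps power2_eq_square)
    then show ?thesis
      by (rule has_field_derivative_transform_within_open[of _ _ _ "{0<..}"])
         (use 3 in \<open>auto simp: flat_def\<close>)
  qed
qed

lemma smooth_flat: "\<eta> > 0 \<Longrightarrow> smooth_on UNIV (flat \<eta> P)"
  by (rule smooth_on_derivative_closed_class[where C="range (flat \<eta>)"])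
     (use flat_has_derivative in blast)+

lemma test_functionI:
  fixes \<psi> :: "'a::euclidean_space \<Rightarrow> real"
  assumes "smooth_on UNIV \<psi>" "compact K" "K \<subseteq> S" "\<And>x. x \<notin> K \<Longrightarrow> \<psi> x = 0"
  shows "test_function S \<psi>"
proof -
  have "closure {x. \<psi> x \<noteq> 0} \<subseteq> K"
    by (rule closure_minimal) (use assms compact_imp_closed in auto)
  then show ?thesis
    using assms compact_imp_bounded bounded_subset
    by (auto simp: test_function_def compact_eq_bounded_closed)
qed

text \<open>Outside the closed support the function is locally zero, hence so is its derivative.\<close>

lemma test_function_deriv:
  fixes \<psi> :: "'a::euclidean_space \<Rightarrow> real"
  assumes "test_function S \<psi>"
  shows "test_function S (\<lambda>x. frechet_derivative \<psi> (at x) v)"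
proof (rule test_functionI[where K="closure {x. \<psi> x \<noteq> 0}"])
  define C where "C = closure {x. \<psi> x \<noteq> 0}"
  have C: "0 = \<psi> y" if "y \<in> - C" for y
    using that closure_subset[of "{x. \<psi> x \<noteq> 0}"] by (auto simp: C_def)
  have "open (- C)" unfolding C_def by (rule open_Compl[OF closed_closure])
  fix x assume "x \<notin> closure {x. \<psi> x \<noteq> 0}"
  then have "x \<in> - C" by (simp add: C_def)
  then have "(\<psi> has_derivative (\<lambda>_. 0)) (at x)"
    by (rule has_derivative_transform_within_open[OF has_derivative_const \<open>open (- C)\<close> _ C])
  then show "frechet_derivative \<psi> (at x) v = 0"
    by (simp add: frechet_derivative_at[symmetric])
qed (use assms smooth_deriv in \<open>auto simp: test_function_def\<close>)

lemma test_function_bounded: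
  fixes \<psi> :: "'a::euclidean_space \<Rightarrow> real"
  assumes "test_function S \<psi>"
  obtains B where "\<And>x. \<bar>\<psi> x\<bar> \<le> B"
proof -
  let ?K = "closure {x. \<psi> x \<noteq> 0}"
  have "compact (\<psi> ` ?K)"
    using assms smooth_imp_continuous
    by (auto simp: test_function_def intro!: compact_continuous_image intro: continuous_on_subset)
  then obtain B where B: "\<And>x. x \<in> ?K \<Longrightarrow> \<bar>\<psi> x\<bar> \<le> B"
    by (fastforce dest!: compact_imp_bounded simp: bounded_iff)
  have "\<bar>\<psi> x\<bar> \<le> max B 0" for x
  proof (cases "\<psi> x = 0")
    case False
    then have "x \<in> ?K" using closure_subset[of "{x. \<psi> x \<noteq> 0}"] by blast
    then show ?thesis using B[of x] by linarith
  qed simp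
  then show ?thesis using that by blast
qed

lemma L2_integrable:
  assumes "L2 S f" "S \<in> lmeasurable"
  shows "integrable (lebesgue_on S) f"
proof -
  interpret finite_measure "lebesgue_on S"
    using assms by (simp add: finite_measure_lebesgue_on)
  show ?thesis
  proof (rule Bochner_Integration.integrable_bound[of _ "\<lambda>x. 1 + (norm (f x))\<^sup>2"])
    show "AE x in lebesgue_on S. norm (f x) \<le> norm (1 + (norm (f x))\<^sup>2)"
      by (rule AE_I2) (smt (verit) real_norm_def power2_eq_square zero_le_power2 mult_le_cancel_left1 norm_ge_zero self_le_power)
  qed (use assms in \<open>auto simp: L2_def\<close>)
qed

lemma integrable_on_subdomain:
  fixes f :: "'a::euclidean_space \<Rightarrow> 'b::{banach, second_countable_topology}"
  assumes "integrable (lebesgue_on S) f" "T \<subseteq> S" "S \<in> sets lebesgue" "T \<in> sets lebesgue"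
  shows "integrable (lebesgue_on T) f"
proof -
  have "integrable lebesgue (\<lambda>x. indicator T x *\<^sub>R (indicator S x *\<^sub>R f x))"
    by (rule integrable_mult_indicator) (use assms in \<open>auto simp: integrable_restrict_space\<close>)
  also have "(\<lambda>x. indicator T x *\<^sub>R (indicator S x *\<^sub>R f x)) = (\<lambda>x. indicator T x *\<^sub>R f x)"
  proof
    show "indicator T x *\<^sub>R (indicator S x *\<^sub>R f x) = indicator T x *\<^sub>R f x" for x
      using assms(2) by (cases "x \<in> T") auto
  qed
  finally show ?thesis
    using assms by (simp add: integrable_restrict_space)
qed

lemma integrable_bounded_scaleR:
  fixes f :: "'a::euclidean_space \<Rightarrow> 'b::euclidean_space"
  assumes "integrable (lebesgue_on S) f" "continuous_on S w" "\<And>x. x \<in> S \<Longrightarrow> \<bar>w x\<bar> \<le> B" "S \<in> sets lebesgue"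
  shows "integrable (lebesgue_on S) (\<lambda>x. w x *\<^sub>R f x)"
proof (rule Bochner_Integration.integrable_bound[of _ "\<lambda>x. B *\<^sub>R f x"])
  have "w \<in> borel_measurable (lebesgue_on S)"
    using assms by (intro continuous_imp_measurable_on_sets_lebesgue) auto
  then show "(\<lambda>x. w x *\<^sub>R f x) \<in> borel_measurable (lebesgue_on S)"
    using assms by (intro borel_measurable_scaleR) auto
  show "AE x in lebesgue_on S. norm (w x *\<^sub>R f x) \<le> norm (B *\<^sub>R f x)"
    by (rule AE_I2) (use assms(3) in \<open>force intro!: mult_right_mono\<close>)
qed (use assms in auto)

lemma has_weak_pderiv_weak_pderiv:
  "H1 S f \<Longrightarrow> b \<in> Basis \<Longrightarrow> has_weak_pderiv S b f (weak_pderiv S b f)"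
  unfolding weak_pderiv_def by (metis H1_def someI_ex)

text \<open>The definition of the operator moves one derivative onto the test function. The second one is
moved by the definition of the weak derivative of \<open>\<phi>\<close>, tested with the partial derivatives
of \<open>\<psi>\<close>. In the resulting identity \<open>\<phi>\<close> appears undifferentiated.\<close>

lemma weak_eigenfunction_identity:
  fixes \<phi> :: "'a::euclidean_space \<Rightarrow> complex" and \<psi> :: "'a \<Rightarrow> real"
  assumes "dirichlet_laplacian S \<phi> (\<lambda>x. of_real m * \<phi> x)" "test_function S \<psi>" "S \<in> lmeasurable"
  shows "(LINT x|lebesgue_on S.
    ((\<Sum>b\<in>Basis. frechet_derivative (\<lambda>y. frechet_derivative \<psi> (at y) b) (at x) b) + m * \<psi> x) *\<^sub>R \<phi> x) = 0"
proof -
  have H1: "H1 S \<phi>" using assms(1) by (auto simp: dirichlet_laplacian_def H10_def)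
  then have L2: "L2 S \<phi>" by (simp add: H1_def)
  let ?D = "\<lambda>b x. frechet_derivative (\<lambda>y. frechet_derivative \<psi> (at y) b) (at x) b"
  have int: "integrable (lebesgue_on S) (\<lambda>x. w x *\<^sub>R \<phi> x)" if "test_function S w" for w
  proof -
    obtain B where "\<And>x. \<bar>w x\<bar> \<le> B" using test_function_bounded[OF \<open>test_function S w\<close>] by blast
    then show ?thesis
      using that L2_integrable[OF L2 assms(3)] assms(3)
      by (auto simp: test_function_def intro!: integrable_bounded_scaleR[of S \<phi> w B]
          intro: continuous_on_subset[OF smooth_imp_continuous])
  qed
  have "(LINT x|lebesgue_on S. ?D b x *\<^sub>R \<phi> x) =
      - (LINT x|lebesgue_on S. frechet_derivative \<psi> (at x) b *\<^sub>R weak_pderiv S b \<phi> x)" if "b \<in> Basis" for b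
  proof -
    have "has_weak_pderiv S b \<phi> (weak_pderiv S b \<phi>)"
      by (rule has_weak_pderiv_weak_pderiv[OF H1 that])
    then show ?thesis
      using test_function_deriv[OF assms(2), of b] by (simp add: has_weak_pderiv_def)
  qed
  then have "(\<Sum>b\<in>Basis. LINT x|lebesgue_on S. ?D b x *\<^sub>R \<phi> x) =
      - (LINT x|lebesgue_on S. \<psi> x *\<^sub>R (of_real m * \<phi> x))"
    using assms(1,2) by (simp add: dirichlet_laplacian_def sum_negf)
  also have "\<dots> = - (LINT x|lebesgue_on S. m *\<^sub>R (\<psi> x *\<^sub>R \<phi> x))"
    by (simp add: scaleR_conv_of_real mult_ac)
  finally have "(\<Sum>b\<in>Basis. LINT x|lebesgue_on S. ?D b x *\<^sub>R \<phi> x) + (LINT x|lebesgue_on S. m *\<^sub>R (\<psi> x *\<^sub>R \<phi> x)) = 0"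
    by simp
  moreover have "integrable (lebesgue_on S) (\<lambda>x. ?D b x *\<^sub>R \<phi> x)" for b
    using assms(2) by (intro int test_function_deriv)
  moreover have "integrable (lebesgue_on S) (\<lambda>x. m *\<^sub>R (\<psi> x *\<^sub>R \<phi> x))"
    using int[OF assms(2)] by (rule integrable_scaleR_right)
  ultimately show ?thesis
    by (simp add: scaleR_add_left scaleR_sum_left integral_sum)
qed

section \<open>Integrable functions orthogonal to an algebra of continuous functions\<close>

text \<open>By the theorem of Stone and Weierstrass \<open>f\<close> is orthogonal to all continuous functions, and in the
limit to the indicators of boxes. The integrals of \<open>f\<close> over small boxes at \<open>x\<close>, divided by
the volume, converge to \<open>f x\<close> for almost all \<open>x\<close>.\<close>

lemma AE_zero_if_orthogonal_to_function_ring: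
  fixes f :: "'a::euclidean_space \<Rightarrow> 'b::euclidean_space"
  assumes R: "function_ring_on R K" and f: "integrable (lebesgue_on K) f"
    and orth: "\<And>g. g \<in> R \<Longrightarrow> (LINT x|lebesgue_on K. g x *\<^sub>R f x) = 0"
  shows "AE x in lebesgue_on K. f x = 0"
proof -
  interpret function_ring_on R K by (rule R)
  have K[measurable]: "K \<in> sets lebesgue"
    using compact by (simp add: lmeasurable_compact fmeasurableD)
  have int: "integrable (lebesgue_on K) (\<lambda>x. g x *\<^sub>R f x)" if g: "continuous_on K g" for g
  proof -
    obtain B where "\<And>x. x \<in> K \<Longrightarrow> \<bar>g x\<bar> \<le> B"
      using compact_imp_bounded[OF compact_continuous_image[OF g compact]]
      by (fastforce simp: bounded_iff)
    then show ?thesis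
      using integrable_bounded_scaleR[OF f g _ K] by blast
  qed
  have cont: "(LINT x|lebesgue_on K. g x *\<^sub>R f x) = 0" if g: "continuous_on K g" for g
  proof -
    let ?I = "LINT x|lebesgue_on K. norm (f x)"
    have "norm (LINT x|lebesgue_on K. g x *\<^sub>R f x) \<le> e * ?I" if "e > 0" for e
    proof -
      obtain h where h: "h \<in> R" "\<And>x. x \<in> K \<Longrightarrow> \<bar>g x - h x\<bar> < e"
        using Stone_Weierstrass_basic[OF g \<open>e > 0\<close>] by blast
      have "(LINT x|lebesgue_on K. g x *\<^sub>R f x) = (LINT x|lebesgue_on K. (g x - h x) *\<^sub>R f x)"
        using int[OF g] int[OF continuous[OF h(1)]] orth[OF h(1)]
        by (simp add: scaleR_diff_left)
      also have "norm \<dots> \<le> (LINT x|lebesgue_on K. e * norm (f x))"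
        using h f by (intro Bochner_Integration.integral_norm_bound_integral int continuous_on_diff g continuous)
          (auto intro!: mult_right_mono intro: less_imp_le)
      finally show ?thesis by simp
    qed
    moreover have "((\<lambda>e. e * ?I) \<longlongrightarrow> 0 * ?I) (at_right 0)"
      by (intro tendsto_intros)
    ultimately have "norm (LINT x|lebesgue_on K. g x *\<^sub>R f x) \<le> 0 * ?I"
      by (intro tendsto_lowerbound[of _ _ "at_right 0"]) (auto simp: eventually_at_filter)
    then show ?thesis by simp
  qed
  \<comment> \<open>The continuous functions \<open>g n\<close> decrease to the indicator of the box.\<close>
  have box: "(LINT x|lebesgue_on K. indicator (cbox a b) x *\<^sub>R f x) = 0" for a b :: 'a
  proof (cases "cbox a b = {}")
    case False
    define g where "g n x = max 0 (1 - real n * infdist x (cbox a b))" for n x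
    have g: "continuous_on K (g n)" for n
      unfolding g_def by (intro continuous_intros)
    have "(\<lambda>n. LINT x|lebesgue_on K. g n x *\<^sub>R f x) \<longlonglongrightarrow>
        (LINT x|lebesgue_on K. indicator (cbox a b) x *\<^sub>R f x)"
    proof (rule integral_dominated_convergence[where w="\<lambda>x. norm (f x)"])
      show "AE x in lebesgue_on K. (\<lambda>n. g n x *\<^sub>R f x) \<longlonglongrightarrow> indicator (cbox a b) x *\<^sub>R f x"
      proof (rule AE_I2, rule tendsto_scaleR[OF _ tendsto_const])
        fix x
        show "(\<lambda>n. g n x) \<longlonglongrightarrow> indicator (cbox a b) x"
        proof (cases "x \<in> cbox a b")
          case True
          then show ?thesis by (simp add: g_def)
        next
          case False
          then have d: "infdist x (cbox a b) > 0"
            using \<open>cbox a b \<noteq> {}\<close> in_closed_iff_infdist_zero[OF closed_cbox, of a b x] infdist_nonneg[of x "cbox a b"]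
            by fastforce
          obtain N where "1 < real N * infdist x (cbox a b)"
            using d reals_Archimedean3 by blast
          have "g n x = 0" if "n \<ge> N" for n
          proof -
            have "real N * infdist x (cbox a b) \<le> real n * infdist x (cbox a b)"
              using that d by (intro mult_right_mono) auto
            then show ?thesis
              using \<open>1 < real N * infdist x (cbox a b)\<close> unfolding g_def by linarith
          qed
          then have "\<forall>\<^sub>F n in sequentially. g n x = 0"
            by (auto simp: eventually_sequentially)
          then show ?thesis
            using False by (simp add: tendsto_eventually)
        qed
      qed
      show "AE x in lebesgue_on K. norm (g n x *\<^sub>R f x) \<le> norm (f x)" for n
        by (rule AE_I2) (auto simp: g_def infdist_nonneg intro!: mult_left_le_one_le)
      show "(\<lambda>x. indicator (cbox a b) x *\<^sub>R f x) \<in> borel_measurable (lebesgue_on K)"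
        using f by (intro borel_measurable_scaleR[OF measurable_restrict_space1[OF borel_measurable_indicator]]) auto
    qed (use int[OF g] f in auto)
    then show ?thesis
      unfolding cont[OF g] LIMSEQ_const_iff by simp
  qed simp
  define F where "F x = indicator K x *\<^sub>R f x" for x
  have F: "integrable lebesgue F"
    using f by (simp add: F_def[abs_def] integrable_restrict_space)
  have F': "set_integrable lebesgue (cbox a b) F" for a b
    unfolding set_integrable_def using F by (intro integrable_mult_indicator) auto
  have "integral (cbox a b) F = 0" for a b
  proof -
    have "integral (cbox a b) F = (LINT x:cbox a b|lebesgue. F x)"
      using F'[of a b] by (simp add: set_lebesgue_integral_eq_integral)
    also have "\<dots> = (LINT x|lebesgue_on K. indicator (cbox a b) x *\<^sub>R f x)"
      by (simp add: integral_restrict_space set_lebesgue_integral_def F_def mult_ac)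
    finally show ?thesis using box by simp
  qed
  moreover have "F integrable_on cbox a b" for a b
    using F'[of a b] by (simp add: set_lebesgue_integral_eq_integral)
  ultimately obtain N where N: "negligible N" "\<And>x e. x \<notin> N \<Longrightarrow> 0 < e \<Longrightarrow> \<exists>d>0. \<forall>h. 0 < h \<and> h < d \<longrightarrow>
      norm (0 /\<^sub>R h ^ DIM('a) - F x) < e"
    using integrable_ccontinuous_explicit[of F] by metis
  have "F x = 0" if "x \<notin> N" for x
  proof -
    have "norm (F x) < e" if "e > 0" for e
      using N(2)[OF \<open>x \<notin> N\<close> that] by (metis diff_0 dense norm_minus_cancel scaleR_zero_right)
    then show ?thesis
      by (metis less_irrefl zero_less_norm_iff)
  qed
  then have "AE x in lebesgue. F x = 0"
    using N(1) by (intro AE_I'[of N]) (auto simp: negligible_iff_null_sets)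
  then show ?thesis
    by (auto simp: AE_restrict_space_iff F_def)
qed

section \<open>Test functions with radial profile\<close>

text \<open>The truncated power $\max(t,0)^m$ is not smooth at $0$, so it cannot serve as the profile of a
test function. With $F(t) = e^{-\eta/(t-\eta)}$ for $t > \eta$ and $F = 0$ elsewhere, the functions
$t^m F$ are smooth, vanish near $0$ and converge to it as $\eta \to 0$. Their first two derivatives
converge as well, because $t F'$ and $t^2 F''$ depend only on $x = \eta/(t-\eta)$: they are
polynomials in $x$ times $e^{-x}$, hence bounded, and tend to $0$ with $x$. The uniform bounds are
what dominated convergence needs.\<close>

lemma smooth_approximations_of_power:
  fixes m :: nat and T :: real
  assumes m: "m \<ge> 1" and T: "T > 0"
  obtains G G' G'' :: "nat \<Rightarrow> real \<Rightarrow> real" and B :: real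
  where "\<And>n. smooth_on UNIV (G n)"
    and "\<And>n t. (G n has_real_derivative G' n t) (at t)"
    and "\<And>n t. (G' n has_real_derivative G'' n t) (at t)"
    and "\<And>n t. t \<le> 1 / real (Suc n) \<Longrightarrow> G n t = 0 \<and> G' n t = 0 \<and> G'' n t = 0"
    and "\<And>t. t > 0 \<Longrightarrow> (\<lambda>n. G n t) \<longlonglongrightarrow> t ^ m"
    and "\<And>t. t > 0 \<Longrightarrow> (\<lambda>n. G' n t) \<longlonglongrightarrow> real m * t ^ (m - 1)"
    and "\<And>t. t > 0 \<Longrightarrow> (\<lambda>n. G'' n t) \<longlonglongrightarrow> real m * real (m - 1) * t ^ (m - 2)"
    and "\<And>n t. t \<le> T \<Longrightarrow> \<bar>G n t\<bar> \<le> B \<and> \<bar>G' n t\<bar> \<le> B \<and> (m \<ge> 2 \<longrightarrow> \<bar>G'' n t\<bar> \<le> B)"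
proof -
  define \<eta> where "\<eta> n = 1 / real (Suc n)" for n
  define D where "D n P = [:0, 0, 1:] * (smult (\<eta> n) P - pderiv P)" for n P
  define F0 where "F0 n t = flat (\<eta> n) 1 (t - \<eta> n)" for n t
  define F1 where "F1 n t = flat (\<eta> n) (D n 1) (t - \<eta> n)" for n t
  define F2 where "F2 n t = flat (\<eta> n) (D n (D n 1)) (t - \<eta> n)" for n t
  define G where "G n t = t ^ m * F0 n t" for n t
  define G' where "G' n t = real m * t ^ (m - 1) * F0 n t + t ^ m * F1 n t" for n t
  define G'' where "G'' n t = real m * real (m - 1) * t ^ (m - 2) * F0 n t
      + 2 * real m * t ^ (m - 1) * F1 n t + t ^ m * F2 n t" for n t
  have \<eta>: "\<eta> n > 0" for n by (simp add: \<eta>_def)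
  have dF: "((\<lambda>t. flat (\<eta> n) P (t - \<eta> n)) has_real_derivative flat (\<eta> n) (D n P) (t - \<eta> n)) (at t)" for n P t
    using DERIV_chain2[OF flat_has_derivative[OF \<eta>] DERIV_diff[OF DERIV_ident DERIV_const]]
    by (simp add: D_def)
  have dF0: "(F0 n has_real_derivative F1 n t) (at t)" for n t
    using dF[of n 1] by (simp add: F0_def[abs_def] F1_def)
  have dF1: "(F1 n has_real_derivative F2 n t) (at t)" for n t
    using dF[of n "D n 1"] by (simp add: F1_def[abs_def] F2_def)
  define X where "X n t = \<eta> n / (t - \<eta> n)" for n t
  have fl: "flat (\<eta> n) (D n 1) \<tau> = \<eta> n / \<tau> / \<tau> * exp (- (\<eta> n / \<tau>))"
    "flat (\<eta> n) (D n (D n 1)) \<tau> = ((\<eta> n / \<tau>)\<^sup>2 - 2 * (\<eta> n / \<tau>)) / \<tau>\<^sup>2 * exp (- (\<eta> n / \<tau>))" if "\<tau> > 0" for n \<tau>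
    using that by (simp_all add: flat_def D_def pderiv_pCons power2_eq_square field_simps)
  have pos: "F0 n t = exp (- X n t)" "t * F1 n t = (1 + X n t) * X n t * exp (- X n t)"
    "t\<^sup>2 * F2 n t = (1 + X n t)\<^sup>2 * ((X n t)\<^sup>2 - 2 * X n t) * exp (- X n t)" if "t > \<eta> n" for n t
  proof -
    have t: "t - \<eta> n > 0" "t = (t - \<eta> n) * (1 + X n t)" using that by (auto simp: X_def field_simps)
    have "F1 n t = X n t / (t - \<eta> n) * exp (- X n t)"
      "F2 n t = ((X n t)\<^sup>2 - 2 * X n t) / (t - \<eta> n)\<^sup>2 * exp (- X n t)"
      unfolding F1_def F2_def X_def by (rule fl[OF t(1)])+
    then show "t * F1 n t = (1 + X n t) * X n t * exp (- X n t)"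
      "t\<^sup>2 * F2 n t = (1 + X n t)\<^sup>2 * ((X n t)\<^sup>2 - 2 * X n t) * exp (- X n t)"
      using t(1) by (subst t(2), simp add: power_mult_distrib)+
    show "F0 n t = exp (- X n t)" using t(1) by (simp add: F0_def X_def flat_def)
  qed
  have zero: "F0 n t = 0" "F1 n t = 0" "F2 n t = 0" if "t \<le> \<eta> n" for n t
    using that by (simp_all add: F0_def F1_def F2_def flat_def)
  have G'_pos: "G' n t = t ^ (m - 1) * (real m * F0 n t + t * F1 n t)" for n t
    using m by (cases m) (auto simp: G'_def algebra_simps)
  have G''_pos: "G'' n t = t ^ (m - 2) * (real m * real (m - 1) * F0 n t + 2 * real m * (t * F1 n t) + t\<^sup>2 * F2 n t)"
    if "m \<ge> 2" for n t
  proof -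
    obtain k where "m = k + 2" using \<open>m \<ge> 2\<close> by (metis add.commute le_Suc_ex)
    then show ?thesis by (simp add: G''_def algebra_simps power2_eq_square)
  qed
  have lim: "(\<lambda>n. F0 n t) \<longlonglongrightarrow> 1" "(\<lambda>n. t * F1 n t) \<longlonglongrightarrow> 0" "(\<lambda>n. t\<^sup>2 * F2 n t) \<longlonglongrightarrow> 0" if "t > 0" for t
  proof -
    have lim\<eta>: "\<eta> \<longlonglongrightarrow> 0"
      using LIMSEQ_inverse_real_of_nat by (simp add: \<eta>_def[abs_def] inverse_eq_divide)
    have ev: "\<forall>\<^sub>F n in sequentially. \<eta> n < t" using lim\<eta> that by (rule order_tendstoD)
    have "(\<lambda>n. \<eta> n / (t - \<eta> n)) \<longlonglongrightarrow> 0 / (t - 0)" using that by (intro tendsto_intros lim\<eta>) auto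
    then have X: "(\<lambda>n. X n t) \<longlonglongrightarrow> 0" by (simp add: X_def)
    have "(\<lambda>n. exp (- X n t)) \<longlonglongrightarrow> 1" using tendsto_exp[OF tendsto_minus[OF X]] by simp
    then show "(\<lambda>n. F0 n t) \<longlonglongrightarrow> 1"
      by (rule Lim_transform_eventually) (rule eventually_mono[OF ev], simp add: pos)
    have "(\<lambda>n. (1 + X n t) * X n t * exp (- X n t)) \<longlonglongrightarrow> (1 + 0) * 0 * exp (- 0)" by (intro tendsto_intros X)
    then have "(\<lambda>n. (1 + X n t) * X n t * exp (- X n t)) \<longlonglongrightarrow> 0" by simp
    then show "(\<lambda>n. t * F1 n t) \<longlonglongrightarrow> 0"
      by (rule Lim_transform_eventually) (rule eventually_mono[OF ev], simp add: pos)
    have "(\<lambda>n. (1 + X n t)\<^sup>2 * ((X n t)\<^sup>2 - 2 * X n t) * exp (- X n t)) \<longlonglongrightarrow> (1 + 0)\<^sup>2 * (0\<^sup>2 - 2 * 0) * exp (- 0)"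
      by (intro tendsto_intros X)
    then have "(\<lambda>n. (1 + X n t)\<^sup>2 * ((X n t)\<^sup>2 - 2 * X n t) * exp (- X n t)) \<longlonglongrightarrow> 0" by simp
    then show "(\<lambda>n. t\<^sup>2 * F2 n t) \<longlonglongrightarrow> 0"
      by (rule Lim_transform_eventually) (rule eventually_mono[OF ev], simp add: pos)
  qed
  have bd: "\<bar>F0 n t\<bar> \<le> 512" "\<bar>t * F1 n t\<bar> \<le> 512" "\<bar>t\<^sup>2 * F2 n t\<bar> \<le> 512" for n t
  proof -
    have "\<bar>F0 n t\<bar> \<le> 512 \<and> \<bar>t * F1 n t\<bar> \<le> 512 \<and> \<bar>t\<^sup>2 * F2 n t\<bar> \<le> 512"
    proof (cases "t \<le> \<eta> n")
      case False
      define x where "x = X n t"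
      have x: "x > 0" using \<eta>[of n] False by (simp add: x_def X_def)
      have "(1 + x) / 4 \<le> 1 + x / 4" by simp
      then have "(1 + x) / 4 \<le> exp (x / 4)" using exp_ge_add_one_self order.trans by blast
      then have "((1 + x) / 4) ^ 4 \<le> exp (x / 4) ^ 4" using x by (intro power_mono) auto
      then have "(1 + x) ^ 4 \<le> 256 * exp x"
        by (simp add: power_divide exp_of_nat_mult[symmetric])
      then have e: "(1 + x) ^ 4 * exp (- x) \<le> 256" by (simp add: exp_minus field_simps)
      have p: "1 \<le> (1 + x) ^ 4" "(1 + x) * x \<le> (1 + x) ^ 4" "\<bar>(1 + x)\<^sup>2 * (x\<^sup>2 - 2 * x)\<bar> \<le> 2 * (1 + x) ^ 4"
      proof -
        show "1 \<le> (1 + x) ^ 4" using x by (intro one_le_power) auto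
        have "(1 + x) * x \<le> (1 + x)\<^sup>2" using x by (simp add: power2_eq_square)
        also have "\<dots> \<le> (1 + x) ^ 4" using x by (intro power_increasing) auto
        finally show "(1 + x) * x \<le> (1 + x) ^ 4" .
        have "\<bar>x\<^sup>2 - 2 * x\<bar> \<le> 2 * (1 + x)\<^sup>2"
          using x by (simp add: abs_le_iff power2_eq_square algebra_simps)
        then have "(1 + x)\<^sup>2 * \<bar>x\<^sup>2 - 2 * x\<bar> \<le> (1 + x)\<^sup>2 * (2 * (1 + x)\<^sup>2)"
          by (intro mult_left_mono) auto
        then show "\<bar>(1 + x)\<^sup>2 * (x\<^sup>2 - 2 * x)\<bar> \<le> 2 * (1 + x) ^ 4"
          by (simp add: abs_mult power2_eq_square power4_eq_xxxx mult_ac)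
      qed
      have q: "\<bar>y * exp (- x)\<bar> \<le> 512" if "\<bar>y\<bar> \<le> 2 * (1 + x) ^ 4" for y
      proof -
        have "\<bar>y * exp (- x)\<bar> = \<bar>y\<bar> * exp (- x)" by (simp add: abs_mult)
        also have "\<dots> \<le> (2 * (1 + x) ^ 4) * exp (- x)" using that by (intro mult_right_mono) auto
        also have "\<dots> \<le> 512" using e by linarith
        finally show ?thesis .
      qed
      show ?thesis
        using False q[of 1] q[of "(1 + x) * x"] q[of "(1 + x)\<^sup>2 * (x\<^sup>2 - 2 * x)"] p x
        by (simp add: pos x_def)
    qed (simp add: zero)
    then show "\<bar>F0 n t\<bar> \<le> 512" "\<bar>t * F1 n t\<bar> \<le> 512" "\<bar>t\<^sup>2 * F2 n t\<bar> \<le> 512" by auto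
  qed
  define C where "C = (real m * real (m - 1) + 2 * real m + 1) * 512"
  define B where "B = (T ^ m + T ^ (m - 1) + T ^ (m - 2)) * C"
  have C: "C \<ge> 512" "(real m + 1) * 512 \<le> C" by (auto simp: C_def)
  have TB: "t ^ j * c \<le> B" if "0 < t" "t \<le> T" "j \<in> {m, m - 1, m - 2}" "c \<le> C" "0 \<le> c" for t c j
    unfolding B_def using that C T
    by (intro mult_mono order.trans[OF power_mono[of t T j]]) (auto intro!: add_nonneg_nonneg)
  show thesis
  proof (rule that[of G G' G'' B])
    show "smooth_on UNIV (G n)" for n
    proof -
      have "smooth_on UNIV (\<lambda>t::real. (1 \<bullet> (t - 0)) ^ m * flat (\<eta> n) 1 (1 \<bullet> (t - \<eta> n)))"
        by (intro smooth_mult smooth_power smooth_compose[OF smooth_flat[OF \<eta>]] smooth_inner)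
      then show ?thesis by (simp add: G_def[abs_def] F0_def)
    qed
    show "(G n has_real_derivative G' n t) (at t)" for n t
      unfolding G_def G'_def by (auto intro!: derivative_eq_intros dF0 simp: algebra_simps)
    have "((\<lambda>t. real m * t ^ (m - 1) * F0 n t + t ^ m * F1 n t) has_real_derivative G'' n t) (at t)" for n t
      unfolding G''_def
      by (auto intro!: derivative_eq_intros dF0 dF1 simp: algebra_simps numeral_2_eq_2)
    then show "(G' n has_real_derivative G'' n t) (at t)" for n t
      by (simp add: G'_def[abs_def])
    show "(\<lambda>n. G n t) \<longlonglongrightarrow> t ^ m" if "t > 0" for t
      using tendsto_mult_left[OF lim(1)[OF that], of "t ^ m"] by (simp add: G_def)
    show "(\<lambda>n. G' n t) \<longlonglongrightarrow> real m * t ^ (m - 1)" if "t > 0" for t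
    proof -
      have "(\<lambda>n. t ^ (m - 1) * (real m * F0 n t + t * F1 n t)) \<longlonglongrightarrow> t ^ (m - 1) * (real m * 1 + 0)"
        by (intro tendsto_intros lim that)
      then show ?thesis by (simp add: G'_pos mult.commute)
    qed
    show "(\<lambda>n. G'' n t) \<longlonglongrightarrow> real m * real (m - 1) * t ^ (m - 2)" if "t > 0" for t
    proof (cases "m \<ge> 2")
      case True
      have "(\<lambda>n. t ^ (m - 2) * (real m * real (m - 1) * F0 n t + 2 * real m * (t * F1 n t) + t\<^sup>2 * F2 n t))
          \<longlonglongrightarrow> t ^ (m - 2) * (real m * real (m - 1) * 1 + 2 * real m * 0 + 0)"
        by (intro tendsto_intros lim that)
      then show ?thesis using True by (simp add: G''_pos mult_ac)
    next
      case False
      then have "m = 1" using m by simp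
      have "(\<lambda>n. (2 * (t * F1 n t) + t\<^sup>2 * F2 n t) / t) \<longlonglongrightarrow> (2 * 0 + 0) / t"
        using that by (intro tendsto_intros lim) auto
      then show ?thesis
        using that by (simp add: G''_def \<open>m = 1\<close> add_divide_distrib power2_eq_square)
    qed
    show G0: "G n t = 0 \<and> G' n t = 0 \<and> G'' n t = 0" if "t \<le> 1 / real (Suc n)" for n t
      using that by (simp add: G_def G'_def G''_def zero \<eta>_def)
    show "\<bar>G n t\<bar> \<le> B \<and> \<bar>G' n t\<bar> \<le> B \<and> (m \<ge> 2 \<longrightarrow> \<bar>G'' n t\<bar> \<le> B)" if "t \<le> T" for n t
    proof (cases "t \<le> 0")
      case True
      have "B \<ge> 0" using T C by (auto simp: B_def)
      moreover have "t \<le> 1 / real (Suc n)" using True by (rule order.trans) simp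
      ultimately show ?thesis using G0[of t n] by simp
    next
      case False
      then have t: "0 < t" by simp
      have mb: "\<bar>k * y\<bar> \<le> k * 512" if "\<bar>y\<bar> \<le> 512" "0 \<le> k" for k y :: real
        using mult_left_mono[OF that] that(2) by (simp add: abs_mult)
      have "\<bar>G n t\<bar> \<le> B"
        using TB[OF t that, of m "\<bar>F0 n t\<bar>"] bd(1)[of n t] C t by (simp add: G_def abs_mult)
      moreover have "\<bar>real m * F0 n t + t * F1 n t\<bar> \<le> C"
        using mb[OF bd(1), of "real m" n t] bd(2)[of t n] C by (simp add: distrib_right)
      then have "\<bar>G' n t\<bar> \<le> B"
        using TB[OF t that, of "m - 1" "\<bar>real m * F0 n t + t * F1 n t\<bar>"] t
        by (simp add: G'_pos abs_mult)
      moreover have "\<bar>G'' n t\<bar> \<le> B" if "m \<ge> 2"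
      proof -
        have "\<bar>real m * real (m - 1) * F0 n t + 2 * real m * (t * F1 n t) + t\<^sup>2 * F2 n t\<bar> \<le> C"
        proof -
          have "\<bar>real m * real (m - 1) * F0 n t\<bar> \<le> real m * real (m - 1) * 512" by (rule mb[OF bd(1)]) simp
          moreover have "\<bar>2 * real m * (t * F1 n t)\<bar> \<le> 2 * real m * 512" by (rule mb[OF bd(2)]) simp
          ultimately show ?thesis using bd(3)[of t n] unfolding C_def distrib_right by linarith
        qed
        then show ?thesis
          using TB[OF t \<open>t \<le> T\<close>, of "m - 2" "\<bar>real m * real (m - 1) * F0 n t + 2 * real m * (t * F1 n t) + t\<^sup>2 * F2 n t\<bar>"] t
          by (simp add: G''_pos[OF that] abs_mult)
      qed
      ultimately show ?thesis by blast
    qed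
  qed
qed

lemma linear_power_times_radial_derivative:
  fixes \<xi> z :: "'a::real_inner"
  assumes "\<And>t. (g has_real_derivative g' t) (at t)"
  shows "((\<lambda>y. (\<xi> \<bullet> (y - z)) ^ n * g (r - (y - z) \<bullet> (y - z))) has_derivative
    (\<lambda>w. real n * (\<xi> \<bullet> w) * ((\<xi> \<bullet> (y - z)) ^ (n - 1) * g (r - (y - z) \<bullet> (y - z)))
      - 2 * ((y - z) \<bullet> w) * ((\<xi> \<bullet> (y - z)) ^ n * g' (r - (y - z) \<bullet> (y - z))))) (at y)"
proof -
  have "((\<lambda>y. r - (y - z) \<bullet> (y - z)) has_derivative (\<lambda>w. - 2 * ((y - z) \<bullet> w))) (at y)"
    by (auto intro!: derivative_eq_intros simp: inner_commute)
  from has_derivative_compose[OF this assms[unfolded has_field_derivative_def]]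
  have 1: "((\<lambda>y. g (r - (y - z) \<bullet> (y - z))) has_derivative (\<lambda>w. g' (r - (y - z) \<bullet> (y - z)) * (- 2 * ((y - z) \<bullet> w)))) (at y)" .
  have 2: "((\<lambda>y. (\<xi> \<bullet> (y - z)) ^ n) has_derivative (\<lambda>w. real n * (\<xi> \<bullet> w) * (\<xi> \<bullet> (y - z)) ^ (n - 1))) (at y)"
    by (auto intro!: derivative_eq_intros)
  show ?thesis
    by (rule has_derivative_eq_rhs[OF has_derivative_mult[OF 2 1]]) (simp add: fun_eq_iff algebra_simps)
qed

text \<open>Products of a power of a linear form and a radial function are used because the Laplacian maps
them to functions of the same kind: with $L = \xi\cdot(y-z)$, the three terms are the Laplacian of
$L^k$, the mixed term together with the first-order part of the radial Laplacian, and the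
second-order part of the radial Laplacian. Euler's identity $(y-z)\cdot\nabla L^k = kL^k$ keeps
the mixed term in the class.\<close>

lemma laplacian_linear_power_times_radial:
  fixes \<xi> z :: "'a::euclidean_space" and k :: nat and r :: real
  assumes g: "\<And>t. (g has_real_derivative g' t) (at t)" and g': "\<And>t. (g' has_real_derivative g'' t) (at t)"
  defines "\<psi> \<equiv> \<lambda>y. (\<xi> \<bullet> (y - z)) ^ k * g (r - (y - z) \<bullet> (y - z))"
  shows "(\<Sum>b\<in>Basis. frechet_derivative (\<lambda>y. frechet_derivative \<psi> (at y) b) (at y) b) =
    real k * real (k - 1) * (\<xi> \<bullet> \<xi>) * ((\<xi> \<bullet> (y - z)) ^ (k - 2) * g (r - (y - z) \<bullet> (y - z)))
    - (4 * real k + 2 * DIM('a)) * ((\<xi> \<bullet> (y - z)) ^ k * g' (r - (y - z) \<bullet> (y - z)))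
    + 4 * ((y - z) \<bullet> (y - z)) * ((\<xi> \<bullet> (y - z)) ^ k * g'' (r - (y - z) \<bullet> (y - z)))"
proof -
  define L where "L y = \<xi> \<bullet> (y - z)" for y
  define s where "s y = r - (y - z) \<bullet> (y - z)" for y
  note d = linear_power_times_radial_derivative[where \<xi>=\<xi> and z=z and r=r, folded L_def s_def]
  have D1: "frechet_derivative \<psi> (at y) b = (real k * (\<xi> \<bullet> b)) * (L y ^ (k - 1) * g (s y))
      - 2 * (((y - z) \<bullet> b) * (L y ^ k * g' (s y)))" for y b
    using frechet_derivative_at[OF d[of g g' k y, OF g]]
    by (simp add: \<psi>_def L_def[symmetric] s_def[symmetric] fun_eq_iff mult.assoc)
  have D2: "((\<lambda>y. (real k * (\<xi> \<bullet> b)) * (L y ^ (k - 1) * g (s y)) - 2 * (((y - z) \<bullet> b) * (L y ^ k * g' (s y))))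
     has_derivative (\<lambda>w. (real k * (\<xi> \<bullet> b)) * (real (k-1) * (\<xi> \<bullet> w) * (L y ^ (k - 1 - 1) * g (s y))
        - 2 * ((y - z) \<bullet> w) * (L y ^ (k-1) * g' (s y)))
       - 2 * (((y - z) \<bullet> b) * (real k * (\<xi> \<bullet> w) * (L y ^ (k - 1) * g' (s y)) - 2 * ((y - z) \<bullet> w) * (L y ^ k * g'' (s y)))
        + (w \<bullet> b) * (L y ^ k * g' (s y))))) (at y)" for b
    by (intro has_derivative_diff has_derivative_mult_right has_derivative_mult[where f="\<lambda>y. (y - z) \<bullet> b" and f'="\<lambda>w. w \<bullet> b"] d g g')
       (auto intro!: derivative_eq_intros)
  have D2': "frechet_derivative (\<lambda>y. frechet_derivative \<psi> (at y) b) (at y) b =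
      real k * real (k - 1) * (L y ^ (k - 2) * g (s y)) * ((\<xi> \<bullet> b) * (\<xi> \<bullet> b))
      - 4 * real k * L y ^ (k - 1) * g' (s y) * ((\<xi> \<bullet> b) * ((y - z) \<bullet> b))
      - 2 * (L y ^ k * g' (s y)) * (b \<bullet> b)
      + 4 * (L y ^ k * g'' (s y)) * (((y - z) \<bullet> b) * ((y - z) \<bullet> b))" for b
    unfolding D1 frechet_derivative_at[OF D2, symmetric] by (simp add: algebra_simps numeral_2_eq_2)
  have kL: "real k * L y ^ (k - 1) * L y = real k * L y ^ k"
    by (cases k) auto
  have "(\<Sum>b\<in>Basis. frechet_derivative (\<lambda>y. frechet_derivative \<psi> (at y) b) (at y) b) =
      real k * real (k - 1) * (L y ^ (k - 2) * g (s y)) * (\<xi> \<bullet> \<xi>)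
      - 4 * real k * L y ^ (k - 1) * g' (s y) * L y
      - 2 * (L y ^ k * g' (s y)) * DIM('a)
      + 4 * (L y ^ k * g'' (s y)) * ((y - z) \<bullet> (y - z))"
    unfolding D2' sum.distrib sum_subtractf sum_distrib_left[symmetric] L_def
    by (simp add: euclidean_inner[symmetric] inner_Basis)
  also have "4 * real k * L y ^ (k - 1) * g' (s y) * L y = 4 * g' (s y) * (real k * L y ^ (k - 1) * L y)"
    by (simp add: mult_ac)
  finally show ?thesis
    unfolding kL by (simp add: L_def s_def algebra_simps)
qed

section \<open>Moments of eigenfunctions over balls\<close>

text \<open>The recurrence forces $X_j \approx R^{-1}X_{j+1}$ for large \<open>j\<close>, so a nonzero solution behaves like
$R^j$ and cannot be $O(q^j)$ with $q < R$. More precisely, a bound $C\theta^j$ that holds from some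
index on, with $q \le \theta < R$, improves itself by a fixed factor below one.\<close>

lemma geometric_decay_two_step_recurrence:
  fixes X :: "nat \<Rightarrow> 'b::real_normed_vector"
  assumes rec: "\<And>j. j \<ge> j0 \<Longrightarrow> R *\<^sub>R X j = a j *\<^sub>R X (Suc j) + b j *\<^sub>R X (Suc (Suc j))"
    and a: "a \<longlonglongrightarrow> 1" and b: "b \<longlonglongrightarrow> 0"
    and bound: "\<And>j. norm (X j) \<le> C * q ^ j" and q: "0 \<le> q" "q < R"
    and j: "j \<ge> j0"
  shows "X j = 0"
proof -
  \<comment> \<open>A rate \<open>\<theta>\<close> strictly between \<open>q\<close> and \<open>R\<close>, and a factor \<open>\<kappa> < 1\<close> that leaves room above \<open>\<theta> / R\<close>.\<close>
  define \<theta> where "\<theta> = (q + R) / 2"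
  define \<kappa> where "\<kappa> = (\<theta> + R) / (2 * R)"
  have \<theta>: "0 < \<theta>" "q \<le> \<theta>" "\<theta> < R" using q by (auto simp: \<theta>_def)
  have \<kappa>: "0 \<le> \<kappa>" "\<kappa> < 1" "\<theta> < \<kappa> * R" using q \<theta> by (auto simp: \<kappa>_def field_simps)
  have C: "C \<ge> 0" using bound[of 0] norm_ge_zero[of "X 0"] by (simp del: norm_ge_zero)
  have "(\<lambda>j. \<bar>a j\<bar> * \<theta> + \<bar>b j\<bar> * \<theta>\<^sup>2) \<longlonglongrightarrow> \<bar>1\<bar> * \<theta> + \<bar>0\<bar> * \<theta>\<^sup>2"
    by (intro tendsto_intros a b)
  then have "\<forall>\<^sub>F j in sequentially. \<bar>a j\<bar> * \<theta> + \<bar>b j\<bar> * \<theta>\<^sup>2 < \<kappa> * R"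
    using \<kappa>(3) by (intro order_tendstoD) auto
  then obtain N where N: "\<And>j. j \<ge> N \<Longrightarrow> \<bar>a j\<bar> * \<theta> + \<bar>b j\<bar> * \<theta>\<^sup>2 < \<kappa> * R"
    by (auto simp: eventually_sequentially)
  have decay: "norm (X j) \<le> \<kappa> ^ n * (C * \<theta> ^ j)" if "j \<ge> max N j0" for n j
    using that
  proof (induction n arbitrary: j)
    case 0
    have "C * q ^ j \<le> C * \<theta> ^ j" using q \<theta> C by (intro mult_left_mono power_mono) auto
    then show ?case using bound[of j] by simp
  next
    case (Suc n)
    have "R * norm (X j) = norm (R *\<^sub>R X j)" using q by simp
    also have "\<dots> \<le> \<bar>a j\<bar> * norm (X (Suc j)) + \<bar>b j\<bar> * norm (X (Suc (Suc j)))"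
      using Suc.prems by (simp add: rec norm_triangle_le)
    also have "\<dots> \<le> \<bar>a j\<bar> * (\<kappa> ^ n * (C * \<theta> ^ Suc j)) + \<bar>b j\<bar> * (\<kappa> ^ n * (C * \<theta> ^ Suc (Suc j)))"
      using Suc.prems by (intro add_mono mult_left_mono Suc.IH) auto
    also have "\<dots> = (\<bar>a j\<bar> * \<theta> + \<bar>b j\<bar> * \<theta>\<^sup>2) * (\<kappa> ^ n * (C * \<theta> ^ j))"
      by (simp add: algebra_simps power2_eq_square)
    also have "\<dots> \<le> (\<kappa> * R) * (\<kappa> ^ n * (C * \<theta> ^ j))"
      using N[of j] Suc.prems \<kappa> C \<theta> by (intro mult_right_mono mult_nonneg_nonneg zero_le_power) auto
    finally have "R * norm (X j) \<le> R * (\<kappa> ^ Suc n * (C * \<theta> ^ j))"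
      by (simp add: mult_ac)
    then show ?case using q by simp
  qed
  have tail: "X j = 0" if "j \<ge> max N j0" for j
  proof -
    have "(\<lambda>n. \<kappa> ^ n * (C * \<theta> ^ j)) \<longlonglongrightarrow> 0 * (C * \<theta> ^ j)"
      using \<kappa> by (intro tendsto_intros LIMSEQ_power_zero) auto
    then have "norm (X j) \<le> 0"
      using decay[OF that] by (intro tendsto_lowerbound[of _ _ sequentially]) auto
    then show ?thesis by simp
  qed
  \<comment> \<open>The recurrence determines each term from the next two, so the zeros propagate downwards.\<close>
  have "X i = 0 \<and> X (Suc i) = 0" if "j0 \<le> i" "i \<le> max N j0" for i
    using that(2,1)
  proof (induction i rule: inc_induct)
    case base
    then show ?case using tail[OF order_refl] tail[OF le_SucI[OF order_refl]] by blast
  next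
    case (step i)
    then have "R *\<^sub>R X i = 0" by (simp add: rec)
    then show ?case using q step by simp
  qed
  then show ?thesis using tail j by (meson linear)
qed

text \<open>This is the weak equation tested with $L^k s_+^j$, where $L = \xi\cdot(x-z)$ and
$s = \rho^2 - |x-z|^2$, obtained as the limit of smooth test functions. For $j \ge 3$ the profile
$s_+^j$ has a continuous second derivative, so the limits also hold on the boundary sphere.\<close>

lemma ball_moment_identity:
  fixes \<phi> :: "'a::euclidean_space \<Rightarrow> complex" and \<xi> z :: 'a and k j :: nat
  assumes eq: "dirichlet_laplacian S \<phi> (\<lambda>x. of_real m * \<phi> x)" and S: "S \<in> lmeasurable"
    and ball: "cball z \<rho> \<subseteq> S" and \<rho>: "\<rho> > 0" and j: "j \<ge> 3"
  defines "L \<equiv> \<lambda>x. \<xi> \<bullet> (x - z)" and "s \<equiv> \<lambda>x. \<rho>\<^sup>2 - (x - z) \<bullet> (x - z)"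
  shows "(LINT x|lebesgue_on (cball z \<rho>).
    (real k * real (k - 1) * (\<xi> \<bullet> \<xi>) * (L x ^ (k - 2) * s x ^ j)
     - (4 * real k + 2 * DIM('a)) * (L x ^ k * (real j * s x ^ (j - 1)))
     + 4 * ((x - z) \<bullet> (x - z)) * (L x ^ k * (real j * real (j - 1) * s x ^ (j - 2)))
     + m * (L x ^ k * s x ^ j)) *\<^sub>R \<phi> x) = 0"
proof -
  let ?K = "cball z \<rho>"
  obtain G G' G'' :: "nat \<Rightarrow> real \<Rightarrow> real" and B :: real
    where G: "\<And>n. smooth_on UNIV (G n)"
    and dG: "\<And>n t. (G n has_real_derivative G' n t) (at t)"
    and dG': "\<And>n t. (G' n has_real_derivative G'' n t) (at t)"
    and "\<And>n t. t \<le> 1 / real (Suc n) \<Longrightarrow> G n t = 0 \<and> G' n t = 0 \<and> G'' n t = 0"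
    and limG: "\<And>t. t > 0 \<Longrightarrow> (\<lambda>n. G n t) \<longlonglongrightarrow> t ^ j"
    "\<And>t. t > 0 \<Longrightarrow> (\<lambda>n. G' n t) \<longlonglongrightarrow> real j * t ^ (j - 1)"
    "\<And>t. t > 0 \<Longrightarrow> (\<lambda>n. G'' n t) \<longlonglongrightarrow> real j * real (j - 1) * t ^ (j - 2)"
    and B: "\<And>n t. t \<le> \<rho>\<^sup>2 \<Longrightarrow> \<bar>G n t\<bar> \<le> B \<and> \<bar>G' n t\<bar> \<le> B \<and> (j \<ge> 2 \<longrightarrow> \<bar>G'' n t\<bar> \<le> B)"
  proof (rule smooth_approximations_of_power)
    show "1 \<le> j" "0 < \<rho>\<^sup>2" using \<rho> j by auto
  qed (rule that)
  then have G0: "G n t = 0 \<and> G' n t = 0 \<and> G'' n t = 0" if "t \<le> 0" for n t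
    using order.trans[OF that, of "1 / real (Suc n)"] by simp
  have B: "\<bar>G n t\<bar> \<le> B" "\<bar>G' n t\<bar> \<le> B" "\<bar>G'' n t\<bar> \<le> B" if "t \<le> \<rho>\<^sup>2" for n t
    using B[OF that] j by auto
  have limG0: "(\<lambda>n. G n t) \<longlonglongrightarrow> t ^ j" "(\<lambda>n. G' n t) \<longlonglongrightarrow> real j * t ^ (j - 1)"
    "(\<lambda>n. G'' n t) \<longlonglongrightarrow> real j * real (j - 1) * t ^ (j - 2)" if "t \<ge> 0" for t
  proof -
    have "t > 0 \<or> t = 0" using that by linarith
    then show "(\<lambda>n. G n t) \<longlonglongrightarrow> t ^ j" "(\<lambda>n. G' n t) \<longlonglongrightarrow> real j * t ^ (j - 1)"
      "(\<lambda>n. G'' n t) \<longlonglongrightarrow> real j * real (j - 1) * t ^ (j - 2)"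
      using limG G0[of t] j by (auto simp: power_0_left)
  qed
  have in_ball: "x \<in> ?K \<longleftrightarrow> s x \<ge> 0" for x
    using \<rho> by (simp add: s_def dist_norm norm_minus_commute power2_norm_eq_inner[symmetric] power2_le_iff_abs_le)
  define \<psi> where "\<psi> n y = L y ^ k * G n (s y)" for n y
  define w where "w n x = real k * real (k - 1) * (\<xi> \<bullet> \<xi>) * (L x ^ (k - 2) * G n (s x))
     - (4 * real k + 2 * DIM('a)) * (L x ^ k * G' n (s x))
     + 4 * ((x - z) \<bullet> (x - z)) * (L x ^ k * G'' n (s x)) + m * (L x ^ k * G n (s x))" for n x
  define w0 where "w0 x = real k * real (k - 1) * (\<xi> \<bullet> \<xi>) * (L x ^ (k - 2) * s x ^ j)
     - (4 * real k + 2 * DIM('a)) * (L x ^ k * (real j * s x ^ (j - 1)))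
     + 4 * ((x - z) \<bullet> (x - z)) * (L x ^ k * (real j * real (j - 1) * s x ^ (j - 2)))
     + m * (L x ^ k * s x ^ j)" for x
  have test: "test_function S (\<psi> n)" for n
  proof (rule test_functionI[OF _ compact_cball ball])
    have "smooth_on UNIV (\<lambda>y. \<rho>\<^sup>2 + (- 1) * ((y - z) \<bullet> (y - z)))"
      by (intro smooth_add smooth_mult smooth_const smooth_norm_square)
    then have "smooth_on UNIV (\<lambda>y. G n (s y))"
      unfolding s_def by (intro smooth_compose[OF G]) simp
    then show "smooth_on UNIV (\<psi> n)"
      unfolding \<psi>_def L_def by (intro smooth_mult smooth_power smooth_inner)
    show "\<psi> n x = 0" if "x \<notin> ?K" for x
      using that in_ball[of x] G0[of "s x" n] by (simp add: \<psi>_def)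
  qed
  have w0_S: "w n x = 0" if "x \<notin> ?K" for n x
    using that in_ball[of x] G0[of "s x" n] by (simp add: w_def)
  have \<psi>_eq: "\<psi> n = (\<lambda>y. (\<xi> \<bullet> (y - z)) ^ k * G n (\<rho>\<^sup>2 - (y - z) \<bullet> (y - z)))" for n
    by (simp add: \<psi>_def[abs_def] L_def s_def)
  have lap: "(\<Sum>b\<in>Basis. frechet_derivative (\<lambda>y. frechet_derivative (\<psi> n) (at y) b) (at x) b) + m * \<psi> n x = w n x" for n x
    unfolding \<psi>_eq laplacian_linear_power_times_radial[OF dG[of n] dG'[of n]] w_def L_def s_def
    by (rule refl)
  have SL: "S \<in> sets lebesgue" using S by blast
  have "(LINT x|lebesgue_on S. w n x *\<^sub>R \<phi> x) = 0" for n
    using weak_eigenfunction_identity[OF eq test[of n] S] unfolding lap .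
  moreover have "(LINT x|lebesgue_on S. w n x *\<^sub>R \<phi> x) = (LINT x|lebesgue_on ?K. w n x *\<^sub>R \<phi> x)" for n
  proof -
    have "(\<lambda>x. indicator S x *\<^sub>R (w n x *\<^sub>R \<phi> x)) = (\<lambda>x. indicator ?K x *\<^sub>R (w n x *\<^sub>R \<phi> x))"
    proof
      show "indicator S x *\<^sub>R (w n x *\<^sub>R \<phi> x) = indicator ?K x *\<^sub>R (w n x *\<^sub>R \<phi> x)" for x
        using w0_S[of x n] ball by (cases "x \<in> ?K") auto
    qed
    from arg_cong[OF this, of "integral\<^sup>L lebesgue"] show ?thesis
      using SL by (simp add: integral_restrict_space)
  qed
  ultimately have zero: "(LINT x|lebesgue_on ?K. w n x *\<^sub>R \<phi> x) = 0" for n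
    by simp
  have L2: "L2 S \<phi>" using eq by (auto simp: dirichlet_laplacian_def H10_def H1_def)
  have int: "integrable (lebesgue_on ?K) \<phi>"
    using integrable_on_subdomain[OF L2_integrable[OF L2 S] ball SL] by simp
  have Lb: "\<bar>L x ^ i\<bar> \<le> (1 + norm \<xi> * \<rho>) ^ k" if "i \<le> k" "x \<in> ?K" for i x
  proof -
    have "\<bar>L x\<bar> \<le> norm \<xi> * norm (x - z)" unfolding L_def by (rule Cauchy_Schwarz_ineq2)
    also have "\<dots> \<le> norm \<xi> * \<rho>" using that by (intro mult_left_mono) (auto simp: dist_norm norm_minus_commute)
    finally have "\<bar>L x ^ i\<bar> \<le> (1 + norm \<xi> * \<rho>) ^ i" by (simp add: power_abs power_mono)
    also have "\<dots> \<le> (1 + norm \<xi> * \<rho>) ^ k" using \<rho> that by (intro power_increasing) auto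
    finally show ?thesis .
  qed
  define \<Lambda> where "\<Lambda> = (1 + norm \<xi> * \<rho>) ^ k * B"
  define C where "C = real k * real (k - 1) * (\<xi> \<bullet> \<xi>) * \<Lambda> + (4 * real k + 2 * DIM('a)) * \<Lambda> + 4 * \<rho>\<^sup>2 * \<Lambda> + \<bar>m\<bar> * \<Lambda>"
  have wb: "\<bar>w n x\<bar> \<le> C" if x: "x \<in> ?K" for n x
  proof -
    have s: "s x \<le> \<rho>\<^sup>2" by (simp add: s_def)
    have n: "0 \<le> (x - z) \<bullet> (x - z)" "(x - z) \<bullet> (x - z) \<le> \<rho>\<^sup>2" using x in_ball[of x] by (auto simp: s_def)
    have p: "\<bar>L x ^ i * g\<bar> \<le> \<Lambda>" if "i \<le> k" "\<bar>g\<bar> \<le> B" for i g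
      using mult_mono[OF Lb[OF that(1) x] that(2)] \<rho> by (simp add: \<Lambda>_def abs_mult)
    have \<Lambda>: "\<Lambda> \<ge> 0" using p[OF _ B(1)[OF s], of 0 0] by simp
    have "\<bar>real k * real (k - 1) * (\<xi> \<bullet> \<xi>) * (L x ^ (k - 2) * G n (s x))\<bar> \<le> real k * real (k - 1) * (\<xi> \<bullet> \<xi>) * \<Lambda>"
      unfolding abs_mult[of "real k * real (k - 1) * (\<xi> \<bullet> \<xi>)"]
      by (intro mult_mono p B s) auto
    moreover have "\<bar>(4 * real k + 2 * DIM('a)) * (L x ^ k * G' n (s x))\<bar> \<le> (4 * real k + 2 * DIM('a)) * \<Lambda>"
      unfolding abs_mult[of "4 * real k + 2 * DIM('a)"]
      by (intro mult_mono p B s) auto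
    moreover have "\<bar>4 * ((x - z) \<bullet> (x - z)) * (L x ^ k * G'' n (s x))\<bar> \<le> 4 * \<rho>\<^sup>2 * \<Lambda>"
      unfolding abs_mult[of "4 * ((x - z) \<bullet> (x - z))"]
      using n \<Lambda> by (intro mult_mono p B s) auto
    moreover have "\<bar>m * (L x ^ k * G n (s x))\<bar> \<le> \<bar>m\<bar> * \<Lambda>"
      unfolding abs_mult[of m] by (intro mult_mono p B s) auto
    moreover have "\<bar>a - b + c + d\<bar> \<le> \<bar>a\<bar> + \<bar>b\<bar> + \<bar>c\<bar> + \<bar>d\<bar>" for a b c d :: real by linarith
    ultimately show ?thesis unfolding w_def C_def by (meson add_mono order_trans)
  qed
  have KL: "?K \<in> sets lebesgue" by simp
  have cont: "continuous_on ?K w0"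
    unfolding w0_def L_def s_def by (intro continuous_intros)
  have lim: "(\<lambda>n. w n x *\<^sub>R \<phi> x) \<longlonglongrightarrow> w0 x *\<^sub>R \<phi> x" if "x \<in> ?K" for x
    unfolding w_def w0_def using that in_ball[of x]
    by (intro tendsto_intros limG0) auto
  have "(\<lambda>n. LINT x|lebesgue_on ?K. w n x *\<^sub>R \<phi> x) \<longlonglongrightarrow> (LINT x|lebesgue_on ?K. w0 x *\<^sub>R \<phi> x)"
  proof (rule integral_dominated_convergence[where w="\<lambda>x. C * norm (\<phi> x)"])
    show "AE x in lebesgue_on ?K. norm (w n x *\<^sub>R \<phi> x) \<le> C * norm (\<phi> x)" for n
      by (rule AE_I2) (use wb in \<open>auto intro!: mult_right_mono\<close>)
    show "(\<lambda>x. w0 x *\<^sub>R \<phi> x) \<in> borel_measurable (lebesgue_on ?K)"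
      using int continuous_imp_measurable_on_sets_lebesgue[OF cont KL]
      by (intro borel_measurable_scaleR) auto
    show "(\<lambda>x. w n x *\<^sub>R \<phi> x) \<in> borel_measurable (lebesgue_on ?K)" for n
    proof -
      let ?v = "\<lambda>x. (\<Sum>b\<in>Basis. frechet_derivative (\<lambda>y. frechet_derivative (\<psi> n) (at y) b) (at x) b) + m * \<psi> n x"
      have "smooth_on UNIV (\<psi> n)" using test[of n] by (simp add: test_function_def)
      then have "continuous_on UNIV ?v"
        by (intro continuous_intros smooth_imp_continuous smooth_deriv)
      moreover have "?v = w n" by (simp only: lap)
      ultimately have "w n \<in> borel_measurable (lebesgue_on ?K)"
        using continuous_imp_measurable_on_sets_lebesgue[OF continuous_on_subset KL] by (metis subset_UNIV)
      then show ?thesis using int by (intro borel_measurable_scaleR) auto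
    qed
  qed (use int lim in auto)
  then have "(LINT x|lebesgue_on ?K. w0 x *\<^sub>R \<phi> x) = 0"
    using zero LIMSEQ_unique[of "\<lambda>_. 0"] by (simp add: LIMSEQ_const_iff)
  then show ?thesis by (simp add: w0_def)
qed

section \<open>Unique continuation for Dirichlet eigenfunctions\<close>

text \<open>A product of exponentials of linear forms is again one, so their sums form an algebra, and one
that is generated additively by functions with a convergent expansion in the moments.\<close>

inductive_set exponential_sums :: "('a::euclidean_space \<Rightarrow> real) set" where
  exponential: "(\<lambda>x. c * exp (\<xi> \<bullet> x)) \<in> exponential_sums"
| sum: "f \<in> exponential_sums \<Longrightarrow> g \<in> exponential_sums \<Longrightarrow> (\<lambda>x. f x + g x) \<in> exponential_sums"

lemma function_ring_exponential_sums:
  assumes "compact K"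
  shows "function_ring_on (exponential_sums :: ('a::euclidean_space \<Rightarrow> real) set) K"
proof
  show "compact K" by fact
  show "continuous_on K f" if "f \<in> exponential_sums" for f :: "'a \<Rightarrow> real"
    using that by induction (auto intro!: continuous_intros)
  show "(\<lambda>x. f x + g x) \<in> exponential_sums"
    if "f \<in> exponential_sums" "g \<in> exponential_sums" for f g :: "'a \<Rightarrow> real"
    using that by (rule exponential_sums.sum)
  have scale: "(\<lambda>x. (c * exp (\<xi> \<bullet> x)) * g x) \<in> exponential_sums"
    if "g \<in> exponential_sums" for c \<xi> and g :: "'a \<Rightarrow> real"
    using that
  proof induction
    case (exponential d \<zeta>)
    have "(\<lambda>x. (c * exp (\<xi> \<bullet> x)) * (d * exp (\<zeta> \<bullet> x))) = (\<lambda>x. (c * d) * exp ((\<xi> + \<zeta>) \<bullet> x))"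
      by (simp add: inner_add_left exp_add mult_ac)
    then show ?case by (metis exponential_sums.exponential)
  next
    case (sum f g)
    then show ?case by (simp add: distrib_left exponential_sums.sum)
  qed
  show "(\<lambda>x. f x * g x) \<in> exponential_sums"
    if "f \<in> exponential_sums" "g \<in> exponential_sums" for f g :: "'a \<Rightarrow> real"
    using that(1)
  proof induction
    case (exponential c \<xi>)
    then show ?case by (rule scale[OF that(2)])
  next
    case (sum f h)
    then show ?case by (simp add: distrib_right exponential_sums.sum)
  qed
  show "(\<lambda>_. c) \<in> (exponential_sums :: ('a \<Rightarrow> real) set)" for c
    using exponential_sums.exponential[of c 0] by simp
  show "\<exists>f\<in>exponential_sums. f x \<noteq> f y" if "x \<noteq> y" for x y :: 'a
  proof (rule bexI)
    have "(x - y) \<bullet> x - (x - y) \<bullet> y = (x - y) \<bullet> (x - y)" by (simp add: inner_diff_right)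
    then have "(x - y) \<bullet> x \<noteq> (x - y) \<bullet> y" using that by (metis diff_self inner_eq_zero_iff right_minus_eq)
    then show "1 * exp ((x - y) \<bullet> x) \<noteq> 1 * exp ((x - y) \<bullet> y)" by simp
  qed (rule exponential_sums.exponential)
qed

text \<open>Write $I(k,j) = \int \phi\, L^k s^j$ over the ball. Substituting $|x-z|^2 = \rho^2 - s$ in the
moment identity and dividing by the coefficient of $I(k,j)$ gives
$\rho^2 I(k,j) = a_j I(k,j+1) + b_j I(k,j+2)$ with $a_j \to 1$ and $b_j \to 0$, up to a multiple of
$I(k-2,j+2)$, which is zero by induction on \<open>k\<close>. Where \<open>\<phi>\<close> does not vanish,
$s \le \rho^2 - \delta^2$, so the moments decay too fast and are all zero. Summing the exponential
series, $\phi s$ is orthogonal to all exponentials.\<close>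

lemma unique_continuation_ball:
  fixes \<phi> :: "'a::euclidean_space \<Rightarrow> complex"
  assumes eq: "dirichlet_laplacian S \<phi> (\<lambda>x. of_real m * \<phi> x)" and S: "S \<in> lmeasurable"
    and ball: "cball z \<rho> \<subseteq> S" and \<delta>: "\<delta> > 0"
    and zero: "AE x in lebesgue. x \<in> ball z \<delta> \<longrightarrow> \<phi> x = 0"
  shows "AE x in lebesgue. x \<in> ball z \<rho> \<longrightarrow> \<phi> x = 0"
proof (cases "\<delta> < \<rho>")
  case False
  then show ?thesis using zero by eventually_elim (use False in auto)
next
  case True
  then have \<rho>: "\<rho> > 0" using \<delta> by simp
  let ?K = "cball z \<rho>"
  have KL: "?K \<in> sets lebesgue" by simp
  define s where "s x = \<rho>\<^sup>2 - (x - z) \<bullet> (x - z)" for x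
  define M where "M p = (LINT x|lebesgue_on ?K. p x *\<^sub>R \<phi> x)" for p
  have in_ball: "x \<in> ?K \<longleftrightarrow> s x \<ge> 0" "x \<in> ball z \<rho> \<longleftrightarrow> s x > 0" for x
    using \<rho> abs_le_square_iff[of "norm (x - z)" \<rho>] abs_le_square_iff[of \<rho> "norm (x - z)"]
    by (auto simp: s_def dist_norm norm_minus_commute power2_norm_eq_inner[symmetric]
        intro: power_strict_mono power2_less_imp_less)
  have L2: "L2 S \<phi>" using eq by (auto simp: dirichlet_laplacian_def H10_def H1_def)
  have int: "integrable (lebesgue_on ?K) \<phi>"
    using integrable_on_subdomain[OF L2_integrable[OF L2 S] ball fmeasurableD[OF S]] by simp
  have bounded: "\<exists>B. \<forall>x\<in>?K. \<bar>p x\<bar> \<le> B" if "continuous_on ?K p" for p :: "'a \<Rightarrow> real"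
    using compact_imp_bounded[OF compact_continuous_image[OF that compact_cball]]
    by (simp add: bounded_iff)
  have intp: "integrable (lebesgue_on ?K) (\<lambda>x. p x *\<^sub>R \<phi> x)" if "continuous_on ?K p" for p
    using bounded[OF that] integrable_bounded_scaleR[OF int that _ KL] by blast
  have M_add: "M (\<lambda>x. p x + q x) = M p + M q" and M_diff: "M (\<lambda>x. p x - q x) = M p - M q"
    if "continuous_on ?K p" "continuous_on ?K q" for p q
    using that by (simp_all add: M_def scaleR_add_left scaleR_diff_left intp)
  have M_scale: "M (\<lambda>x. c * p x) = c *\<^sub>R M p" for c p
    by (simp add: M_def flip: scaleR_scaleR)
  have moments: "M (\<lambda>x. (\<xi> \<bullet> (x - z)) ^ k * s x ^ j) = 0" if "j \<ge> 1" for \<xi> k j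
    using that
  proof (induction k arbitrary: j rule: less_induct)
    case (less k)
    define L where "L x = \<xi> \<bullet> (x - z)" for x
    define I where "I k j = M (\<lambda>x. L x ^ k * s x ^ j)" for k j
    have contI[continuous_intros]: "continuous_on ?K L" "continuous_on ?K s"
      unfolding L_def s_def by (intro continuous_intros)+
    have low: "(real k * real (k - 1)) *\<^sub>R I (k - 2) j = 0" if "j \<ge> 1" for j
    proof (cases "k \<ge> 2")
      case True
      then show ?thesis using less.IH[of "k - 2" j] that by (simp add: I_def L_def)
    next
      case False
      then have "k = 0 \<or> k = 1" by linarith
      then show ?thesis by auto
    qed
    define a where "a j = 1 + (4 * real k + 2 * DIM('a)) / (4 * (real j + 1))" for j
    define b where "b j = - m / (4 * (real j + 2) * (real j + 1))" for j
    have rec: "\<rho>\<^sup>2 *\<^sub>R I k j = a j *\<^sub>R I k (Suc j) + b j *\<^sub>R I k (Suc (Suc j))" if "j \<ge> 1" for j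
    proof -
      \<comment> \<open>The moment with exponent \<open>j\<close> comes from the second derivative of the profile with exponent \<open>j + 2\<close>.\<close>
      define i where "i = j + 2"
      define A where "A = 4 * real i * real (i - 1)"
      define D where "D = (4 * real k + 2 * DIM('a)) * real i"
      have i: "i - 2 = j" "i - 1 = Suc j" "i = Suc (Suc j)" by (auto simp: i_def)
      have "0 = M (\<lambda>x. real k * real (k - 1) * (\<xi> \<bullet> \<xi>) * (L x ^ (k - 2) * s x ^ i)
     - (4 * real k + 2 * DIM('a)) * (L x ^ k * (real i * s x ^ (i - 1)))
     + 4 * ((x - z) \<bullet> (x - z)) * (L x ^ k * (real i * real (i - 1) * s x ^ (i - 2)))
     + m * (L x ^ k * s x ^ i))"
        using ball_moment_identity[OF eq S ball \<rho>, of i k \<xi>] \<open>j \<ge> 1\<close>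
        by (simp add: M_def L_def s_def i_def)
      also have "\<dots> = M (\<lambda>x. (real k * real (k - 1) * (\<xi> \<bullet> \<xi>)) * (L x ^ (k - 2) * s x ^ i)
          - D * (L x ^ k * s x ^ Suc j) + ((A * \<rho>\<^sup>2) * (L x ^ k * s x ^ j) - A * (L x ^ k * s x ^ Suc j))
          + m * (L x ^ k * s x ^ i))"
        unfolding A_def D_def s_def i(1,2)
        by (intro arg_cong[where f=M] ext) (simp add: algebra_simps)
      also have "\<dots> = (real k * real (k - 1) * (\<xi> \<bullet> \<xi>)) *\<^sub>R I (k - 2) i - D *\<^sub>R I k (Suc j)
          + ((A * \<rho>\<^sup>2) *\<^sub>R I k j - A *\<^sub>R I k (Suc j)) + m *\<^sub>R I k i"
        unfolding I_def M_scale[symmetric]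
        by (subst M_add M_diff; (intro continuous_intros)?)+ simp
      also have "(real k * real (k - 1) * (\<xi> \<bullet> \<xi>)) *\<^sub>R I (k - 2) i = 0"
        using low[of i] by (auto simp: i_def)
      finally have "A *\<^sub>R (\<rho>\<^sup>2 *\<^sub>R I k j) = (D + A) *\<^sub>R I k (Suc j) - m *\<^sub>R I k i"
        by (simp add: algebra_simps)
      also have "\<dots> = A *\<^sub>R (a j *\<^sub>R I k (Suc j) + b j *\<^sub>R I k (Suc (Suc j)))"
      proof -
        have A: "A = 4 * (real j + 2) * (real j + 1)" by (simp add: A_def i_def algebra_simps)
        have "A \<noteq> 0" by (simp add: A_def i_def)
        then have "A * b j = - m" unfolding b_def A[symmetric] by simp
        moreover have "A * a j = D + A"
          unfolding A D_def a_def i_def by (simp add: divide_simps) (simp add: algebra_simps)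
        ultimately show ?thesis by (simp add: scaleR_add_right i(3))
      qed
      finally show ?thesis
        by (rule scaleR_left_imp_eq[rotated]) (simp add: A_def i_def)
    qed
    obtain C where C: "\<And>x. x \<in> ?K \<Longrightarrow> \<bar>L x ^ k\<bar> \<le> C"
      using bounded[OF continuous_on_power[OF contI(1)], of k] by blast
    have C0: "C \<ge> 0" using C[of z] \<rho> by force
    have decay: "norm (I k j) \<le> (C * (LINT x|lebesgue_on ?K. norm (\<phi> x))) * (\<rho>\<^sup>2 - \<delta>\<^sup>2) ^ j" for j
    proof -
      have "AE x in lebesgue_on ?K. norm ((L x ^ k * s x ^ j) *\<^sub>R \<phi> x) \<le> C * (\<rho>\<^sup>2 - \<delta>\<^sup>2) ^ j * norm (\<phi> x)"
      proof -
        have ae: "AE x in lebesgue_on ?K. x \<in> ball z \<delta> \<longrightarrow> \<phi> x = 0"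
          using zero by (subst AE_restrict_space_iff) (auto elim: eventually_mono)
        have bnd: "norm ((L x ^ k * s x ^ j) *\<^sub>R \<phi> x) \<le> C * (\<rho>\<^sup>2 - \<delta>\<^sup>2) ^ j * norm (\<phi> x)"
          if "x \<in> ?K" "x \<notin> ball z \<delta>" for x
        proof -
          have "\<delta>\<^sup>2 \<le> (norm (x - z))\<^sup>2"
            using that \<delta> by (intro power_mono) (auto simp: dist_norm norm_minus_commute)
          then have "\<bar>s x\<bar> \<le> \<rho>\<^sup>2 - \<delta>\<^sup>2"
            using in_ball(1)[of x] that by (simp add: s_def power2_norm_eq_inner)
          then have "\<bar>s x ^ j\<bar> \<le> (\<rho>\<^sup>2 - \<delta>\<^sup>2) ^ j" by (simp add: power_abs power_mono)
          then show ?thesis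
            using C[OF that(1)] C0 by (auto simp: abs_mult intro!: mult_mono mult_right_mono)
        qed
        show ?thesis
          using ae AE_space
        proof eventually_elim
          case (elim x)
          then show ?case using bnd[of x] by (cases "x \<in> ball z \<delta>") auto
        qed
      qed
      then have "norm (I k j) \<le> (LINT x|lebesgue_on ?K. C * (\<rho>\<^sup>2 - \<delta>\<^sup>2) ^ j * norm (\<phi> x))"
        unfolding I_def M_def
        by (intro order.trans[OF integral_norm_bound integral_mono_AE] integrable_norm intp continuous_intros integrable_mult_right int)
      then show ?thesis by (simp add: mult_ac)
    qed
    have "I k j = 0"
    proof (rule geometric_decay_two_step_recurrence[OF rec _ _ decay])
      show "a \<longlonglongrightarrow> 1" unfolding a_def by real_asymp
      show "b \<longlonglongrightarrow> 0" unfolding b_def by real_asymp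
      show "0 \<le> \<rho>\<^sup>2 - \<delta>\<^sup>2" "\<rho>\<^sup>2 - \<delta>\<^sup>2 < \<rho>\<^sup>2" using True \<delta> by (auto intro: power_mono)
    qed (use less.prems in auto)
    then show ?case by (simp add: I_def L_def)
  qed
  have exp_moment: "M (\<lambda>x. exp (\<xi> \<bullet> (x - z)) * s x) = 0" for \<xi>
  proof -
    define L where "L x = \<xi> \<bullet> (x - z)" for x
    have contI[continuous_intros]: "continuous_on ?K L" "continuous_on ?K s"
      unfolding L_def s_def by (intro continuous_intros)+
    define p where "p n x = (\<Sum>k<n. L x ^ k /\<^sub>R fact k) * s x" for n x
    obtain C where C: "\<And>x. x \<in> ?K \<Longrightarrow> \<bar>exp \<bar>L x\<bar> * s x\<bar> \<le> C"
    proof -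
      have "continuous_on ?K (\<lambda>x. exp \<bar>L x\<bar> * s x)" by (intro continuous_intros)
      from bounded[OF this] show ?thesis using that by blast
    qed
    have pC: "\<bar>p n x\<bar> \<le> C" if "x \<in> ?K" for n x
    proof -
      have "\<bar>\<Sum>k<n. L x ^ k /\<^sub>R fact k\<bar> \<le> (\<Sum>k<n. \<bar>L x\<bar> ^ k /\<^sub>R fact k)"
        by (rule order.trans[OF sum_abs]) (simp add: abs_mult power_abs)
      also have "\<dots> \<le> exp \<bar>L x\<bar>"
        unfolding exp_def by (intro sum_le_suminf summable_exp_generic) auto
      finally have "\<bar>p n x\<bar> \<le> \<bar>exp \<bar>L x\<bar> * s x\<bar>"
        unfolding p_def abs_mult by (intro mult_right_mono) auto
      with C[OF that] show ?thesis by simp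
    qed
    have "M (p n) = 0" for n
    proof -
      have "M (p n) = (\<Sum>k<n. M (\<lambda>x. inverse (fact k) * (L x ^ k * s x ^ 1)))"
      proof -
        have "p n x *\<^sub>R \<phi> x = (\<Sum>k<n. (inverse (fact k) * (L x ^ k * s x ^ 1)) *\<^sub>R \<phi> x)" for x
          unfolding scaleR_sum_left[symmetric] by (simp add: p_def sum_distrib_right mult.assoc)
        then show ?thesis
          unfolding M_def by (simp only:) (intro Bochner_Integration.integral_sum intp continuous_intros)
      qed
      also have "\<dots> = 0"
        unfolding M_scale using moments[of 1] by (simp add: L_def)
      finally show ?thesis .
    qed
    moreover have "(\<lambda>n. M (p n)) \<longlonglongrightarrow> M (\<lambda>x. exp (L x) * s x)"
      unfolding M_def
    proof (rule integral_dominated_convergence[where w="\<lambda>x. C * norm (\<phi> x)"])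
      have "(\<lambda>n. p n x) \<longlonglongrightarrow> exp (L x) * s x" for x
        unfolding p_def using exp_converges[of "L x"] by (intro tendsto_mult tendsto_const) (simp add: sums_def)
      then show "AE x in lebesgue_on ?K. (\<lambda>n. p n x *\<^sub>R \<phi> x) \<longlonglongrightarrow> (exp (L x) * s x) *\<^sub>R \<phi> x"
        by (intro AE_I2 tendsto_scaleR tendsto_const)
      show "AE x in lebesgue_on ?K. norm (p n x *\<^sub>R \<phi> x) \<le> C * norm (\<phi> x)" for n
        by (rule AE_I2) (use pC in \<open>auto intro!: mult_right_mono\<close>)
      show "(\<lambda>x. p n x *\<^sub>R \<phi> x) \<in> borel_measurable (lebesgue_on ?K)" for n
        unfolding p_def by (intro borel_measurable_integrable intp continuous_intros)
      show "(\<lambda>x. (exp (L x) * s x) *\<^sub>R \<phi> x) \<in> borel_measurable (lebesgue_on ?K)"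
        by (intro borel_measurable_integrable intp continuous_intros)
    qed (use int in auto)
    ultimately show ?thesis
      unfolding L_def by (simp add: LIMSEQ_const_iff)
  qed
  have conts: "continuous_on ?K s" unfolding s_def by (intro continuous_intros)
  have "AE x in lebesgue_on ?K. s x *\<^sub>R \<phi> x = 0"
  proof (rule AE_zero_if_orthogonal_to_function_ring[OF function_ring_exponential_sums[OF compact_cball] intp[OF conts]])
    fix g :: "'a \<Rightarrow> real" assume g: "g \<in> exponential_sums"
    have "continuous_on ?K g \<and> M (\<lambda>x. g x * s x) = 0"
      using g
    proof induction
      case (exponential c \<xi>)
      have "M (\<lambda>x. (c * exp (\<xi> \<bullet> z)) * (exp (\<xi> \<bullet> (x - z)) * s x)) = 0"
        unfolding M_scale exp_moment by simp
      also have "(\<lambda>x. (c * exp (\<xi> \<bullet> z)) * (exp (\<xi> \<bullet> (x - z)) * s x)) = (\<lambda>x. c * exp (\<xi> \<bullet> x) * s x)"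
        by (simp add: inner_diff_right exp_diff mult.assoc)
      finally show ?case by (auto intro!: continuous_intros)
    next
      case (sum f h)
      then show ?case
        using M_add[of "\<lambda>x. f x * s x" "\<lambda>x. h x * s x"] conts
        by (auto simp: distrib_right intro!: continuous_intros)
    qed
    then show "(LINT x|lebesgue_on ?K. g x *\<^sub>R s x *\<^sub>R \<phi> x) = 0"
      by (simp add: M_def)
  qed
  then have "AE x in lebesgue. x \<in> ?K \<longrightarrow> s x *\<^sub>R \<phi> x = 0"
    by (simp add: AE_restrict_space_iff)
  then show ?thesis
    by eventually_elim (use in_ball in force)
qed

text \<open>The set of points with a neighbourhood on which \<open>\<phi>\<close> vanishes is open, and so is its
complement in \<open>S\<close>: if a point of this set were close to \<open>x\<close>, then a ball around it that
contains \<open>x\<close> would still lie in \<open>S\<close>, and \<open>\<phi>\<close> would vanish on it. Almost everywhere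
statements are passed from balls to \<open>S\<close> by a countable subcover.\<close>

lemma unique_continuation:
  fixes \<phi> :: "'a::euclidean_space \<Rightarrow> complex"
  assumes eq: "dirichlet_laplacian S \<phi> (\<lambda>x. of_real m * \<phi> x)"
    and S: "open S" "connected S" "bounded S"
    and U: "open U" "U \<noteq> {}" "U \<subseteq> S" and zero: "AE x in lebesgue. x \<in> U \<longrightarrow> \<phi> x = 0"
  shows "AE x in lebesgue. x \<in> S \<longrightarrow> \<phi> x = 0"
proof -
  have Sm: "S \<in> lmeasurable" using S by (simp add: lmeasurable_open)
  define Z where "Z = {x \<in> S. \<exists>r>0. AE y in lebesgue. y \<in> ball x r \<longrightarrow> \<phi> y = 0}"
  have "open Z"
    unfolding open_contains_ball
  proof
    fix x assume "x \<in> Z"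
    then obtain r where r: "r > 0" "AE y in lebesgue. y \<in> ball x r \<longrightarrow> \<phi> y = 0" "x \<in> S"
      by (auto simp: Z_def)
    obtain e where e: "e > 0" "ball x e \<subseteq> S" using S r(3) by (meson open_contains_ball)
    have "y \<in> Z" if y: "y \<in> ball x (min e r)" for y
    proof -
      have "ball y (r - dist x y) \<subseteq> ball x r"
        by (rule ball_subset_ball_iff[THEN iffD2]) (simp add: dist_commute)
      then have "AE w in lebesgue. w \<in> ball y (r - dist x y) \<longrightarrow> \<phi> w = 0"
        using r(2) by (elim eventually_mono) blast
      then show ?thesis using y e by (auto simp: Z_def intro!: exI[of _ "r - dist x y"])
    qed
    then show "\<exists>e>0. ball x e \<subseteq> Z" using e r by (intro exI[of _ "min e r"]) auto
  qed
  moreover have "open (S - Z)"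
    unfolding open_contains_ball
  proof
    fix x assume x: "x \<in> S - Z"
    then obtain e where e: "e > 0" "ball x e \<subseteq> S" using S by (meson DiffD1 open_contains_ball)
    \<comment> \<open>A ball of radius \<open>2 * r\<close> around a point within \<open>r\<close> of \<open>x\<close> contains \<open>ball x r\<close> and stays in \<open>S\<close>.\<close>
    define r where "r = e / 4"
    have r: "r > 0" using e by (simp add: r_def)
    have "y \<in> S - Z" if y: "y \<in> ball x r" for y
    proof -
      have "cball y (2 * r) \<subseteq> ball x e"
      proof
        fix w assume "w \<in> cball y (2 * r)"
        then have "dist x w \<le> dist x y + 2 * r" using dist_triangle[of x w y] by simp
        then show "w \<in> ball x e" using y r by (simp add: r_def)
      qed
      then have c: "cball y (2 * r) \<subseteq> S" using e by blast
      have "y \<notin> Z"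
      proof
        assume "y \<in> Z"
        then obtain d where "d > 0" "AE w in lebesgue. w \<in> ball y d \<longrightarrow> \<phi> w = 0" by (auto simp: Z_def)
        from unique_continuation_ball[OF eq Sm c this]
        have "AE w in lebesgue. w \<in> ball x r \<longrightarrow> \<phi> w = 0"
        proof eventually_elim
          case (elim w)
          have "dist y w \<le> dist x y + dist x w" by (metis dist_commute dist_triangle)
          then show ?case using elim y by auto
        qed
        then have "x \<in> Z" using x r by (auto simp: Z_def)
        then show False using x by blast
      qed
      then show ?thesis using c r by force
    qed
    then show "\<exists>e>0. ball x e \<subseteq> S - Z" using r by blast
  qed
  moreover have "U \<subseteq> Z"
  proof
    fix x assume "x \<in> U"
    then obtain e where "e > 0" "ball x e \<subseteq> U" using U by (meson open_contains_ball)
    moreover have "AE y in lebesgue. y \<in> ball x e \<longrightarrow> \<phi> y = 0"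
      using zero by eventually_elim (use \<open>ball x e \<subseteq> U\<close> in blast)
    ultimately show "x \<in> Z" using \<open>x \<in> U\<close> U by (auto simp: Z_def)
  qed
  moreover have "Z \<subseteq> S" by (auto simp: Z_def)
  ultimately have "S \<subseteq> Z"
    using connectedD[OF S(2), of Z "S - Z"] U by blast
  then obtain r where r: "\<And>x. x \<in> S \<Longrightarrow> r x > 0 \<and> (AE y in lebesgue. y \<in> ball x (r x) \<longrightarrow> \<phi> y = 0)"
    unfolding Z_def by (simp add: subset_iff) metis
  obtain F where F: "F \<subseteq> (\<lambda>x. ball x (r x)) ` S" "countable F" "\<Union>F = (\<Union>x\<in>S. ball x (r x))"
    using Lindelof[of "(\<lambda>x. ball x (r x)) ` S"] by auto
  have "AE y in lebesgue. \<forall>B\<in>F. y \<in> B \<longrightarrow> \<phi> y = 0"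
    using F(1) r by (subst AE_ball_countable[OF F(2)]) blast
  then show ?thesis
  proof eventually_elim
    case (elim y)
    show ?case
    proof
      assume "y \<in> S"
      then have "y \<in> \<Union>F" unfolding F(3) using r by force
      then show "\<phi> y = 0" using elim by blast
    qed
  qed
qed

section \<open>Weak derivatives on an interval\<close>

lemma AE_lebesgue_on_box_interior:
  fixes a b :: real
  shows "(AE x in lebesgue_on {a<..<b}. P x) \<longleftrightarrow> (AE x in lebesgue_on {a..b}. P x)"
proof -
  have ne: "AE x in lebesgue. x \<noteq> a \<and> x \<noteq> b"
    by (rule AE_I'[of "{a, b}"]) (auto simp: negligible_iff_null_sets[symmetric] negligible_insert)
  have "(AE x in lebesgue. x \<in> {a<..<b} \<longrightarrow> P x) \<longleftrightarrow> (AE x in lebesgue. x \<in> {a..b} \<longrightarrow> P x)"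
  proof
    assume "AE x in lebesgue. x \<in> {a<..<b} \<longrightarrow> P x"
    with ne show "AE x in lebesgue. x \<in> {a..b} \<longrightarrow> P x" by eventually_elim auto
  next
    assume "AE x in lebesgue. x \<in> {a..b} \<longrightarrow> P x"
    then show "AE x in lebesgue. x \<in> {a<..<b} \<longrightarrow> P x" by eventually_elim auto
  qed
  then show ?thesis by (simp add: AE_restrict_space_iff)
qed

lemma lebesgue_on_open_to_closed:
  fixes a b :: real and f :: "real \<Rightarrow> 'b::euclidean_space"
  assumes "integrable (lebesgue_on {a<..<b}) f"
  shows "integrable (lebesgue_on {a..b}) f"
    and "(LINT x|lebesgue_on {a..b}. f x) = (LINT x|lebesgue_on {a<..<b}. f x)"
proof -
  have int: "integrable lebesgue (\<lambda>x. indicator {a<..<b} x *\<^sub>R f x)"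
    using assms by (simp add: integrable_restrict_space)
  then have m: "(\<lambda>x. indicator {a<..<b} x *\<^sub>R f x) \<in> borel_measurable lebesgue"
    by (rule borel_measurable_integrable)
  have ae: "AE x in lebesgue. indicator {a..b} x *\<^sub>R f x = indicator {a<..<b} x *\<^sub>R f x"
  proof -
    have "AE x in lebesgue. x \<noteq> a \<and> x \<noteq> b"
      by (rule AE_I'[of "{a, b}"]) (auto simp: negligible_iff_null_sets[symmetric] negligible_insert)
    then show ?thesis by eventually_elim (auto simp: indicator_def)
  qed
  have m': "(\<lambda>x. indicator {a..b} x *\<^sub>R f x) \<in> borel_measurable lebesgue"
    by (rule borel_measurable_AE[OF m]) (use ae in \<open>auto elim: eventually_mono\<close>)
  show "integrable (lebesgue_on {a..b}) f"
    using integrable_cong_AE[OF m' m ae] int by (simp add: integrable_restrict_space)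
  show "(LINT x|lebesgue_on {a..b}. f x) = (LINT x|lebesgue_on {a<..<b}. f x)"
    using integral_cong_AE[OF m' m ae] by (simp add: integral_restrict_space)
qed

lemma function_ring_polynomials:
  assumes "compact K"
  shows "function_ring_on (range (poly :: real poly \<Rightarrow> real \<Rightarrow> real)) K"
proof
  show "compact K" by fact
  show "continuous_on K f" if "f \<in> range poly" for f :: "real \<Rightarrow> real"
    using that by (auto intro!: continuous_intros)
  fix f g :: "real \<Rightarrow> real" assume "f \<in> range poly" "g \<in> range poly"
  then obtain p q where [simp]: "f = poly p" "g = poly q" by blast
  show "(\<lambda>x. f x + g x) \<in> range poly" by (intro image_eqI[of _ _ "p + q"]) auto
  show "(\<lambda>x. f x * g x) \<in> range poly" by (intro image_eqI[of _ _ "p * q"]) auto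
next
  show "(\<lambda>_. c) \<in> range poly" for c :: real by (intro image_eqI[of _ _ "[:c:]"]) auto
  show "\<exists>f\<in>range poly. f x \<noteq> f y" if "x \<noteq> y" for x y :: real
    using that by (intro bexI[of _ "poly [:0, 1:]"]) auto
qed

text \<open>The product $Q(y)\,y(H-y)$ is not a test function, since it does not vanish near the endpoints. It is
the limit of the test functions $Q(y)\,G_n(y(H-y))$, where $G_n(t) \to t$ with $G_n' \to 1$
boundedly and $G_n = 0$ near $0$. Only the first derivative is involved, so vanishing to first order
at the endpoints is enough.\<close>

lemma weak_derivative_identity:
  assumes H: "H > 0" and weak: "has_weak_pderiv {0<..<H} 1 u g"
    and Q: "smooth_on UNIV Q" and Q': "\<And>y. (Q has_real_derivative Q' y) (at y)"
  shows "(LINT y|lebesgue_on {0<..<H}. (Q' y * (y * (H - y)) + Q y * (H - 2 * y)) * u y) =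
    - (LINT y|lebesgue_on {0<..<H}. (Q y * (y * (H - y))) * g y)"
proof -
  let ?I = "{0<..<H}"
  have Im: "?I \<in> lmeasurable" by (simp add: lmeasurable_open)
  have L2: "L2 ?I u" "L2 ?I g"
    and test: "\<And>\<psi>. test_function ?I \<psi> \<Longrightarrow> (LINT x|lebesgue_on ?I. frechet_derivative \<psi> (at x) 1 * u x) =
        - (LINT x|lebesgue_on ?I. \<psi> x * g x)"
    using weak by (auto simp: has_weak_pderiv_def)
  have int: "integrable (lebesgue_on ?I) u" "integrable (lebesgue_on ?I) g"
    using L2_integrable[OF _ Im] L2 by auto
  note um = borel_measurable_integrable[OF int(1)] and gm = borel_measurable_integrable[OF int(2)]
  have "1 \<le> (1::nat)" "0 < H\<^sup>2" using H by auto
  then obtain G G' G'' :: "nat \<Rightarrow> real \<Rightarrow> real" and B :: real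
    where G: "\<And>n. smooth_on UNIV (G n)"
    and dG: "\<And>n t. (G n has_real_derivative G' n t) (at t)"
    and dG': "\<And>n t. (G' n has_real_derivative G'' n t) (at t)"
    and G0: "\<And>n t. t \<le> 1 / real (Suc n) \<Longrightarrow> G n t = 0 \<and> G' n t = 0 \<and> G'' n t = 0"
    and limG: "\<And>t. t > 0 \<Longrightarrow> (\<lambda>n. G n t) \<longlonglongrightarrow> t ^ 1"
    "\<And>t. t > 0 \<Longrightarrow> (\<lambda>n. G' n t) \<longlonglongrightarrow> real 1 * t ^ (1 - 1)"
    "\<And>t. t > 0 \<Longrightarrow> (\<lambda>n. G'' n t) \<longlonglongrightarrow> real 1 * real (1 - 1) * t ^ (1 - 2)"
    and B: "\<And>n t. t \<le> H\<^sup>2 \<Longrightarrow> \<bar>G n t\<bar> \<le> B \<and> \<bar>G' n t\<bar> \<le> B \<and> (1 \<ge> (2::nat) \<longrightarrow> \<bar>G'' n t\<bar> \<le> B)"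
  proof (rule smooth_approximations_of_power)
  qed (rule that)
  define s where "s y = y * (H - y)" for y
  define \<psi> where "\<psi> n y = Q y * G n (s y)" for n y
  have ds: "(s has_real_derivative H - 2 * y) (at y)" for y
    unfolding s_def by (auto intro!: derivative_eq_intros)
  have d\<psi>: "(\<psi> n has_real_derivative Q' y * G n (s y) + Q y * (G' n (s y) * (H - 2 * y))) (at y)" for n y
    unfolding \<psi>_def by (auto intro!: derivative_eq_intros Q' DERIV_chain2[OF dG ds])
  have sm: "smooth_on UNIV s"
  proof -
    have "smooth_on UNIV (\<lambda>y::real. (1 \<bullet> (y - 0)) * (H + (- 1) * (1 \<bullet> (y - 0))))"
      by (intro smooth_add smooth_mult smooth_const smooth_inner)
    then show ?thesis by (simp add: s_def[abs_def])
  qed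
  have test\<psi>: "test_function ?I (\<psi> n)" for n
  proof (rule test_functionI)
    let ?K = "{y. s y \<ge> 1 / real (Suc n)}"
    show "smooth_on UNIV (\<psi> n)"
      unfolding \<psi>_def by (intro smooth_mult Q smooth_compose[OF G sm])
    show "\<psi> n y = 0" if "y \<notin> ?K" for y
      using that G0[of "s y" n] by (auto simp: \<psi>_def)
    show sub: "?K \<subseteq> ?I"
    proof
      fix y assume "y \<in> ?K"
      then have "0 < s y" by (auto intro: less_le_trans[rotated])
      then show "y \<in> ?I" using H by (auto simp: s_def zero_less_mult_iff)
    qed
    have "closed ?K" unfolding s_def by (intro closed_Collect_le continuous_intros)
    then show "compact ?K"
      using bounded_subset[OF bounded_box, of ?K 0 H] sub by (auto simp: compact_eq_bounded_closed box_real)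
  qed
  have fd: "frechet_derivative (\<psi> n) (at y) 1 = Q' y * G n (s y) + Q y * (G' n (s y) * (H - 2 * y))" for n y
    using frechet_derivative_at[OF d\<psi>[unfolded has_field_derivative_def]] by (metis mult.right_neutral)
  have cQ: "continuous_on UNIV Q" by (rule smooth_imp_continuous[OF Q])
  have "Q' = (\<lambda>y. frechet_derivative Q (at y) 1)"
    using frechet_derivative_at[OF Q'[unfolded has_field_derivative_def]] by (metis mult.right_neutral)
  then have cQ': "continuous_on UNIV Q'"
    using smooth_imp_continuous[OF smooth_deriv[OF Q, of 1]] by simp
  have "compact ((\<lambda>y. \<bar>Q y\<bar> + \<bar>Q' y\<bar>) ` {0..H})"
    by (intro compact_continuous_image continuous_intros continuous_on_subset[OF cQ] continuous_on_subset[OF cQ']) auto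
  then obtain C where "\<And>y. y \<in> {0..H} \<Longrightarrow> \<bar>\<bar>Q y\<bar> + \<bar>Q' y\<bar>\<bar> \<le> C"
    by (fastforce dest!: compact_imp_bounded simp: bounded_iff)
  then have C: "\<bar>Q y\<bar> \<le> C \<and> \<bar>Q' y\<bar> \<le> C" if "y \<in> {0..H}" for y
    using that by (smt (verit))
  have meas: "w \<in> borel_measurable (lebesgue_on ?I)" if "continuous_on UNIV w" for w :: "real \<Rightarrow> real"
    using that by (intro continuous_imp_measurable_on_sets_lebesgue) (auto intro: continuous_on_subset)
  have lim: "(\<lambda>n. G n (s y)) \<longlonglongrightarrow> s y" "(\<lambda>n. G' n (s y)) \<longlonglongrightarrow> 1" if "y \<in> ?I" for y
    using limG[of "s y"] that by (auto simp: s_def)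
  have bd: "\<bar>G n (s y)\<bar> \<le> B" "\<bar>G' n (s y)\<bar> \<le> B" if "y \<in> {0..H}" for n y
  proof -
    have "y * (H - y) \<le> H * H" using that by (intro mult_mono) auto
    then show "\<bar>G n (s y)\<bar> \<le> B" "\<bar>G' n (s y)\<bar> \<le> B"
      using B[of "s y" n] by (auto simp: s_def power2_eq_square)
  qed
  have C0: "C \<ge> 0" "B \<ge> 0" using C[of 0] bd(1)[of 0 0] H by force+
  have 1: "(\<lambda>n. LINT y|lebesgue_on ?I. frechet_derivative (\<psi> n) (at y) 1 * u y) \<longlonglongrightarrow>
      (LINT y|lebesgue_on ?I. (Q' y * s y + Q y * (1 * (H - 2 * y))) * u y)"
  proof (rule integral_dominated_convergence[where w="\<lambda>y. (C * B + C * (B * H)) * norm (u y)"])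
    show "(\<lambda>y. (Q' y * s y + Q y * (1 * (H - 2 * y))) * u y) \<in> borel_measurable (lebesgue_on ?I)"
      unfolding s_def by (rule borel_measurable_times[OF meas um]) (intro continuous_intros cQ cQ')
    show "(\<lambda>y. frechet_derivative (\<psi> n) (at y) 1 * u y) \<in> borel_measurable (lebesgue_on ?I)" for n
      using test\<psi>[of n] by (intro borel_measurable_times[OF meas um] smooth_imp_continuous smooth_deriv) (simp add: test_function_def)
    show "AE y in lebesgue_on ?I. (\<lambda>n. frechet_derivative (\<psi> n) (at y) 1 * u y) \<longlonglongrightarrow>
        (Q' y * s y + Q y * (1 * (H - 2 * y))) * u y"
      unfolding fd by (rule AE_I2, intro tendsto_intros lim) auto
    show "AE y in lebesgue_on ?I. norm (frechet_derivative (\<psi> n) (at y) 1 * u y) \<le> (C * B + C * (B * H)) * norm (u y)" for n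
    proof (rule AE_I2)
      fix y assume "y \<in> space (lebesgue_on ?I)"
      then have y: "y \<in> {0..H}" by simp
      have "\<bar>Q' y * G n (s y)\<bar> \<le> C * B"
        unfolding abs_mult using C[OF y] bd[OF y] C0 by (intro mult_mono) auto
      moreover have "\<bar>H - 2 * y\<bar> \<le> H" using y by auto
      then have "\<bar>Q y * (G' n (s y) * (H - 2 * y))\<bar> \<le> C * (B * H)"
        unfolding abs_mult using C[OF y] bd[OF y, of n] C0 by (intro mult_mono) auto
      ultimately show "norm (frechet_derivative (\<psi> n) (at y) 1 * u y) \<le> (C * B + C * (B * H)) * norm (u y)"
        unfolding fd norm_mult by (intro mult_right_mono) auto
    qed
  qed (use int in auto)
  have 2: "(\<lambda>n. LINT y|lebesgue_on ?I. \<psi> n y * g y) \<longlonglongrightarrow> (LINT y|lebesgue_on ?I. (Q y * s y) * g y)"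
  proof (rule integral_dominated_convergence[where w="\<lambda>y. (C * B) * norm (g y)"])
    show "(\<lambda>y. (Q y * s y) * g y) \<in> borel_measurable (lebesgue_on ?I)"
      unfolding s_def by (rule borel_measurable_times[OF meas gm]) (intro continuous_intros cQ)
    show "(\<lambda>y. \<psi> n y * g y) \<in> borel_measurable (lebesgue_on ?I)" for n
      using test\<psi>[of n] by (intro borel_measurable_times[OF meas gm] smooth_imp_continuous) (simp add: test_function_def)
    show "AE y in lebesgue_on ?I. (\<lambda>n. \<psi> n y * g y) \<longlonglongrightarrow> (Q y * s y) * g y"
      unfolding \<psi>_def by (rule AE_I2, intro tendsto_intros lim) auto
    show "AE y in lebesgue_on ?I. norm (\<psi> n y * g y) \<le> (C * B) * norm (g y)" for n
    proof (rule AE_I2)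
      fix y assume "y \<in> space (lebesgue_on ?I)"
      then have y: "y \<in> {0..H}" by simp
      have "\<bar>Q y * G n (s y)\<bar> \<le> C * B"
        unfolding abs_mult using C[OF y] bd[OF y] C0 by (intro mult_mono) auto
      then show "norm (\<psi> n y * g y) \<le> (C * B) * norm (g y)"
        unfolding \<psi>_def norm_mult by (intro mult_right_mono) auto
    qed
  qed (use int in auto)
  show ?thesis
    using LIMSEQ_unique[OF 1[unfolded test[OF test\<psi>]] tendsto_minus[OF 2]] by (simp add: s_def)
qed

lemma integrable_mult_continuous:
  fixes f w :: "real \<Rightarrow> real"
  assumes "integrable (lebesgue_on S) f" "continuous_on UNIV w" "bounded S" "S \<in> sets lebesgue"
  shows "integrable (lebesgue_on S) (\<lambda>x. w x * f x)"
proof -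
  have "compact (w ` closure S)"
    using assms by (intro compact_continuous_image) (auto intro: continuous_on_subset simp: compact_closure)
  then obtain B where "\<And>x. x \<in> S \<Longrightarrow> \<bar>w x\<bar> \<le> B"
    using closure_subset[of S] by (fastforce dest!: compact_imp_bounded simp: bounded_iff)
  then show ?thesis
    using integrable_bounded_scaleR[of S f w B] assms by (auto intro: continuous_on_subset)
qed

text \<open>This is Fubini's theorem for $P'(y)\,g(t)$ on the triangle $t \le y$. The boundary terms are zero: at
$H$ by $P(H) = 0$, and at $0$ because the indefinite integral starts there.\<close>

lemma integration_by_parts_indefinite_integral:
  fixes g P P' :: "real \<Rightarrow> real"
  assumes g: "integrable (lebesgue_on {0..H}) g"
    and P: "\<And>y. (P has_real_derivative P' y) (at y)" and P': "continuous_on UNIV P'" and PH: "P H = 0"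
  shows "(LINT y|lebesgue_on {0..H}. P' y * integral {0..y} g) = - (LINT y|lebesgue_on {0..H}. P y * g y)"
proof -
  let ?K = "{0..H}"
  define M where "M = lebesgue_on ?K"
  interpret M: finite_measure M unfolding M_def by (simp add: finite_measure_lebesgue_on)
  interpret pair_sigma_finite M M ..
  have sp: "space M = ?K" by (simp add: M_def)
  have cm: "w \<in> borel_measurable M" if "continuous_on UNIV w" for w :: "real \<Rightarrow> real"
    unfolding M_def using that by (intro continuous_imp_measurable_on_sets_lebesgue) (auto intro: continuous_on_subset)
  have [measurable]: "P' \<in> borel_measurable M" using P' by (rule cm)
  have gm[measurable]: "g \<in> borel_measurable M" using g unfolding M_def by (rule borel_measurable_integrable)
  have id: "(\<lambda>x. x) \<in> borel_measurable M" by (rule cm) (rule continuous_on_id)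
  have [measurable]: "fst \<in> borel_measurable (M \<Otimes>\<^sub>M M)" "snd \<in> borel_measurable (M \<Otimes>\<^sub>M M)"
    using measurable_compose[OF measurable_fst id] measurable_compose[OF measurable_snd id] by auto
  define f where "f y t = (if t \<le> y then P' y * g t else 0)" for y t
  have fm: "case_prod f \<in> borel_measurable (M \<Otimes>\<^sub>M M)"
    unfolding f_def split_beta' by measurable
  have ft: "integrable M (\<lambda>t. f y t)" if "y \<in> space M" for y
  proof (rule Bochner_Integration.integrable_bound[where f="\<lambda>t. P' y * g t"])
    show "integrable M (\<lambda>t. P' y * g t)" using g by (simp add: M_def)
    show "(\<lambda>t. f y t) \<in> borel_measurable M"
      using measurable_Pair2[OF fm that] by simp
  qed (auto simp: f_def)
  have int: "integrable (M \<Otimes>\<^sub>M M) (case_prod f)"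
  proof (rule Fubini_integrable[OF fm])
    obtain B where B: "\<And>y. y \<in> ?K \<Longrightarrow> \<bar>P' y\<bar> \<le> B"
      using compact_imp_bounded[OF compact_continuous_image[OF continuous_on_subset[OF P'] compact_Icc[of 0 H]]]
      by (fastforce simp: bounded_iff)
    show "integrable M (\<lambda>y. LINT t|M. norm (case_prod f (y, t)))"
    proof (rule M.integrable_const_bound[where B="B * (LINT t|M. norm (g t))"])
      show "AE y in M. norm (LINT t|M. norm (case_prod f (y, t))) \<le> B * (LINT t|M. norm (g t))"
      proof (rule AE_I2)
        fix y assume y: "y \<in> space M"
        have "(LINT t|M. norm (f y t)) \<le> (LINT t|M. B * norm (g t))"
          using g B[of y] y by (intro Bochner_Integration.integral_mono integrable_norm ft[OF y])
             (auto simp: M_def f_def abs_mult intro!: mult_right_mono)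
        then show "norm (LINT t|M. norm (case_prod f (y, t))) \<le> B * (LINT t|M. norm (g t))"
          by simp
      qed
      show "(\<lambda>y. LINT t|M. norm (case_prod f (y, t))) \<in> borel_measurable M"
        by (intro M.borel_measurable_lebesgue_integral) (use fm in \<open>simp add: split_beta'\<close>)
    qed
    show "AE y in M. integrable M (\<lambda>t. case_prod f (y, t))"
      by (rule AE_I2) (use ft in simp)
  qed
  have 1: "(LINT t|M. f y t) = P' y * integral {0..y} g" if "y \<in> ?K" for y
  proof -
    have y: "integrable (lebesgue_on {0..y}) g"
      using integrable_on_subdomain[OF g, of "{0..y}"] that by auto
    have "(LINT t|M. f y t) = (LINT t|M. P' y * (indicator {0..y} t * g t))"
      unfolding M_def by (intro Bochner_Integration.integral_cong) (auto simp: f_def indicator_def)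
    also have "\<dots> = P' y * (LINT t|M. indicator {0..y} t * g t)" by simp
    also have "(LINT t|M. indicator {0..y} t * g t) = (LINT t|lebesgue. indicator ?K t * (indicator {0..y} t * g t))"
      by (simp add: M_def integral_restrict_space)
    also have "\<dots> = (LINT t|lebesgue. indicator {0..y} t * g t)"
      using that by (intro Bochner_Integration.integral_cong) (auto simp: indicator_def)
    also have "\<dots> = (LINT t|lebesgue_on {0..y}. g t)" by (simp add: integral_restrict_space)
    also have "\<dots> = integral {0..y} g" using y by (rule lebesgue_integral_eq_integral) simp
    finally show ?thesis .
  qed
  have 2: "(LINT y|M. f y t) = - (P t * g t)" if t: "t \<in> ?K" for t
  proof -
    have "(LINT y|M. f y t) = (LINT y|M. (indicator {t..H} y * P' y) * g t)"
      unfolding M_def by (intro Bochner_Integration.integral_cong) (auto simp: f_def indicator_def)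
    also have "\<dots> = (LINT y|M. indicator {t..H} y * P' y) * g t" by simp
    also have "(LINT y|M. indicator {t..H} y * P' y) = (LINT y|lebesgue. indicator ?K y * (indicator {t..H} y * P' y))"
      by (simp add: M_def integral_restrict_space)
    also have "\<dots> = (LINT y|lebesgue. indicator {t..H} y * P' y)"
      using t by (intro Bochner_Integration.integral_cong) (auto simp: indicator_def)
    also have "\<dots> = (LINT y|lebesgue_on {t..H}. P' y)" by (simp add: integral_restrict_space)
    also have "\<dots> = integral {t..H} P'"
      by (intro lebesgue_integral_eq_integral continuous_imp_integrable_real continuous_on_subset[OF P']) auto
    also have "\<dots> = P H - P t"
      using t P by (intro integral_unique fundamental_theorem_of_calculus)
        (auto simp: has_real_derivative_iff_has_vector_derivative intro: has_vector_derivative_at_within)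
    finally show ?thesis using PH by simp
  qed
  have "(LINT y|M. P' y * integral {0..y} g) = (LINT y|M. LINT t|M. f y t)"
    by (intro Bochner_Integration.integral_cong) (auto simp: 1 sp)
  also have "\<dots> = (LINT t|M. LINT y|M. f y t)"
    using Fubini_integral[OF int] by simp
  also have "\<dots> = (LINT t|M. - (P t * g t))"
    by (intro Bochner_Integration.integral_cong) (auto simp: 2 sp)
  finally show ?thesis by (simp add: M_def)
qed

lemma smooth_poly: "smooth_on UNIV (poly (p :: real poly))"
  by (rule smooth_on_derivative_closed_class[where C="range poly"]) (use poly_DERIV in blast)+

text \<open>Subtract the indefinite integral of \<open>g\<close> from \<open>u\<close>. The difference \<open>w\<close> is orthogonal to the
derivatives of all polynomials that vanish at both endpoints, that is, to all polynomials with mean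
zero. Hence \<open>w\<close> minus its mean is orthogonal to all polynomials.\<close>

lemma weak_derivative_is_indefinite_integral:
  fixes u g :: "real \<Rightarrow> real"
  assumes H: "H > 0" and weak: "has_weak_pderiv {0<..<H} 1 u g"
  shows "integrable (lebesgue_on {0..H}) g"
    and "\<exists>\<kappa>. AE y in lebesgue_on {0..H}. u y = \<kappa> + integral {0..y} g"
proof -
  let ?I = "{0<..<H}" and ?K = "{0..H}"
  have Im: "?I \<in> lmeasurable" by (simp add: lmeasurable_open)
  have L2: "L2 ?I u" "L2 ?I g" using weak by (auto simp: has_weak_pderiv_def)
  have intI: "integrable (lebesgue_on ?I) u" "integrable (lebesgue_on ?I) g"
    using L2_integrable[OF _ Im] L2 by auto
  have int: "integrable (lebesgue_on ?K) u" "integrable (lebesgue_on ?K) g"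
    using lebesgue_on_open_to_closed intI by auto
  show "integrable (lebesgue_on ?K) g" by (rule int)
  define G where "G y = integral {0..y} g" for y
  have "g integrable_on ?K" using integrable_on_lebesgue_on[OF int(2)] by simp
  then have cG: "continuous_on ?K G" unfolding G_def by (rule indefinite_integral_continuous_1)
  have intG: "integrable (lebesgue_on ?K) G" by (rule continuous_imp_integrable_real[OF cG])
  define w where "w y = u y - G y" for y
  have intw: "integrable (lebesgue_on ?K) w" unfolding w_def using int intG by simp
  have mult: "integrable (lebesgue_on ?K) (\<lambda>y. p y * f y)"
    if "continuous_on UNIV p" "integrable (lebesgue_on ?K) f" for p f :: "real \<Rightarrow> real"
    using that by (auto intro!: integrable_mult_continuous)
  have multI: "integrable (lebesgue_on ?I) (\<lambda>y. p y * f y)"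
    if "continuous_on UNIV p" "integrable (lebesgue_on ?I) f" for p f :: "real \<Rightarrow> real"
    using that by (auto intro!: integrable_mult_continuous)
  have orth: "(LINT y|lebesgue_on ?K. (y ^ n - H ^ n / real (n + 1)) * w y) = 0" for n
  proof -
    \<comment> \<open>Chosen such that $q(y)\,y(H-y) = (y^{n+1} - H^n y)/(n+1)$, whose derivative is $y^n$ minus its mean over $(0,H)$.\<close>
    define q where "q = smult (- 1 / real (n + 1)) (\<Sum>i<n. monom (H ^ (n - Suc i)) i)"
    define P where "P y = poly q y * (y * (H - y))" for y
    define P' where "P' y = poly (pderiv q) y * (y * (H - y)) + poly q y * (H - 2 * y)" for y
    have P_eq: "P y = (y ^ (n + 1) - H ^ n * y) / real (n + 1)" for y
    proof -
      have "P y = - (1 / real (n + 1)) * (\<Sum>i<n. H ^ (n - Suc i) * y ^ i) * (y * (H - y))"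
        by (simp add: P_def q_def poly_sum poly_monom)
      also have "\<dots> = ((y - H) * (\<Sum>i<n. H ^ (n - Suc i) * y ^ i)) * y / real (n + 1)"
        by (simp add: divide_simps) (simp add: algebra_simps)
      also have "(y - H) * (\<Sum>i<n. H ^ (n - Suc i) * y ^ i) = y ^ n - H ^ n"
        by (rule power_diff_sumr2[symmetric])
      finally show ?thesis by (simp add: algebra_simps)
    qed
    have dP: "(P has_real_derivative P' y) (at y)" for y
      unfolding P_def P'_def by (auto intro!: derivative_eq_intros)
    have "(P has_real_derivative (real (n + 1) * y ^ n - H ^ n) / real (n + 1)) (at y)" for y
      unfolding P_eq[abs_def]
      using DERIV_cdivide[OF DERIV_diff[OF DERIV_pow[of "n + 1" y] DERIV_cmult_Id[of "H ^ n" y]], of "real (n + 1)"] by simp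
    from DERIV_unique[OF dP this] have P'_eq: "P' y = y ^ n - H ^ n / real (n + 1)" for y
      by (simp add: field_simps)
    have cont: "continuous_on UNIV P" "continuous_on UNIV P'"
      unfolding P_def P'_def by (intro continuous_intros)+
    have "(LINT y|lebesgue_on ?I. P' y * u y) = - (LINT y|lebesgue_on ?I. P y * g y)"
      using weak_derivative_identity[OF H weak smooth_poly[of q] poly_DERIV] by (simp add: P_def P'_def)
    then have 1: "(LINT y|lebesgue_on ?K. P' y * u y) = - (LINT y|lebesgue_on ?K. P y * g y)"
      using lebesgue_on_open_to_closed(2)[OF multI[OF cont(2) intI(1)]]
        lebesgue_on_open_to_closed(2)[OF multI[OF cont(1) intI(2)]] by simp
    have 2: "(LINT y|lebesgue_on ?K. P' y * G y) = - (LINT y|lebesgue_on ?K. P y * g y)"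
      unfolding G_def by (rule integration_by_parts_indefinite_integral[OF int(2) dP cont(2)]) (simp add: P_def)
    have "(LINT y|lebesgue_on ?K. P' y * w y) = (LINT y|lebesgue_on ?K. P' y * u y) - (LINT y|lebesgue_on ?K. P' y * G y)"
      unfolding w_def right_diff_distrib
      by (intro Bochner_Integration.integral_diff mult[OF cont(2)] int intG)
    then show ?thesis using 1 2 by (simp add: P'_eq)
  qed
  define \<kappa> where "\<kappa> = (LINT y|lebesgue_on ?K. w y) / H"
  have pow: "(LINT y|lebesgue_on ?K. y ^ n) = H ^ (n + 1) / real (n + 1)" for n
  proof -
    have "(LINT y|lebesgue_on ?K. y ^ n) = integral ?K (\<lambda>y. y ^ n)"
      by (intro lebesgue_integral_eq_integral continuous_imp_integrable_real continuous_intros) auto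
    also have "\<dots> = H ^ (n + 1) / real (n + 1) - 0 ^ (n + 1) / real (n + 1)"
    proof (intro integral_unique fundamental_theorem_of_calculus)
      show "((\<lambda>y. y ^ (n + 1) / real (n + 1)) has_vector_derivative x ^ n) (at x within ?K)" for x
        using DERIV_cdivide[OF DERIV_pow[of "n + 1" x], of "real (n + 1)"]
        by (auto simp: has_real_derivative_iff_has_vector_derivative intro: has_vector_derivative_at_within)
    qed (use H in simp)
    finally show ?thesis by simp
  qed
  have mono: "(LINT y|lebesgue_on ?K. y ^ n * (w y - \<kappa>)) = 0" for n
  proof -
    have m1: "integrable (lebesgue_on ?K) (\<lambda>y. y ^ n * w y)"
      by (rule mult[OF _ intw]) (intro continuous_intros)
    have m2: "integrable (lebesgue_on ?K) (\<lambda>y. y ^ n :: real)"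
      by (intro continuous_imp_integrable_real continuous_intros)
    have "0 = (LINT y|lebesgue_on ?K. y ^ n * w y - (H ^ n / real (n + 1)) * w y)"
      using orth[of n] by (simp add: left_diff_distrib)
    also have "\<dots> = (LINT y|lebesgue_on ?K. y ^ n * w y) - (H ^ n / real (n + 1)) * (LINT y|lebesgue_on ?K. w y)"
      using m1 intw by simp
    also have "\<dots> = (LINT y|lebesgue_on ?K. y ^ n * w y) - \<kappa> * (LINT y|lebesgue_on ?K. y ^ n)"
      using H by (simp add: \<kappa>_def pow)
    also have "\<dots> = (LINT y|lebesgue_on ?K. y ^ n * w y - \<kappa> * y ^ n)"
      using m1 m2 by simp
    finally show ?thesis by (simp add: algebra_simps)
  qed
  have "AE y in lebesgue_on ?K. w y - \<kappa> = 0"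
  proof (rule AE_zero_if_orthogonal_to_function_ring[OF function_ring_polynomials[OF compact_Icc]])
    show wk: "integrable (lebesgue_on ?K) (\<lambda>y. w y - \<kappa>)"
      by (intro Bochner_Integration.integrable_diff intw continuous_imp_integrable_real continuous_intros)
    fix f :: "real \<Rightarrow> real" assume "f \<in> range poly"
    then obtain p where p: "f = poly p" by blast
    have "(LINT y|lebesgue_on ?K. f y *\<^sub>R (w y - \<kappa>)) =
        (LINT y|lebesgue_on ?K. (\<Sum>i\<le>degree p. coeff p i * (y ^ i * (w y - \<kappa>))))"
      by (simp add: p poly_altdef sum_distrib_right mult.assoc)
    also have "\<dots> = (\<Sum>i\<le>degree p. (LINT y|lebesgue_on ?K. coeff p i * (y ^ i * (w y - \<kappa>))))"
      by (intro Bochner_Integration.integral_sum integrable_mult_right mult[OF _ wk] continuous_intros)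
    also have "\<dots> = 0" by (simp add: mono)
    finally show "(LINT y|lebesgue_on ?K. f y *\<^sub>R (w y - \<kappa>)) = 0" .
  qed
  then have "AE y in lebesgue_on ?K. u y = \<kappa> + integral {0..y} g"
    by eventually_elim (simp add: w_def G_def)
  then show "\<exists>\<kappa>. AE y in lebesgue_on ?K. u y = \<kappa> + integral {0..y} g" ..
qed

section \<open>Mass of oscillating first-order systems\<close>

text \<open>The system $U' = \kappa P V$, $V' = -\kappa Q U$ in integrated form, as the coefficients \<open>P\<close> and
\<open>Q\<close> are in general discontinuous. All estimates depend on them only through the bounds
\<open>p\<close>, \<open>q\<close> and \<open>m\<close>.\<close>

definition oscillator :: "real \<Rightarrow> real \<Rightarrow> real \<Rightarrow> real \<Rightarrow> real set \<Rightarrow> (real \<Rightarrow> real) \<Rightarrow> (real \<Rightarrow> real) \<Rightarrow> bool" where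
  "oscillator \<kappa> p q m T U V \<longleftrightarrow> \<kappa> > 0 \<and> p > 0 \<and> m > 0 \<and> continuous_on T U \<and> continuous_on T V \<and>
    (\<exists>P Q. (\<forall>t. p \<le> P t \<and> P t \<le> q \<and> m \<le> Q t \<and> Q t \<le> 1) \<and>
      (\<forall>x y. x \<le> y \<longrightarrow> {x..y} \<subseteq> T \<longrightarrow>
        ((\<lambda>t. \<kappa> * P t * V t) has_integral (U y - U x)) {x..y} \<and>
        ((\<lambda>t. - (\<kappa> * Q t * U t)) has_integral (V y - V x)) {x..y}))"

lemma oscillator_subset: "oscillator \<kappa> p q m T U V \<Longrightarrow> T' \<subseteq> T \<Longrightarrow> oscillator \<kappa> p q m T' U V"
  unfolding oscillator_def by (meson continuous_on_subset order_trans)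

text \<open>The symmetry by which every estimate is needed for one sign only.\<close>

lemma oscillator_uminus:
  assumes "oscillator \<kappa> p q m T U V"
  shows "oscillator \<kappa> p q m T (\<lambda>x. - U x) (\<lambda>x. - V x)"
proof -
  obtain P Q where PQ: "\<forall>t. p \<le> P t \<and> P t \<le> q \<and> m \<le> Q t \<and> Q t \<le> 1"
    and I: "\<forall>x y. x \<le> y \<longrightarrow> {x..y} \<subseteq> T \<longrightarrow> ((\<lambda>t. \<kappa> * P t * V t) has_integral (U y - U x)) {x..y} \<and>
        ((\<lambda>t. - (\<kappa> * Q t * U t)) has_integral (V y - V x)) {x..y}"
    using assms unfolding oscillator_def by (elim conjE exE) (rule that)
  have "((\<lambda>t. \<kappa> * P t * - V t) has_integral (- U y - - U x)) {x..y} \<and>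
      ((\<lambda>t. - (\<kappa> * Q t * - U t)) has_integral (- V y - - V x)) {x..y}" if "x \<le> y" "{x..y} \<subseteq> T" for x y
    using I[rule_format, OF that, THEN conjunct1, THEN has_integral_neg]
      I[rule_format, OF that, THEN conjunct2, THEN has_integral_neg] by simp
  then show ?thesis
    using assms PQ unfolding oscillator_def by (intro conjI exI[of _ P] exI[of _ Q]) (auto intro: continuous_intros)
qed

lemma has_integral_constant_bounds:
  fixes f :: "real \<Rightarrow> real"
  assumes "(f has_integral i) {x..y}" "x \<le> y"
  shows "(\<And>t. t \<in> {x..y} \<Longrightarrow> B \<le> f t) \<Longrightarrow> B * (y - x) \<le> i"
    and "(\<And>t. t \<in> {x..y} \<Longrightarrow> f t \<le> B) \<Longrightarrow> i \<le> B * (y - x)"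
  using has_integral_le[OF has_integral_const_real[of B x y] assms(1)]
    has_integral_le[OF assms(1) has_integral_const_real[of B x y]] assms(2)
  by (auto simp: mult.commute)

lemma oscillator_mean_value:
  assumes o: "oscillator \<kappa> p q m T U V" and T: "{x..y} \<subseteq> T" and xy: "x \<le> y"
  shows "(\<And>t. t \<in> {x..y} \<Longrightarrow> \<bar>V t\<bar> \<le> v) \<Longrightarrow> \<bar>U y - U x\<bar> \<le> \<kappa> * q * v * (y - x)"
    and "(\<And>t. t \<in> {x..y} \<Longrightarrow> \<bar>U t\<bar> \<le> v) \<Longrightarrow> \<bar>V y - V x\<bar> \<le> \<kappa> * v * (y - x)"
    and "0 \<le> v \<Longrightarrow> (\<And>t. t \<in> {x..y} \<Longrightarrow> V t \<ge> v) \<Longrightarrow> U y - U x \<ge> \<kappa> * p * v * (y - x)"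
    and "0 \<le> v \<Longrightarrow> (\<And>t. t \<in> {x..y} \<Longrightarrow> U t \<ge> v) \<Longrightarrow> V y - V x \<le> - (\<kappa> * m * v * (y - x))"
proof -
  obtain P Q where PQ: "\<forall>t. p \<le> P t \<and> P t \<le> q \<and> m \<le> Q t \<and> Q t \<le> 1"
    and I: "\<forall>x y. x \<le> y \<longrightarrow> {x..y} \<subseteq> T \<longrightarrow> ((\<lambda>t. \<kappa> * P t * V t) has_integral (U y - U x)) {x..y} \<and>
        ((\<lambda>t. - (\<kappa> * Q t * U t)) has_integral (V y - V x)) {x..y}"
    using o unfolding oscillator_def by (elim conjE exE) (rule that)
  have P: "p \<le> P t" "P t \<le> q" and Q: "m \<le> Q t" "Q t \<le> 1" for t using PQ by auto
  have U: "((\<lambda>t. \<kappa> * P t * V t) has_integral (U y - U x)) {x..y}"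
    and V: "((\<lambda>t. - (\<kappa> * Q t * U t)) has_integral (V y - V x)) {x..y}"
    using I xy T by blast+
  have pos: "\<kappa> > 0" "p > 0" "m > 0" "P t > 0" "Q t > 0" for t
    using o less_le_trans[OF _ P(1)] less_le_trans[OF _ Q(1)] by (auto simp: oscillator_def)
  note Ub = has_integral_constant_bounds[OF U xy] and Vb = has_integral_constant_bounds[OF V xy]
  show "\<bar>U y - U x\<bar> \<le> \<kappa> * q * v * (y - x)" if v: "\<And>t. t \<in> {x..y} \<Longrightarrow> \<bar>V t\<bar> \<le> v"
  proof -
    have "\<bar>\<kappa> * P t * V t\<bar> \<le> \<kappa> * q * v" if "t \<in> {x..y}" for t
      unfolding abs_mult using v[OF that] P[of t] pos(1) pos(4)[of t] by (intro mult_mono) auto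
    then have "\<And>t. t \<in> {x..y} \<Longrightarrow> \<kappa> * P t * V t \<le> \<kappa> * q * v" "\<And>t. t \<in> {x..y} \<Longrightarrow> - (\<kappa> * q * v) \<le> \<kappa> * P t * V t"
      by (metis abs_le_D1, metis abs_le_D2 minus_le_iff)
    from Ub(2)[OF this(1)] Ub(1)[OF this(2)] show ?thesis by (simp add: abs_le_iff)
  qed
  show "\<bar>V y - V x\<bar> \<le> \<kappa> * v * (y - x)" if v: "\<And>t. t \<in> {x..y} \<Longrightarrow> \<bar>U t\<bar> \<le> v"
  proof -
    have "\<bar>- (\<kappa> * Q t * U t)\<bar> \<le> \<kappa> * 1 * v" if "t \<in> {x..y}" for t
      unfolding abs_minus_cancel abs_mult using v[OF that] Q[of t] pos(1) pos(5)[of t] by (intro mult_mono) auto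
    then have "\<And>t. t \<in> {x..y} \<Longrightarrow> - (\<kappa> * Q t * U t) \<le> \<kappa> * v" "\<And>t. t \<in> {x..y} \<Longrightarrow> - (\<kappa> * v) \<le> - (\<kappa> * Q t * U t)"
      by (metis abs_le_D1 mult.right_neutral, metis abs_le_D2 minus_le_iff mult.right_neutral)
    from Vb(2)[OF this(1)] Vb(1)[OF this(2)] show ?thesis by (simp add: abs_le_iff)
  qed
  assume v0: "0 \<le> v"
  show "\<kappa> * p * v * (y - x) \<le> U y - U x" if v: "\<And>t. t \<in> {x..y} \<Longrightarrow> v \<le> V t"
    using v v0 P pos by (intro Ub(1) mult_mono) (auto intro: less_imp_le)
  show "V y - V x \<le> - (\<kappa> * m * v * (y - x))" if v: "\<And>t. t \<in> {x..y} \<Longrightarrow> v \<le> U t"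
  proof -
    have "- (\<kappa> * Q t * U t) \<le> - (\<kappa> * m * v)" if "t \<in> {x..y}" for t
      unfolding neg_le_iff_le using v[OF that] v0 Q pos by (intro mult_mono) (auto intro: less_imp_le)
    from Vb(2)[OF this] show ?thesis by simp
  qed
qed

text \<open>If \<open>V\<close> is positive, then \<open>U\<close> increases. When \<open>U\<close> is nonnegative at the midpoint, \<open>V\<close>
decreases on the right half: on the third quarter \<open>U\<close> gains an amount proportional to the
value \<open>v\<close> of \<open>V\<close> at its end, and on the last quarter this makes \<open>V\<close> lose more than \<open>v\<close>.
When \<open>U\<close> is negative at the midpoint, the same argument runs backwards on the left half.\<close>

lemma oscillator_not_positive:
  assumes o: "oscillator \<kappa> p q m {\<alpha>..\<beta>} U V" and ab: "\<alpha> < \<beta>"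
    and long: "p * m * (\<kappa> * (\<beta> - \<alpha>) / 4)\<^sup>2 > 1"
  shows "\<not> (\<forall>x\<in>{\<alpha>..\<beta>}. V x > 0)"
proof
  assume Vpos: "\<forall>x\<in>{\<alpha>..\<beta>}. V x > 0"
  have pos: "\<kappa> > 0" "p > 0" using o by (auto simp: oscillator_def)
  define d where "d = (\<beta> - \<alpha>) / 4"
  have d: "d > 0" "\<beta> = \<alpha> + 4 * d" using ab by (auto simp: d_def field_simps)
  have long': "1 < \<kappa> * m * (\<kappa> * p * d) * d"
    using long by (simp add: d_def power2_eq_square mult_ac)
  have grow: "v < \<kappa> * m * (\<kappa> * p * v * d) * d" if "v > 0" for v
    using mult_strict_left_mono[OF long' that] by (simp add: mult_ac)
  have U_mono: "U x \<le> U y" if "\<alpha> \<le> x" "x \<le> y" "y \<le> \<beta>" for x y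
  proof -
    have "U y - U x \<ge> \<kappa> * p * 0 * (y - x)"
      using Vpos that by (intro oscillator_mean_value(3)[OF o]) (auto intro: less_imp_le)
    then show ?thesis by simp
  qed
  show False
  proof (cases "U (\<alpha> + 2 * d) \<ge> 0")
    case True
    have U0: "U x \<ge> 0" if "\<alpha> + 2 * d \<le> x" "x \<le> \<beta>" for x
      using U_mono[of "\<alpha> + 2 * d" x] True that d by simp
    have V_anti: "V y \<le> V x" if "\<alpha> + 2 * d \<le> x" "x \<le> y" "y \<le> \<beta>" for x y
    proof -
      have "V y - V x \<le> - (\<kappa> * m * 0 * (y - x))"
        using U0 that d by (intro oscillator_mean_value(4)[OF o]) auto
      then show ?thesis by simp
    qed
    define v where "v = V (\<alpha> + 3 * d)"
    have v: "v > 0" using Vpos d by (simp add: v_def)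
    have "V t \<ge> v" if "t \<in> {\<alpha> + 2 * d..\<alpha> + 3 * d}" for t
      unfolding v_def using that d by (intro V_anti) auto
    then have "U (\<alpha> + 3 * d) - U (\<alpha> + 2 * d) \<ge> \<kappa> * p * v * (\<alpha> + 3 * d - (\<alpha> + 2 * d))"
      using d v by (intro oscillator_mean_value(3)[OF o]) auto
    then have u: "U (\<alpha> + 3 * d) \<ge> \<kappa> * p * v * d" using True by (simp add: algebra_simps)
    have "U t \<ge> \<kappa> * p * v * d" if "t \<in> {\<alpha> + 3 * d..\<beta>}" for t
      using U_mono[of "\<alpha> + 3 * d" t] u that d by auto
    then have "V \<beta> - V (\<alpha> + 3 * d) \<le> - (\<kappa> * m * (\<kappa> * p * v * d) * (\<beta> - (\<alpha> + 3 * d)))"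
      using d v pos(1,2) by (intro oscillator_mean_value(4)[OF o]) auto
    then have "V \<beta> - v \<le> - (\<kappa> * m * (\<kappa> * p * v * d) * d)"
      using d by (simp add: v_def)
    moreover have "V \<beta> > 0" using Vpos ab by simp
    ultimately show False using grow[OF v] by linarith
  next
    case False
    have U0: "U x \<le> 0" if "\<alpha> \<le> x" "x \<le> \<alpha> + 2 * d" for x
      using U_mono[of x "\<alpha> + 2 * d"] False that d by simp
    have V_mono: "V x \<le> V y" if "\<alpha> \<le> x" "x \<le> y" "y \<le> \<alpha> + 2 * d" for x y
    proof -
      have "- V y - - V x \<le> - (\<kappa> * m * 0 * (y - x))"
        using U0 that d by (intro oscillator_mean_value(4)[OF oscillator_uminus[OF o]]) auto
      then show ?thesis by simp
    qed
    define v where "v = V (\<alpha> + d)"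
    have v: "v > 0" using Vpos d by (simp add: v_def)
    have "V t \<ge> v" if "t \<in> {\<alpha> + d..\<alpha> + 2 * d}" for t
      unfolding v_def using that d by (intro V_mono) auto
    then have "U (\<alpha> + 2 * d) - U (\<alpha> + d) \<ge> \<kappa> * p * v * (\<alpha> + 2 * d - (\<alpha> + d))"
      using d v by (intro oscillator_mean_value(3)[OF o]) auto
    then have u: "U (\<alpha> + d) \<le> - (\<kappa> * p * v * d)" using False by (simp add: algebra_simps)
    have "U t \<le> - (\<kappa> * p * v * d)" if "t \<in> {\<alpha>..\<alpha> + d}" for t
      using U_mono[of t "\<alpha> + d"] u that d by auto
    then have u': "\<kappa> * p * v * d \<le> - U t" if "t \<in> {\<alpha>..\<alpha> + d}" for t using that by force
    have "- V (\<alpha> + d) - - V \<alpha> \<le> - (\<kappa> * m * (\<kappa> * p * v * d) * (\<alpha> + d - \<alpha>))"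
      using d v pos(1,2) by (intro oscillator_mean_value(4)[OF oscillator_uminus[OF o]] u') auto
    then have "v - V \<alpha> \<ge> \<kappa> * m * (\<kappa> * p * v * d) * d" by (simp add: v_def)
    moreover have "V \<alpha> > 0" using Vpos ab by simp
    ultimately show False using grow[OF v] by linarith
  qed
qed

lemma oscillator_zero:
  assumes o: "oscillator \<kappa> p q m {\<alpha>..\<beta>} U V" and ab: "\<alpha> < \<beta>"
    and long: "p * m * (\<kappa> * (\<beta> - \<alpha>) / 4)\<^sup>2 > 1"
  obtains x where "x \<in> {\<alpha>..\<beta>}" "V x = 0"
proof -
  obtain x y where xy: "x \<in> {\<alpha>..\<beta>}" "y \<in> {\<alpha>..\<beta>}" "V x \<le> 0" "V y \<ge> 0"
    using oscillator_not_positive[OF o ab long] oscillator_not_positive[OF oscillator_uminus[OF o] ab long]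
    by (meson neg_0_less_iff_less not_less)
  have c: "continuous_on {\<alpha>..\<beta>} V" using o by (simp add: oscillator_def)
  have "connected (V ` {\<alpha>..\<beta>})" by (rule connected_continuous_image[OF c connected_Icc])
  then have "0 \<in> V ` {\<alpha>..\<beta>}"
    using connectedD_interval[of "V ` {\<alpha>..\<beta>}" "V x" "V y" 0] xy by blast
  then show ?thesis using that by force
qed

lemma half_interval:
  fixes x \<alpha> \<beta> h :: real
  assumes "x \<in> {\<alpha>..\<beta>}" "0 \<le> h" "h \<le> (\<beta> - \<alpha>) / 2"
  obtains l where "\<alpha> \<le> l" "l + h \<le> \<beta>" "x = l \<or> x = l + h"
proof (cases "x + h \<le> \<beta>")
  case True
  then show ?thesis using that[of x] assms by auto
next
  case False
  then show ?thesis using that[of "x - h"] assms by auto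
qed

text \<open>Let \<open>B\<close> be the largest value of $|U|$ and $|V|$ on the interval. If it is attained by $V$, then
$|V| \ge B/2$ on an interval of rescaled length of order one, across which $U$ changes
by a fixed multiple of \<open>B\<close>. In all cases $|U| \ge \eta B$ at some point, and since $U$ is
Lipschitz with constant $\kappa q B$, it stays above $\eta B/2$ on a fixed fraction of the interval.\<close>

lemma oscillator_mass:
  assumes o: "oscillator \<kappa> p q m {\<alpha>..\<beta>} U V" and ab: "\<alpha> < \<beta>" and A: "A > 0"
    and \<tau>: "0 < \<tau>0" "\<tau>0 \<le> \<kappa> * (\<beta> - \<alpha>)" "\<kappa> * (\<beta> - \<alpha>) \<le> \<tau>1"
    and x: "x \<in> {\<alpha>..\<beta>}" "A \<le> max \<bar>U x\<bar> \<bar>V x\<bar>"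
  defines "\<eta> \<equiv> min 1 (p * min \<tau>0 1 / 8)"
  shows "integral {\<alpha>..\<beta>} (\<lambda>t. (U t)\<^sup>2) \<ge> min (1/2) (\<eta> / (2 * q * \<tau>1)) * \<eta>\<^sup>2 / 4 * A\<^sup>2 * (\<beta> - \<alpha>)"
proof -
  have "p \<le> q" using o unfolding oscillator_def by (meson order_trans)
  then have pos: "\<kappa> > 0" "p > 0" "q > 0" "\<alpha> < \<beta>" "A > 0" using o ab A by (auto simp: oscillator_def)
  have cU: "continuous_on {\<alpha>..\<beta>} U" and cV: "continuous_on {\<alpha>..\<beta>} V"
    using o by (auto simp: oscillator_def)
  have "\<exists>z\<in>{\<alpha>..\<beta>}. \<forall>t\<in>{\<alpha>..\<beta>}. max \<bar>U t\<bar> \<bar>V t\<bar> \<le> max \<bar>U z\<bar> \<bar>V z\<bar>"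
    using pos by (intro continuous_attains_sup continuous_intros cU cV) auto
  then obtain z where z: "z \<in> {\<alpha>..\<beta>}" "\<And>t. t \<in> {\<alpha>..\<beta>} \<Longrightarrow> max \<bar>U t\<bar> \<bar>V t\<bar> \<le> max \<bar>U z\<bar> \<bar>V z\<bar>"
    by blast
  define B where "B = max \<bar>U z\<bar> \<bar>V z\<bar>"
  have AB: "A \<le> B" unfolding B_def by (rule order.trans[OF x(2) z(2)[OF x(1)]])
  have B: "B > 0" using AB pos by simp
  have bd: "\<bar>U t\<bar> \<le> B" "\<bar>V t\<bar> \<le> B" if "t \<in> {\<alpha>..\<beta>}" for t
    using z(2)[OF that] by (auto simp: B_def)
  have \<eta>: "0 < \<eta>" "\<eta> \<le> 1" "\<eta> \<le> p * min \<tau>0 1 / 8" using pos \<tau> by (auto simp: \<eta>_def)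
  obtain w where w: "w \<in> {\<alpha>..\<beta>}" "\<bar>U w\<bar> \<ge> \<eta> * B"
  proof (cases "\<bar>U z\<bar> = B")
    case True
    moreover have "\<eta> * B \<le> 1 * B" using \<eta> B by (intro mult_right_mono) auto
    ultimately show ?thesis using that[of z] z(1) by simp
  next
    case False
    then have Vz: "\<bar>V z\<bar> = B" by (auto simp: B_def max_def split: if_splits)
    \<comment> \<open>On an interval of this length \<open>V\<close> changes by at most \<open>B / 2\<close>, and it fits on one side of \<open>z\<close>.\<close>
    define h where "h = min ((\<beta> - \<alpha>) / 2) (1 / (2 * \<kappa>))"
    have h: "0 < h" "h \<le> (\<beta> - \<alpha>) / 2" "\<kappa> * h \<le> 1 / 2" using pos by (auto simp: h_def min_def field_simps)
    have \<kappa>h: "\<kappa> * h \<ge> min \<tau>0 1 / 2"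
      using pos \<tau> by (auto simp: h_def min_def field_simps)
    obtain l where l: "\<alpha> \<le> l" "l + h \<le> \<beta>" "z = l \<or> z = l + h"
      using half_interval[OF z(1) less_imp_le[OF h(1)] h(2)] .
    have near: "\<bar>V t - V z\<bar> \<le> B / 2" if t: "t \<in> {l..l + h}" for t
    proof -
      \<comment> \<open>The Lipschitz estimate is available for ordered endpoints only.\<close>
      define r s where "r = min t z" and "s = max t z"
      have rs: "l \<le> r" "r \<le> s" "s \<le> l + h" using t l h by (auto simp: r_def s_def)
      have "\<bar>V s - V r\<bar> \<le> \<kappa> * B * (s - r)"
        using rs l by (intro oscillator_mean_value(2)[OF o] bd) auto
      also have "\<dots> \<le> \<kappa> * B * h" using rs pos B by (intro mult_left_mono) auto
      also have "\<dots> \<le> B / 2" using h(3) B by (simp add: mult.commute mult.left_commute field_simps)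
      finally show ?thesis by (auto simp: r_def s_def min_def max_def abs_minus_commute split: if_splits)
    qed
    have diff: "\<bar>U (l + h) - U l\<bar> \<ge> \<kappa> * p * (B / 2) * h"
    proof (cases "V z > 0")
      case True
      then have "V t \<ge> B / 2" if "t \<in> {l..l+h}" for t using near[OF that] Vz by linarith
      then have "U (l + h) - U l \<ge> \<kappa> * p * (B / 2) * (l + h - l)"
        using l h B by (intro oscillator_mean_value(3)[OF o]) auto
      then show ?thesis unfolding add_diff_cancel_left' by linarith
    next
      case False
      then have "B / 2 \<le> - V t" if "t \<in> {l..l+h}" for t using near[OF that] Vz by linarith
      then have "- U (l + h) - - U l \<ge> \<kappa> * p * (B / 2) * (l + h - l)"
        using l h B by (intro oscillator_mean_value(3)[OF oscillator_uminus[OF o]]) auto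
      then show ?thesis unfolding add_diff_cancel_left' by linarith
    qed
    have "2 * (\<eta> * B) \<le> 2 * (p * min \<tau>0 1 / 8 * B)" using \<eta> B by simp
    also have "\<dots> = (min \<tau>0 1 / 2) * (p * (B / 2))" by simp
    also have "\<dots> \<le> (\<kappa> * h) * (p * (B / 2))" using \<kappa>h pos B by (intro mult_right_mono) auto
    also have "\<dots> = \<kappa> * p * (B / 2) * h" by simp
    finally have "2 * (\<eta> * B) \<le> \<bar>U (l + h) - U l\<bar>" using diff by linarith
    then have "\<eta> * B \<le> \<bar>U (l + h)\<bar> \<or> \<eta> * B \<le> \<bar>U l\<bar>" by linarith
    then show ?thesis using that[of l] that[of "l + h"] l h by auto
  qed
  \<comment> \<open>On an interval of this length \<open>U\<close> changes by at most \<open>\<eta> * B / 2\<close>.\<close>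
  define h where "h = min ((\<beta> - \<alpha>) / 2) (\<eta> / (2 * \<kappa> * q))"
  have h: "0 < h" "h \<le> (\<beta> - \<alpha>) / 2" "\<kappa> * q * h \<le> \<eta> / 2"
    using pos \<eta> by (auto simp: h_def min_def field_simps)
  have hb: "h \<ge> min (1/2) (\<eta> / (2 * q * \<tau>1)) * (\<beta> - \<alpha>)"
  proof -
    have "\<eta> / (2 * q * \<tau>1) * (\<beta> - \<alpha>) \<le> \<eta> / (2 * \<kappa> * q)"
    proof -
      have "\<eta> / (2 * q * \<tau>1) * (\<beta> - \<alpha>) = \<eta> / (2 * \<kappa> * q) * (\<kappa> * (\<beta> - \<alpha>) / \<tau>1)"
        using pos by (simp add: divide_simps)
      also have "\<dots> \<le> \<eta> / (2 * \<kappa> * q) * 1"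
        using \<tau> pos \<eta> by (intro mult_left_mono) (auto simp: divide_le_eq_1)
      finally show ?thesis by simp
    qed
    moreover have "min (1/2) (\<eta> / (2 * q * \<tau>1)) * (\<beta> - \<alpha>) \<le> 1/2 * (\<beta> - \<alpha>)"
      using pos by (intro mult_right_mono) auto
    moreover have "min (1/2) (\<eta> / (2 * q * \<tau>1)) * (\<beta> - \<alpha>) \<le> \<eta> / (2 * q * \<tau>1) * (\<beta> - \<alpha>)"
      using pos by (intro mult_right_mono) auto
    ultimately show ?thesis by (simp add: h_def)
  qed
  obtain l where l: "\<alpha> \<le> l" "l + h \<le> \<beta>" "w = l \<or> w = l + h"
    using half_interval[OF w(1) less_imp_le[OF h(1)] h(2)] .
  have big: "(\<eta> * B / 2)\<^sup>2 \<le> (U t)\<^sup>2" if t: "t \<in> {l..l + h}" for t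
  proof -
    define r s where "r = min t w" and "s = max t w"
    have rs: "l \<le> r" "r \<le> s" "s \<le> l + h" using t l h by (auto simp: r_def s_def)
    have "\<bar>U s - U r\<bar> \<le> \<kappa> * q * B * (s - r)"
      using rs l by (intro oscillator_mean_value(1)[OF o] bd) auto
    also have "\<dots> \<le> \<kappa> * q * B * h" using rs pos B by (intro mult_left_mono) auto
    also have "\<dots> = (\<kappa> * q * h) * B" by simp
    also have "\<dots> \<le> \<eta> / 2 * B" using h(3) B by (intro mult_right_mono) auto
    finally have "\<bar>U t - U w\<bar> \<le> \<eta> * B / 2" by (auto simp: r_def s_def min_def max_def abs_minus_commute split: if_splits)
    then have "\<eta> * B / 2 \<le> \<bar>U t\<bar>" using w(2) by linarith
    then show ?thesis using \<eta> B by (intro abs_le_square_iff[THEN iffD1]) simp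
  qed
  have c2: "continuous_on {\<alpha>..\<beta>} (\<lambda>t. (U t)\<^sup>2)" by (intro continuous_intros cU)
  have "min (1/2) (\<eta> / (2 * q * \<tau>1)) * \<eta>\<^sup>2 / 4 * A\<^sup>2 * (\<beta> - \<alpha>) =
      (min (1/2) (\<eta> / (2 * q * \<tau>1)) * (\<beta> - \<alpha>)) * (\<eta> * A / 2)\<^sup>2"
    by (simp add: power_mult_distrib power_divide)
  also have "\<dots> \<le> h * (\<eta> * B / 2)\<^sup>2"
    using hb h AB pos \<eta> by (intro mult_mono power_mono) auto
  also have "\<dots> = integral {l..l + h} (\<lambda>t. (\<eta> * B / 2)\<^sup>2)" using h by simp
  also have "\<dots> \<le> integral {l..l + h} (\<lambda>t. (U t)\<^sup>2)"
    using l by (intro integral_le big integrable_continuous_interval continuous_on_subset[OF c2]) auto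
  also have "\<dots> \<le> integral {\<alpha>..\<beta>} (\<lambda>t. (U t)\<^sup>2)"
    using l by (intro integral_subset_le integrable_continuous_interval continuous_on_subset[OF c2]) auto
  finally show ?thesis .
qed

lemma integral_equal_pieces:
  fixes f :: "real \<Rightarrow> real"
  assumes "d > 0" "f integrable_on {a..a + real n * d}"
    and "\<And>i. i < n \<Longrightarrow> integral {a + real i * d..a + real (Suc i) * d} f \<ge> C"
  shows "integral {a..a + real n * d} f \<ge> real n * C"
  using assms(2,3)
proof (induction n)
  case (Suc n)
  let ?m = "a + real n * d" and ?e = "a + real (Suc n) * d"
  have le: "a \<le> ?m" "?m \<le> ?e" using assms(1) by (auto simp: algebra_simps)
  have "f integrable_on {a..?m}"
    using integrable_on_subinterval[OF Suc.prems(1)] le by auto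
  then have "integral {a..?m} f \<ge> real n * C" using Suc by simp
  moreover have "integral {?m..?e} f \<ge> C" using Suc.prems(2)[of n] by simp
  moreover have "integral {a..?m} f + integral {?m..?e} f = integral {a..?e} f"
    using le Suc.prems(1) by (intro Henstock_Kurzweil_Integration.integral_combine)
  ultimately show ?case by (simp add: algebra_simps)
qed simp

text \<open>The rescaled length $l$ is chosen so large that every interval of this length contains a zero of
\<open>V\<close>. If $\kappa(b-a) \ge l$, the interval is cut into equal pieces of rescaled length between $l$
and $2l$, and each piece contributes a fixed multiple of $r^2$ times its length. Otherwise \<open>\<kappa>\<close>
lies between $\kappa_0$ and $l/(b-a)$, and the hypothesis at the single point \<open>a\<close> bounds the
amplitude from below.\<close>

lemma oscillator_uniform_mass:
  fixes p q m r \<kappa>0 a b :: real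
  assumes pos: "p > 0" "q > 0" "m > 0" "r > 0" "\<kappa>0 > 0" "a < b"
  shows "\<exists>C>0. \<forall>\<kappa> U V. \<kappa>0 \<le> \<kappa> \<longrightarrow> oscillator \<kappa> p q m {a..b} U V \<longrightarrow>
      (\<forall>y\<in>{a..b}. r\<^sup>2 \<le> (U y)\<^sup>2 + (\<kappa> * V y)\<^sup>2) \<longrightarrow> C \<le> integral {a..b} (\<lambda>y. (U y)\<^sup>2)"
proof -
  define c where "c \<tau>0 \<tau>1 = min (1/2) (min 1 (p * min \<tau>0 1 / 8) / (2 * q * \<tau>1)) * (min 1 (p * min \<tau>0 1 / 8))\<^sup>2 / 4" for \<tau>0 \<tau>1 :: real
  have c: "c \<tau>0 \<tau>1 > 0" if "\<tau>0 > 0" "\<tau>1 > 0" for \<tau>0 \<tau>1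
  proof -
    have 1: "0 < min 1 (p * min \<tau>0 1 / 8)" using that pos by simp
    then have "0 < min 1 (p * min \<tau>0 1 / 8) / (2 * q * \<tau>1)"
      by (rule divide_pos_pos) (use that pos in simp)
    then have "0 < min (1/2) (min 1 (p * min \<tau>0 1 / 8) / (2 * q * \<tau>1))" by simp
    from mult_pos_pos[OF this zero_less_power[OF 1, of 2]] show ?thesis by (simp add: c_def)
  qed
  \<comment> \<open>Twice the threshold of \<open>oscillator_zero\<close>, whose condition reads $pm\,(l/4)^2 > 1$.\<close>
  define l where "l = 8 / sqrt (p * m)"
  have l: "l > 0" "p * m * (l / 4)\<^sup>2 = 4" using pos by (auto simp: l_def power_divide)
  \<comment> \<open>If $\kappa \le l/(b-a)$ and $|U|, |V| \le M$, then $U^2 + \kappa^2V^2 \le M^2(1 + (l/(b-a))^2)$.\<close>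
  define A where "A = r / sqrt (1 + (l / (b - a))\<^sup>2)"
  have A: "A > 0" using pos by (auto simp: A_def intro!: divide_pos_pos add_pos_nonneg)
  define C where "C = min (c l (2 * l) * r\<^sup>2 * (b - a)) (c (\<kappa>0 * (b - a)) l * A\<^sup>2 * (b - a))"
  have "C > 0" using c l pos A by (auto simp: C_def)
  moreover have "C \<le> integral {a..b} (\<lambda>y. (U y)\<^sup>2)"
    if \<kappa>: "\<kappa>0 \<le> \<kappa>" and o: "oscillator \<kappa> p q m {a..b} U V"
      and amp: "\<And>y. y \<in> {a..b} \<Longrightarrow> r\<^sup>2 \<le> (U y)\<^sup>2 + (\<kappa> * V y)\<^sup>2" for \<kappa> U V
  proof (cases "l \<le> \<kappa> * (b - a)")
    case True
    define n where "n = nat \<lfloor>\<kappa> * (b - a) / l\<rfloor>"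
    have ge1: "\<kappa> * (b - a) / l \<ge> 1" using True l by simp
    have n: "n \<ge> 1" "real n \<le> \<kappa> * (b - a) / l" "\<kappa> * (b - a) / l < real n + 1"
      using ge1 by (auto simp: n_def le_nat_floor)
    define d where "d = (b - a) / real n"
    have d: "d > 0" "a + real n * d = b" using n pos by (auto simp: d_def)
    have \<kappa>d: "l \<le> \<kappa> * d" "\<kappa> * d \<le> 2 * l"
    proof -
      have "real n * l \<le> \<kappa> * (b - a)" using n(2) l by (simp add: field_simps)
      then show "l \<le> \<kappa> * d" using n(1) by (simp add: d_def field_simps)
      have "\<kappa> * (b - a) < (real n + 1) * l" using n(3) l by (simp add: field_simps)
      also have "\<dots> \<le> (2 * real n) * l" using n(1) l by (intro mult_right_mono) auto
      finally show "\<kappa> * d \<le> 2 * l" using n(1) by (simp add: d_def field_simps)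
    qed
    have piece: "integral {a + real i * d..a + real (Suc i) * d} (\<lambda>y. (U y)\<^sup>2) \<ge> c l (2 * l) * r\<^sup>2 * d" if i: "i < n" for i
    proof -
      define \<alpha> where "\<alpha> = a + real i * d"
      have \<beta>: "a + real (Suc i) * d = \<alpha> + d" by (simp add: \<alpha>_def algebra_simps)
      have "a + real (Suc i) * d \<le> a + real n * d" using i d by (intro add_left_mono mult_right_mono) auto
      then have "\<alpha> + d \<le> b" unfolding \<beta> d(2) .
      moreover have "a \<le> \<alpha>" using d by (simp add: \<alpha>_def)
      ultimately have sub: "{\<alpha>..\<alpha> + d} \<subseteq> {a..b}" by auto
      note o' = oscillator_subset[OF o sub]
      have "p * m * (\<kappa> * (\<alpha> + d - \<alpha>) / 4)\<^sup>2 \<ge> p * m * (l / 4)\<^sup>2"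
        using \<kappa>d l pos by (intro mult_left_mono power_mono) auto
      then have "p * m * (\<kappa> * (\<alpha> + d - \<alpha>) / 4)\<^sup>2 > 1" using l by simp
      then obtain x where x: "x \<in> {\<alpha>..\<alpha> + d}" "V x = 0"
        using oscillator_zero[OF o'] d by auto
      have "r\<^sup>2 \<le> (U x)\<^sup>2" using amp[of x] x sub by auto
      then have "r \<le> \<bar>U x\<bar>" using pos by (metis abs_le_square_iff abs_of_pos)
      then have "r \<le> max \<bar>U x\<bar> \<bar>V x\<bar>" by simp
      from oscillator_mass[OF o' _ pos(4) l(1) _ _ x(1) this, of "2 * l"]
      show ?thesis
        unfolding \<beta> \<alpha>_def[symmetric] c_def using \<kappa>d d by simp
    qed
    have "continuous_on {a..b} (\<lambda>y. (U y)\<^sup>2)"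
      using o by (auto simp: oscillator_def intro!: continuous_intros)
    then have "(\<lambda>y. (U y)\<^sup>2) integrable_on {a..a + real n * d}"
      unfolding d(2) by (rule integrable_continuous_interval)
    from integral_equal_pieces[OF d(1) this piece]
    have "real n * (c l (2 * l) * r\<^sup>2 * d) \<le> integral {a..b} (\<lambda>y. (U y)\<^sup>2)" unfolding d(2) .
    moreover have "real n * (c l (2 * l) * r\<^sup>2 * d) = c l (2 * l) * r\<^sup>2 * (b - a)"
      using n(1) by (simp add: d_def)
    ultimately show ?thesis by (simp add: C_def)
  next
    case False
    have \<kappa>p: "\<kappa> > 0" using \<kappa> pos by simp
    define M where "M = max \<bar>U a\<bar> \<bar>V a\<bar>"
    have M: "M \<ge> 0" "\<bar>U a\<bar> \<le> M" "\<bar>V a\<bar> \<le> M" by (auto simp: M_def)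
    have \<kappa>l: "\<kappa> \<le> l / (b - a)" using False pos by (simp add: field_simps)
    have "r\<^sup>2 \<le> (U a)\<^sup>2 + (\<kappa> * V a)\<^sup>2" using amp[of a] pos by simp
    also have "\<dots> \<le> M\<^sup>2 + (l / (b - a) * M)\<^sup>2"
    proof (intro add_mono)
      show "(U a)\<^sup>2 \<le> M\<^sup>2" using M by (intro abs_le_square_iff[THEN iffD1]) auto
      have "\<bar>\<kappa> * V a\<bar> \<le> l / (b - a) * M"
        unfolding abs_mult using \<kappa>l \<kappa>p M l pos by (intro mult_mono) auto
      then show "(\<kappa> * V a)\<^sup>2 \<le> (l / (b - a) * M)\<^sup>2"
        by (metis abs_le_square_iff abs_ge_self order_trans)
    qed
    also have "\<dots> = (sqrt (1 + (l / (b - a))\<^sup>2) * M)\<^sup>2"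
      unfolding power_mult_distrib by (simp add: distrib_right)
    finally have "r \<le> sqrt (1 + (l / (b - a))\<^sup>2) * M"
      by (rule power2_le_imp_le) (intro mult_nonneg_nonneg real_sqrt_ge_zero add_nonneg_nonneg M zero_le_one zero_le_power2)
    then have "A \<le> M"
      unfolding A_def by (subst pos_divide_le_eq) (auto intro: add_pos_nonneg simp: mult.commute)
    then have "A \<le> max \<bar>U a\<bar> \<bar>V a\<bar>" by (simp add: M_def)
    from oscillator_mass[OF o pos(6) A _ _ _ _ this, of "\<kappa>0 * (b - a)" l]
    have "c (\<kappa>0 * (b - a)) l * A\<^sup>2 * (b - a) \<le> integral {a..b} (\<lambda>y. (U y)\<^sup>2)"
      using False \<kappa> pos by (simp add: c_def)
    then show ?thesis by (simp add: C_def)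
  qed
  ultimately show ?thesis by blast
qed

section \<open>The first-order system of a reduced eigenfunction\<close>

lemma coeff_class_bounds:
  assumes "c \<in> coeff_class H c\<^sub>m c\<^sub>M"
  shows "AE y in lebesgue_on {0..H}. c\<^sub>m \<le> c y \<and> c y \<le> c\<^sub>M"
proof -
  have "AE y in lebesgue_on {0..H}. ereal (c y) \<le> ereal c\<^sub>M"
    using esssup_AE[of "\<lambda>y. ereal (c y)" "lebesgue_on {0..H}"] assms by (simp add: coeff_class_def)
  moreover have "AE y in lebesgue_on {0..H}. - ereal (c y) \<le> - ereal c\<^sub>m"
  proof -
    have "esssup (lebesgue_on {0..H}) (\<lambda>y. - ereal (c y)) = - ereal c\<^sub>m"
      using assms by (auto simp: coeff_class_def essinf_def ereal_uminus_eq_reorder)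
    then show ?thesis using esssup_AE[of "\<lambda>y. - ereal (c y)" "lebesgue_on {0..H}"] by simp
  qed
  ultimately show ?thesis by eventually_elim auto
qed

text \<open>This makes the choice in the definition of \<open>continuous_rep\<close> irrelevant.\<close>

lemma continuous_AE_eq_imp_eq:
  fixes f g :: "real \<Rightarrow> real"
  assumes "H > 0" "continuous_on {0..H} f" "continuous_on {0..H} g"
    and ae: "AE y in lebesgue_on {0..H}. f y = g y" and y: "y \<in> {0..H}"
  shows "f y = g y"
proof -
  have int: "integrable (lebesgue_on {0..H}) (\<lambda>y. (f y - g y)\<^sup>2)"
    by (intro continuous_imp_integrable_real continuous_intros assms)
  have "(LINT y|lebesgue_on {0..H}. (f y - g y)\<^sup>2) = (LINT y|lebesgue_on {0..H}. 0)"
    using int by (intro integral_cong_AE) (use ae in \<open>auto elim: eventually_mono\<close>)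
  then have "integral {0..H} (\<lambda>y. (f y - g y)\<^sup>2) = 0"
    using lebesgue_integral_eq_integral[OF int] by simp
  moreover have "(\<lambda>y. (f y - g y)\<^sup>2) integrable_on {0..H}"
    by (intro integrable_continuous_interval continuous_intros assms)
  ultimately have "((\<lambda>y. (f y - g y)\<^sup>2) has_integral 0) (cbox 0 H)"
    by (simp add: has_integral_integral)
  then have "(f y - g y)\<^sup>2 = 0"
    using assms by (intro has_integral_0_cbox_imp_0[of 0 H "\<lambda>y. (f y - g y)\<^sup>2"]) (auto intro!: continuous_intros)
  then show ?thesis by simp
qed

lemma AE_lebesgue_on_imp_negligible:
  assumes "AE y in lebesgue_on S. P y" "S \<in> sets lebesgue"
  obtains N where "negligible N" "\<And>y. y \<in> S - N \<Longrightarrow> P y"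
proof -
  have "AE y in lebesgue. y \<in> S \<longrightarrow> P y" using assms by (simp add: AE_restrict_space_iff)
  then obtain N where "N \<in> null_sets lebesgue" "{y \<in> space lebesgue. \<not> (y \<in> S \<longrightarrow> P y)} \<subseteq> N"
    by (auto simp: eventually_ae_filter)
  then show ?thesis using that[of N] by (auto simp: negligible_iff_null_sets)
qed

lemma continuous_rep_of_weakly_differentiable:
  assumes H: "H > 0" and weak: "has_weak_pderiv {0<..<H} 1 f g"
    and ae: "AE y in lebesgue_on {0..H}. g y = h y"
  shows "continuous_on {0..H} (continuous_rep H f)"
    and "AE y in lebesgue_on {0..H}. continuous_rep H f y = f y"
    and "\<And>x y. 0 \<le> x \<Longrightarrow> x \<le> y \<Longrightarrow> y \<le> H \<Longrightarrow>
      (h has_integral (continuous_rep H f y - continuous_rep H f x)) {x..y}"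
proof -
  let ?F = "continuous_rep H f"
  have int: "integrable (lebesgue_on {0..H}) g" by (rule weak_derivative_is_indefinite_integral[OF H weak])
  then have gi: "g integrable_on {0..H}" by (rule integrable_on_lebesgue_on) simp
  obtain \<kappa> where \<kappa>: "AE y in lebesgue_on {0..H}. f y = \<kappa> + integral {0..y} g"
    using weak_derivative_is_indefinite_integral[OF H weak] by blast
  define G where "G y = \<kappa> + integral {0..y} g" for y
  have cG: "continuous_on {0..H} G"
    unfolding G_def by (intro continuous_intros indefinite_integral_continuous_1 gi)
  have "continuous_on {0..H} G \<and> (AE y in lebesgue_on {0..H}. G y = f y)"
    using cG \<kappa> by (auto simp: G_def elim: eventually_mono)
  from someI[of "\<lambda>g. continuous_on {0..H} g \<and> (AE y in lebesgue_on {0..H}. g y = f y)", OF this]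
  show c: "continuous_on {0..H} ?F" and a: "AE y in lebesgue_on {0..H}. ?F y = f y"
    by (auto simp: continuous_rep_def)
  have "AE y in lebesgue_on {0..H}. ?F y = G y" using a \<kappa> by eventually_elim (simp add: G_def)
  then have FG: "?F y = G y" if "y \<in> {0..H}" for y
    using continuous_AE_eq_imp_eq[OF H c cG] that by blast
  fix x y assume xy: "0 \<le> x" "x \<le> y" "y \<le> H"
  have "g integrable_on {0..y}" "g integrable_on {x..y}"
    using integrable_on_subinterval[OF gi] xy by auto
  then have "integral {0..x} g + integral {x..y} g = integral {0..y} g"
    using xy by (intro Henstock_Kurzweil_Integration.integral_combine) auto
  then have "(g has_integral (?F y - ?F x)) {x..y}"
    using xy \<open>g integrable_on {x..y}\<close> by (simp add: FG G_def has_integral_iff algebra_simps)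
  moreover obtain N where "negligible N" "\<And>y. y \<in> {0..H} - N \<Longrightarrow> g y = h y"
    using AE_lebesgue_on_imp_negligible[OF ae] by auto
  ultimately show "(h has_integral (?F y - ?F x)) {x..y}"
    using xy by (intro has_integral_spike[of N "{x..y}" h g]) auto
qed

text \<open>The coefficient is replaced by a version \<open>c'\<close> that satisfies its bounds everywhere. The
integrands then obey pointwise estimates, and the integral equations are not affected.\<close>

lemma eigenfunction_first_order_system:
  assumes eig: "eigenfunction_A H c \<mu> lam u" and H: "H > 0" and cm: "0 < c\<^sub>m" "c\<^sub>m \<le> c\<^sub>M"
    and bounds: "AE y in lebesgue_on {0..H}. c\<^sub>m \<le> c y \<and> c y \<le> c\<^sub>M"
  defines "U \<equiv> continuous_rep H u" and "W \<equiv> continuous_rep H (\<lambda>z. c z * wderiv H u z)"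
  obtains c' where "\<And>y. c\<^sub>m \<le> c' y \<and> c' y \<le> c\<^sub>M" "continuous_on {0..H} U" "continuous_on {0..H} W"
    "AE y in lebesgue_on {0..H}. U y = u y"
    "\<And>x y. 0 \<le> x \<Longrightarrow> x \<le> y \<Longrightarrow> y \<le> H \<Longrightarrow> ((\<lambda>t. W t / c' t) has_integral (U y - U x)) {x..y}"
    "\<And>x y. 0 \<le> x \<Longrightarrow> x \<le> y \<Longrightarrow> y \<le> H \<Longrightarrow> ((\<lambda>t. - ((lam - c' t * \<mu>\<^sup>2) * U t)) has_integral (W y - W x)) {x..y}"
proof -
  define c' where "c' y = (if c\<^sub>m \<le> c y \<and> c y \<le> c\<^sub>M then c y else c\<^sub>m)" for y
  have c': "c\<^sub>m \<le> c' y \<and> c' y \<le> c\<^sub>M" for y using cm by (simp add: c'_def)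
  have dom: "H1 {0<..<H} u" "H1 {0<..<H} (\<lambda>y. c y * wderiv H u y)"
    using eig by (auto simp: eigenfunction_A_def dom_A_def H10_def)
  have w1: "has_weak_pderiv {0<..<H} 1 u (wderiv H u)"
    by (rule has_weak_pderiv_weak_pderiv[OF dom(1)]) simp
  have w2: "has_weak_pderiv {0<..<H} 1 (\<lambda>y. c y * wderiv H u y) (wderiv H (\<lambda>y. c y * wderiv H u y))"
    by (rule has_weak_pderiv_weak_pderiv[OF dom(2)]) simp
  note U1 = continuous_rep_of_weakly_differentiable(1,2)[OF H w1, of "wderiv H u", folded U_def]
  note W1 = continuous_rep_of_weakly_differentiable(1,2)[OF H w2, of "wderiv H (\<lambda>y. c y * wderiv H u y)", folded W_def]
  have aeU: "AE y in lebesgue_on {0..H}. wderiv H u y = W y / c' y"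
    using W1(2)[OF AE_I2[OF refl]] bounds by eventually_elim (use cm in \<open>simp add: c'_def\<close>)
  have "AE y in lebesgue_on {0..H}. op_A H c \<mu> u y = lam * u y"
    using eig by (simp add: eigenfunction_A_def AE_lebesgue_on_box_interior)
  then have aeW: "AE y in lebesgue_on {0..H}. wderiv H (\<lambda>y. c y * wderiv H u y) y = - ((lam - c' y * \<mu>\<^sup>2) * U y)"
    using U1(2)[OF AE_I2[OF refl]] bounds
    by eventually_elim (simp add: c'_def op_A_def algebra_simps)
  show ?thesis
    by (rule that[of c', OF c' U1(1)[OF AE_I2[OF refl]] W1(1)[OF AE_I2[OF refl]] U1(2)[OF AE_I2[OF refl]]
        continuous_rep_of_weakly_differentiable(3)[OF H w1 aeU, folded U_def]
        continuous_rep_of_weakly_differentiable(3)[OF H w2 aeW, folded W_def]])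
qed

text \<open>With $V = W/\sqrt\lambda$ the system reads $U' = \sqrt\lambda\,V/c$ and $V' = -\sqrt\lambda\,Q\,U$ with
$Q = 1 - c\mu^2/\lambda$. The condition $\lambda \ge (c_M+\varepsilon)\mu^2$ gives
$c\mu^2/\lambda \le c_M/(c_M+\varepsilon)$, which keeps $Q$ between $\varepsilon/(c_M+\varepsilon)$ and $1$.\<close>

lemma eigenfunction_oscillator:
  fixes U W c' :: "real \<Rightarrow> real"
  assumes cm: "0 < c\<^sub>m" "c\<^sub>m \<le> c\<^sub>M" and \<epsilon>: "\<epsilon> > 0" and lam: "lam > 0" "(c\<^sub>M + \<epsilon>) * \<mu>\<^sup>2 \<le> lam"
    and c': "\<And>y. c\<^sub>m \<le> c' y \<and> c' y \<le> c\<^sub>M" and cont: "continuous_on {0..H} U" "continuous_on {0..H} W"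
    and U: "\<And>x y. 0 \<le> x \<Longrightarrow> x \<le> y \<Longrightarrow> y \<le> H \<Longrightarrow> ((\<lambda>t. W t / c' t) has_integral (U y - U x)) {x..y}"
    and W: "\<And>x y. 0 \<le> x \<Longrightarrow> x \<le> y \<Longrightarrow> y \<le> H \<Longrightarrow>
      ((\<lambda>t. - ((lam - c' t * \<mu>\<^sup>2) * U t)) has_integral (W y - W x)) {x..y}"
  shows "oscillator (sqrt lam) (1 / c\<^sub>M) (1 / c\<^sub>m) (\<epsilon> / (c\<^sub>M + \<epsilon>)) {0..H} U (\<lambda>y. W y / sqrt lam)"
proof -
  define \<kappa> where "\<kappa> = sqrt lam"
  have \<kappa>: "\<kappa> > 0" "\<kappa> * \<kappa> = lam" using lam by (auto simp: \<kappa>_def)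
  define Q where "Q t = 1 - c' t * \<mu>\<^sup>2 / lam" for t
  have cMe: "c\<^sub>M + \<epsilon> > 0" using cm \<epsilon> by simp
  have Q: "\<epsilon> / (c\<^sub>M + \<epsilon>) \<le> Q t" "Q t \<le> 1" for t
  proof -
    have "\<mu>\<^sup>2 / lam \<le> 1 / (c\<^sub>M + \<epsilon>)" using lam cMe by (simp add: field_simps)
    then have "c' t * (\<mu>\<^sup>2 / lam) \<le> c\<^sub>M * (1 / (c\<^sub>M + \<epsilon>))" using c'[of t] cm lam by (intro mult_mono) auto
    moreover have "1 - c\<^sub>M * (1 / (c\<^sub>M + \<epsilon>)) = \<epsilon> / (c\<^sub>M + \<epsilon>)" using cMe by (simp add: field_simps)
    ultimately show "\<epsilon> / (c\<^sub>M + \<epsilon>) \<le> Q t" by (simp add: Q_def)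
    show "Q t \<le> 1" using c'[of t] cm lam by (simp add: Q_def)
  qed
  have P: "1 / c\<^sub>M \<le> 1 / c' t" "1 / c' t \<le> 1 / c\<^sub>m" for t
    using c'[of t] cm by (auto intro!: divide_left_mono mult_pos_pos)
  have "((\<lambda>t. \<kappa> * (1 / c' t) * (W t / \<kappa>)) has_integral (U y - U x)) {x..y} \<and>
      ((\<lambda>t. - (\<kappa> * Q t * U t)) has_integral (W y / \<kappa> - W x / \<kappa>)) {x..y}" if "x \<le> y" "{x..y} \<subseteq> {0..H}" for x y
  proof -
    have xy: "0 \<le> x" "x \<le> y" "y \<le> H" using that by auto
    have "- ((lam - c' t * \<mu>\<^sup>2) * U t) / \<kappa> = - (\<kappa> * Q t * U t)" for t
      using \<kappa> lam(1) by (simp add: Q_def field_simps flip: \<kappa>(2))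
    then show ?thesis
      using U[OF xy] has_integral_divide[OF W[OF xy], of \<kappa>] \<kappa>(1) by (simp add: diff_divide_distrib[of "W y" "W x" \<kappa>])
  qed
  moreover have "continuous_on {0..H} (\<lambda>y. W y / \<kappa>)" using \<kappa> by (intro continuous_intros cont) auto
  ultimately have "oscillator \<kappa> (1 / c\<^sub>M) (1 / c\<^sub>m) (\<epsilon> / (c\<^sub>M + \<epsilon>)) {0..H} U (\<lambda>y. W y / \<kappa>)"
    unfolding oscillator_def using \<kappa>(1) cm \<epsilon> cMe cont(1) P Q
    by (intro conjI exI[of _ "\<lambda>t. 1 / c' t"] exI[of _ Q]) auto
  then show ?thesis by (simp add: \<kappa>_def)
qed

section \<open>Unboundedness of the reduced eigenvalues\<close>

lemma weighted_young_inequality: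
  fixes a b t :: real
  assumes "t > 0"
  shows "\<bar>a * b\<bar> \<le> (t * a\<^sup>2 + b\<^sup>2 / t) / 2"
proof -
  have "2 * (t * \<bar>a\<bar>) * \<bar>b\<bar> \<le> (t * \<bar>a\<bar>)\<^sup>2 + \<bar>b\<bar>\<^sup>2" by (rule sum_squares_bound)
  then have "t * (2 * \<bar>a * b\<bar>) \<le> t * (t * a\<^sup>2 + b\<^sup>2 / t)"
    using assms by (simp add: abs_mult power_mult_distrib distrib_left power2_eq_square mult_ac)
  then show ?thesis using assms by simp
qed

text \<open>A weighted form of the Cauchy-Schwarz inequality. With $t = 1/e$ it turns the smallness of one norm
into smallness of the integral.\<close>

lemma L2_product_bound:
  fixes f g :: "'a::euclidean_space \<Rightarrow> real"
  assumes "L2 S f" "L2 S g"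
  shows "integrable (lebesgue_on S) (\<lambda>x. f x * g x)"
    and "t > 0 \<Longrightarrow> \<bar>LINT x|lebesgue_on S. f x * g x\<bar> \<le> (t * (L2_norm S f)\<^sup>2 + (L2_norm S g)\<^sup>2 / t) / 2"
proof -
  have m[measurable]: "f \<in> borel_measurable (lebesgue_on S)" "g \<in> borel_measurable (lebesgue_on S)"
    and i: "integrable (lebesgue_on S) (\<lambda>x. (f x)\<^sup>2)" "integrable (lebesgue_on S) (\<lambda>x. (g x)\<^sup>2)"
    using assms by (auto simp: L2_def)
  note young = weighted_young_inequality
  show int: "integrable (lebesgue_on S) (\<lambda>x. f x * g x)"
  proof (rule Bochner_Integration.integrable_bound[where f="\<lambda>x. (1 * (f x)\<^sup>2 + (g x)\<^sup>2 / 1) / 2"])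
    show "AE x in lebesgue_on S. norm (f x * g x) \<le> norm ((1 * (f x)\<^sup>2 + (g x)\<^sup>2 / 1) / 2)"
      by (rule AE_I2) (use young[of 1] in \<open>fastforce intro: order.trans[OF _ abs_ge_self]\<close>)
  qed (use i in auto)
  assume t: "t > 0"
  have n: "(L2_norm S f)\<^sup>2 = (LINT x|lebesgue_on S. (f x)\<^sup>2)" "(L2_norm S g)\<^sup>2 = (LINT x|lebesgue_on S. (g x)\<^sup>2)"
    by (simp_all add: L2_norm_def)
  have "\<bar>LINT x|lebesgue_on S. f x * g x\<bar> \<le> (LINT x|lebesgue_on S. \<bar>f x * g x\<bar>)"
    by (rule integral_abs_bound)
  also have "\<dots> \<le> (LINT x|lebesgue_on S. (t * (f x)\<^sup>2 + (g x)\<^sup>2 / t) / 2)"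
    using int i young[OF t] by (intro Bochner_Integration.integral_mono) auto
  also have "\<dots> = (t * (L2_norm S f)\<^sup>2 + (L2_norm S g)\<^sup>2 / t) / 2"
    using i by (simp add: n)
  finally show "\<bar>LINT x|lebesgue_on S. f x * g x\<bar> \<le> (t * (L2_norm S f)\<^sup>2 + (L2_norm S g)\<^sup>2 / t) / 2" .
qed

lemma L2_diff:
  fixes f g :: "'a::euclidean_space \<Rightarrow> real"
  assumes "L2 S f" "L2 S g"
  shows "L2 S (\<lambda>x. f x - g x)"
proof -
  have "integrable (lebesgue_on S) (\<lambda>x. (f x)\<^sup>2 + (g x)\<^sup>2 - 2 * (f x * g x))"
    using assms L2_product_bound(1)[OF assms] by (auto simp: L2_def)
  then show ?thesis
    using assms by (auto simp: L2_def power2_diff mult.assoc)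
qed

lemma L2_test_function:
  fixes \<psi> :: "'a::euclidean_space \<Rightarrow> real"
  assumes "test_function S \<psi>" "S \<in> lmeasurable"
  shows "L2 S \<psi>"
proof -
  interpret finite_measure "lebesgue_on S"
    using assms by (simp add: finite_measure_lebesgue_on)
  obtain B where B: "\<And>x. \<bar>\<psi> x\<bar> \<le> B" using test_function_bounded[OF assms(1)] by blast
  have m: "\<psi> \<in> borel_measurable (lebesgue_on S)"
    using assms smooth_imp_continuous[of \<psi>]
    by (intro continuous_imp_measurable_on_sets_lebesgue) (auto simp: test_function_def intro: continuous_on_subset)
  moreover have "integrable (lebesgue_on S) (\<lambda>x. (\<psi> x)\<^sup>2)"
  proof (rule integrable_const_bound[where B="B\<^sup>2"])
    show "AE x in lebesgue_on S. norm ((\<psi> x)\<^sup>2) \<le> B\<^sup>2"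
      using B by (intro AE_I2) (simp add: abs_le_square_iff[symmetric] order.trans[OF B abs_ge_self])
  qed (use m in auto)
  ultimately show ?thesis by (simp add: L2_def)
qed

text \<open>For a test function in place of \<open>v\<close> this is the definition of the weak derivative, and both sides
are continuous with respect to the $H^1$ norm. Approximability by test functions takes the place of
zero boundary values.\<close>

lemma H10_integration_by_parts:
  fixes f g v :: "real \<Rightarrow> real"
  assumes v: "H10 {0<..<H} v" and w: "has_weak_pderiv {0<..<H} 1 f g"
  shows "(LINT x|lebesgue_on {0<..<H}. wderiv H v x * f x) = - (LINT x|lebesgue_on {0<..<H}. v x * g x)"
proof -
  let ?I = "{0<..<H}"
  have Im: "?I \<in> lmeasurable" by (simp add: lmeasurable_open)
  have H1v: "H1 ?I v" using v by (simp add: H10_def)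
  have "has_weak_pderiv ?I 1 v (wderiv H v)" by (rule has_weak_pderiv_weak_pderiv[OF H1v]) simp
  then have L2: "L2 ?I v" "L2 ?I (wderiv H v)" "L2 ?I f" "L2 ?I g"
    using w by (auto simp: has_weak_pderiv_def)
  define X where "X = (LINT x|lebesgue_on ?I. wderiv H v x * f x) + (LINT x|lebesgue_on ?I. v x * g x)"
  define K where "K = (2 + (L2_norm ?I f)\<^sup>2 + (L2_norm ?I g)\<^sup>2) / 2"
  have "\<bar>X\<bar> \<le> e * K" if e: "e > 0" for e
  proof -
    obtain \<psi> where \<psi>: "test_function ?I \<psi>" "L2_norm ?I (\<lambda>x. v x - \<psi> x) < e"
      "L2_norm ?I (\<lambda>x. wderiv H v x - frechet_derivative \<psi> (at x) 1) < e"
      using v e unfolding H10_def by force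
    let ?\<psi>' = "\<lambda>x. frechet_derivative \<psi> (at x) 1"
    have L2\<psi>: "L2 ?I \<psi>" "L2 ?I ?\<psi>'"
      using L2_test_function[OF \<psi>(1) Im] L2_test_function[OF test_function_deriv[OF \<psi>(1)] Im] by auto
    have "(LINT x|lebesgue_on ?I. ?\<psi>' x * f x) = - (LINT x|lebesgue_on ?I. \<psi> x * g x)"
      using w \<psi>(1) by (simp add: has_weak_pderiv_def)
    then have X: "X = (LINT x|lebesgue_on ?I. (wderiv H v x - ?\<psi>' x) * f x) + (LINT x|lebesgue_on ?I. (v x - \<psi> x) * g x)"
      using L2 L2\<psi> by (simp add: X_def left_diff_distrib L2_product_bound(1))
    have "\<bar>X\<bar> \<le> (1 / e * (L2_norm ?I (\<lambda>x. wderiv H v x - ?\<psi>' x))\<^sup>2 + (L2_norm ?I f)\<^sup>2 / (1 / e)) / 2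
        + (1 / e * (L2_norm ?I (\<lambda>x. v x - \<psi> x))\<^sup>2 + (L2_norm ?I g)\<^sup>2 / (1 / e)) / 2"
      unfolding X using e by (intro order.trans[OF abs_triangle_ineq] add_mono L2_product_bound(2) L2_diff L2 L2\<psi>) auto
    also have "\<dots> \<le> (1 / e * e\<^sup>2 + (L2_norm ?I f)\<^sup>2 / (1 / e)) / 2 + (1 / e * e\<^sup>2 + (L2_norm ?I g)\<^sup>2 / (1 / e)) / 2"
      using e \<psi>(2,3)
      by (intro add_mono divide_right_mono mult_left_mono power_mono) (auto simp: L2_norm_def)
    also have "\<dots> = e * K" using e by (simp add: K_def power2_eq_square field_simps)
    finally show ?thesis .
  qed
  moreover have "((\<lambda>e. e * K) \<longlongrightarrow> 0 * K) (at_right 0)" by (intro tendsto_intros)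
  ultimately have "\<bar>X\<bar> \<le> 0 * K"
    by (intro tendsto_lowerbound[of _ _ "at_right 0"]) (auto simp: eventually_at_filter)
  then show ?thesis by (simp add: X_def)
qed

text \<open>Eigenfunctions for different eigenvalues are orthogonal, as $\int c\,u_i'u_j'$ is symmetric in $i$ and
$j$. If all eigenvalues were at most \<open>B\<close>, then $c_m\int u_l'^2 \le \int c\,u_l'^2 \le B$, so the
eigenfunctions would be uniformly bounded and equicontinuous. By the theorem of Arzela and Ascoli
two of them would be uniformly close, whereas $\int (u_i-u_j)^2 = 2$.\<close>

lemma eigenvalues_unbounded:
  fixes \<beta> :: "nat \<Rightarrow> real" and u :: "nat \<Rightarrow> real \<Rightarrow> real"
  assumes H: "H > 0" and cm: "0 < c\<^sub>m"
    and bounds: "AE y in lebesgue_on {0..H}. c\<^sub>m \<le> c y \<and> c y \<le> c\<^sub>M"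
    and inj: "inj \<beta>" and eig: "\<And>l. eigenfunction_A H c \<mu> (\<beta> l) (u l)"
    and norm: "\<And>l. L2_norm {0<..<H} (u l) = 1"
  shows "\<exists>l. \<beta> l > B"
proof (rule ccontr)
  assume "\<nexists>l. \<beta> l > B"
  then have B: "\<beta> l \<le> B" for l by (simp add: not_less)
  let ?I = "{0<..<H}" and ?K = "{0..H}"
  have boundsI: "AE y in lebesgue_on ?I. c\<^sub>m \<le> c y \<and> c y \<le> c\<^sub>M"
    using bounds by (simp add: AE_lebesgue_on_box_interior)
  define D where "D l = wderiv H (u l)" for l
  define h where "h l = wderiv H (\<lambda>y. c y * D l y)" for l
  have H10: "H10 ?I (u l)" and H1: "H1 ?I (\<lambda>y. c y * D l y)" for l
    using eig[of l] by (auto simp: eigenfunction_A_def dom_A_def D_def)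
  have wu: "has_weak_pderiv ?I 1 (u l) (D l)" for l
    unfolding D_def by (rule has_weak_pderiv_weak_pderiv) (use H10 in \<open>auto simp: H10_def\<close>)
  have wD: "has_weak_pderiv ?I 1 (\<lambda>y. c y * D l y) (h l)" for l
    unfolding h_def by (rule has_weak_pderiv_weak_pderiv[OF H1]) simp
  have L2: "L2 ?I (u l)" "L2 ?I (D l)" "L2 ?I (\<lambda>y. c y * D l y)" "L2 ?I (h l)" for l
    using wu[of l] wD[of l] by (auto simp: has_weak_pderiv_def)
  have eq: "AE y in lebesgue_on ?I. h l y + \<beta> l * u l y = c y * \<mu>\<^sup>2 * u l y" for l
    using eig[of l] by (auto simp: eigenfunction_A_def op_A_def h_def D_def elim: eventually_mono)
  have parts: "(LINT y|lebesgue_on ?I. D j y * (c y * D i y)) = - (LINT y|lebesgue_on ?I. u j y * h i y)" for i j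
    using H10_integration_by_parts[OF H10 wD] by (simp add: D_def)
  note int = L2_product_bound(1)
  have norm2: "(LINT y|lebesgue_on ?I. u l y * u l y) = 1" for l
    using norm[of l] by (simp add: L2_norm_def power2_eq_square)
  have orth: "(LINT y|lebesgue_on ?I. u i y * u j y) = 0" if "i \<noteq> j" for i j
  proof -
    define P where "P = (LINT y|lebesgue_on ?I. u i y * u j y)"
    have P': "(LINT y|lebesgue_on ?I. u j y * u i y) = P" by (simp add: P_def mult.commute)
    have L2h: "L2 ?I (\<lambda>y. h l y + \<beta> l * u l y)" for l
    proof -
      have "L2 ?I (\<lambda>y. (- \<beta> l) * u l y)"
        using L2(1)[of l] by (auto simp: L2_def power_mult_distrib)
      from L2_diff[OF L2(4) this] show ?thesis by simp
    qed
    \<comment> \<open>Both integrands equal $c\mu^2u_iu_j$ almost everywhere.\<close>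
    have "(LINT y|lebesgue_on ?I. u j y * (h i y + \<beta> i * u i y)) = (LINT y|lebesgue_on ?I. u i y * (h j y + \<beta> j * u j y))"
    proof (rule integral_cong_AE)
      show "AE y in lebesgue_on ?I. u j y * (h i y + \<beta> i * u i y) = u i y * (h j y + \<beta> j * u j y)"
        using eq[of i] eq[of j] by eventually_elim simp
    qed (use int[OF L2(1) L2h] in \<open>auto intro: borel_measurable_integrable\<close>)
    moreover have "(LINT y|lebesgue_on ?I. u j y * (h i y + \<beta> i * u i y)) = (LINT y|lebesgue_on ?I. u j y * h i y) + \<beta> i * P"
      using int[OF L2(1) L2(4)] int[OF L2(1) L2(1)] P'
      by (simp add: distrib_left mult.left_commute[of _ "\<beta> i"])
    moreover have "(LINT y|lebesgue_on ?I. u i y * (h j y + \<beta> j * u j y)) = (LINT y|lebesgue_on ?I. u i y * h j y) + \<beta> j * P"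
      using int[OF L2(1) L2(4)] int[OF L2(1) L2(1)]
      by (simp add: P_def distrib_left mult.left_commute[of _ "\<beta> j"])
    moreover have "(LINT y|lebesgue_on ?I. u j y * h i y) = (LINT y|lebesgue_on ?I. u i y * h j y)"
    proof -
      have "(LINT y|lebesgue_on ?I. D j y * (c y * D i y)) = (LINT y|lebesgue_on ?I. D i y * (c y * D j y))"
        by (simp add: mult_ac)
      then show ?thesis using parts[of i j] parts[of j i] by simp
    qed
    ultimately have "(\<beta> i - \<beta> j) * P = 0" by (simp add: algebra_simps)
    then show ?thesis using that inj by (auto simp: P_def inj_def)
  qed
  define E where "E = max 0 (B / c\<^sub>m)"
  have E0: "E \<ge> 0" by (simp add: E_def)
  have intD2: "integrable (lebesgue_on ?I) (\<lambda>y. (D l y)\<^sup>2)" for l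
    using L2(2)[of l] by (simp add: L2_def)
  have energy: "(LINT y|lebesgue_on ?I. (D l y)\<^sup>2) \<le> E" for l
  proof -
    have "c\<^sub>m * (LINT y|lebesgue_on ?I. (D l y)\<^sup>2) = (LINT y|lebesgue_on ?I. c\<^sub>m * (D l y)\<^sup>2)" by simp
    also have "\<dots> \<le> (LINT y|lebesgue_on ?I. D l y * (c y * D l y))"
    proof (rule integral_mono_AE)
      show "AE y in lebesgue_on ?I. c\<^sub>m * (D l y)\<^sup>2 \<le> D l y * (c y * D l y)"
        using boundsI
      proof eventually_elim
        case (elim y)
        then have "c\<^sub>m * (D l y)\<^sup>2 \<le> c y * (D l y)\<^sup>2" by (intro mult_right_mono) auto
        then show ?case by (simp add: power2_eq_square mult_ac)
      qed
    qed (use intD2 int[OF L2(2) L2(3)] in auto)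
    also have "\<dots> = (LINT y|lebesgue_on ?I. - (u l y * h l y))" by (simp add: parts)
    also have "\<dots> \<le> (LINT y|lebesgue_on ?I. \<beta> l * (u l y * u l y))"
    proof (rule integral_mono_AE)
      show "AE y in lebesgue_on ?I. - (u l y * h l y) \<le> \<beta> l * (u l y * u l y)"
        using eq[of l] boundsI
      proof eventually_elim
        case (elim y)
        have "0 \<le> c y * \<mu>\<^sup>2 * (u l y * u l y)" using elim cm by simp
        also have "\<dots> = u l y * (h l y + \<beta> l * u l y)" unfolding elim(1) by (simp add: mult_ac)
        finally show ?case by (simp add: algebra_simps)
      qed
    qed (use int[OF L2(1) L2(4)] int[OF L2(1) L2(1)] in auto)
    also have "\<dots> \<le> B" using B by (simp add: norm2)
    finally have "(LINT y|lebesgue_on ?I. (D l y)\<^sup>2) \<le> B / c\<^sub>m"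
      using cm by (simp add: pos_le_divide_eq mult.commute)
    then show ?thesis by (simp add: E_def)
  qed
  define U where "U l = continuous_rep H (u l)" for l
  note rep = continuous_rep_of_weakly_differentiable[OF H wu AE_I2[OF refl], folded U_def]
  have osc: "\<bar>U l y - U l x\<bar> \<le> (t * E + (y - x) / t) / 2" if "0 \<le> x" "x \<le> y" "y \<le> H" "t > 0" for l x y t
  proof -
    have iK: "(\<lambda>y. (D l y)\<^sup>2) integrable_on ?K"
      using lebesgue_on_open_to_closed(1)[OF intD2[of l]] by (intro integrable_on_lebesgue_on) auto
    then have ixy: "(\<lambda>y. (D l y)\<^sup>2) integrable_on {x..y}"
      by (rule integrable_on_subinterval) (use that in auto)
    have "integral {x..y} (\<lambda>y. (D l y)\<^sup>2) \<le> integral ?K (\<lambda>y. (D l y)\<^sup>2)"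
      using that by (intro integral_subset_le iK ixy) auto
    also have "\<dots> = (LINT y|lebesgue_on ?I. (D l y)\<^sup>2)"
      using lebesgue_on_open_to_closed[OF intD2[of l]] by (simp add: lebesgue_integral_eq_integral[symmetric])
    finally have b: "integral {x..y} (\<lambda>y. (D l y)\<^sup>2) \<le> E" using energy[of l] by simp
    let ?b = "(t * integral {x..y} (\<lambda>y. (D l y)\<^sup>2) + (y - x) * (1 / t)) * (1 / 2)"
    have hb: "((\<lambda>s. (t * (D l s)\<^sup>2 + 1 / t) * (1 / 2)) has_integral ?b) {x..y}"
      using that has_integral_const_real[of "1 / t" x y]
      by (intro has_integral_mult_left has_integral_add has_integral_mult_right integrable_integral ixy) (simp add: mult.commute)
    have young: "\<bar>d\<bar> \<le> (t * d\<^sup>2 + 1 / t) * (1 / 2)" for d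
      using weighted_young_inequality[OF that(4), of d 1] by simp
    have "U l y - U l x \<le> ?b"
      using has_integral_le[OF rep(3)[OF that(1-3)] hb] young by (meson abs_le_D1)
    moreover have "- (U l y - U l x) \<le> ?b"
      using has_integral_le[OF has_integral_neg[OF rep(3)[OF that(1-3)]] hb] young by (meson abs_le_D2)
    moreover have "?b \<le> (t * E + (y - x) / t) / 2"
      using b that by (simp add: mult_left_mono)
    ultimately show ?thesis by linarith
  qed
  define M where "M = sqrt (2 / H) + (1 * E + H / 1) / 2"
  have UM: "norm (U l y) \<le> M" if y: "y \<in> ?K" for l y
  proof -
    have intu: "integrable (lebesgue_on ?I) (\<lambda>y. u l y * u l y)" by (rule int[OF L2(1) L2(1)])
    \<comment> \<open>Otherwise $\int u_l^2$ would be at least $2$.\<close>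
    have "\<exists>z\<in>?K. (U l z)\<^sup>2 \<le> 2 / H"
    proof (rule ccontr)
      assume "\<not> (\<exists>z\<in>?K. (U l z)\<^sup>2 \<le> 2 / H)"
      then have big: "2 / H \<le> (U l z)\<^sup>2" if "z \<in> ?K" for z using that by force
      have "AE y in lebesgue_on ?I. 2 / H \<le> u l y * u l y"
      proof -
        have "AE y in lebesgue_on ?I. U l y = u l y"
          using rep(2)[of l] by (simp add: AE_lebesgue_on_box_interior)
        then show ?thesis using AE_space
        proof eventually_elim
          case (elim y)
          then show ?case using big[of y] by (simp add: power2_eq_square)
        qed
      qed
      then have "(LINT y|lebesgue_on ?I. 2 / H) \<le> (LINT y|lebesgue_on ?I. u l y * u l y)"
        using intu by (intro integral_mono_AE) (auto simp: finite_measure_lebesgue_on finite_measure.integrable_const)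
      then show False using H by (simp add: norm2 measure_restrict_space)
    qed
    then obtain z where z: "z \<in> ?K" "(U l z)\<^sup>2 \<le> 2 / H" by blast
    have "\<bar>U l z\<bar> \<le> sqrt (2 / H)" using z(2) by (metis real_sqrt_abs real_sqrt_le_mono)
    moreover have "\<bar>U l y - U l z\<bar> \<le> (1 * E + H / 1) / 2"
    proof (cases "z \<le> y")
      case True
      then show ?thesis using osc[of z y 1 l] y z by auto
    next
      case False
      then have "\<bar>U l z - U l y\<bar> \<le> (1 * E + (z - y) / 1) / 2" using osc[of y z 1 l] y z by auto
      then show ?thesis using y z by (simp add: abs_minus_commute)
    qed
    ultimately show ?thesis unfolding M_def real_norm_def by linarith
  qed
  have equi: "\<exists>d>0. \<forall>n y. y \<in> ?K \<and> norm (x - y) < d \<longrightarrow> norm (U n x - U n y) < e" if x: "x \<in> ?K" and e: "e > 0" for x e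
  proof -
    define t where "t = e / (E + 1)"
    have t: "t > 0" "t * E < e" using e E0 by (auto simp: t_def field_simps)
    show ?thesis
    proof (intro exI[of _ "e * t"] conjI allI impI)
      show "e * t > 0" using e t by simp
      fix n y assume y: "y \<in> ?K \<and> norm (x - y) < e * t"
      define r s where "r = min x y" and "s = max x y"
      have "\<bar>U n s - U n r\<bar> \<le> (t * E + (s - r) / t) / 2"
        using x y t by (intro osc) (auto simp: r_def s_def)
      moreover have "(s - r) / t < e" using y t by (auto simp: r_def s_def pos_divide_less_eq)
      then have "(t * E + (s - r) / t) / 2 < e" using add_strict_mono[OF t(2)] by fastforce
      ultimately have "\<bar>U n s - U n r\<bar> < e" by (rule le_less_trans)
      then show "norm (U n x - U n y) < e" by (auto simp: r_def s_def min_def max_def abs_minus_commute split: if_splits)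
    qed
  qed
  obtain g k where "continuous_on ?K g" and k: "strict_mono (k :: nat \<Rightarrow> nat)"
    and conv: "\<And>e. 0 < e \<Longrightarrow> \<exists>N. \<forall>n x. n \<ge> N \<and> x \<in> ?K \<longrightarrow> norm (U (k n) x - g x) < e"
  proof (rule Arzela_Ascoli[of ?K U M, OF compact_Icc UM equi])
  qed (assumption | rule that)+
  \<comment> \<open>Two functions within \<open>e\<close> of the limit differ by at most $1/\sqrt H$, so their $L^2$ distance is at most $1$.\<close>
  define e where "e = 1 / (2 * sqrt H)"
  have e: "e > 0" using H by (simp add: e_def)
  obtain N where N: "\<And>n x. n \<ge> N \<Longrightarrow> x \<in> ?K \<Longrightarrow> \<bar>U (k n) x - g x\<bar> < e" using conv[OF e] by auto
  define i j where "i = k N" and "j = k (Suc N)"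
  have ij: "i \<noteq> j" using k by (simp add: i_def j_def strict_mono_eq)
  have close: "\<bar>U i x - U j x\<bar> \<le> 1 / sqrt H" if "x \<in> ?K" for x
  proof -
    have "\<bar>U i x - g x\<bar> < e" "\<bar>U j x - g x\<bar> < e" using N[of N x] N[of "Suc N" x] that by (auto simp: i_def j_def)
    moreover have "2 * e = 1 / sqrt H" by (simp add: e_def)
    ultimately show ?thesis by linarith
  qed
  have "AE y in lebesgue_on ?I. (u i y - u j y) * (u i y - u j y) \<le> 1 / H"
  proof -
    have "AE y in lebesgue_on ?I. U i y = u i y" "AE y in lebesgue_on ?I. U j y = u j y"
      using rep(2) by (simp_all add: AE_lebesgue_on_box_interior)
    then show ?thesis using AE_space
    proof eventually_elim
      case (elim y)
      then have "\<bar>u i y - u j y\<bar> \<le> 1 / sqrt H" using close[of y] by simp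
      then have "(u i y - u j y)\<^sup>2 \<le> (1 / sqrt H)\<^sup>2" by (metis abs_le_square_iff abs_ge_self order_trans)
      then show ?case using H by (simp add: power_divide power2_eq_square)
    qed
  qed
  then have "(LINT y|lebesgue_on ?I. (u i y - u j y) * (u i y - u j y)) \<le> (LINT y|lebesgue_on ?I. 1 / H)"
    using int[OF L2_diff L2_diff, OF L2(1) L2(1) L2(1) L2(1)]
    by (intro integral_mono_AE) (auto simp: finite_measure_lebesgue_on finite_measure.integrable_const)
  also have "\<dots> = 1" using H by (simp add: measure_restrict_space)
  also have "(LINT y|lebesgue_on ?I. (u i y - u j y) * (u i y - u j y)) =
      (LINT y|lebesgue_on ?I. (u i y * u i y - u i y * u j y) - (u j y * u i y - u j y * u j y))"
    by (intro Bochner_Integration.integral_cong) (auto simp: algebra_simps)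
  also have "\<dots> = 2"
    using int[OF L2(1) L2(1)] by (simp add: norm2 orth[OF ij] orth[OF ij[symmetric]])
  finally show False by simp
qed

section \<open>Norms on product domains and the uniform lower bound\<close>

text \<open>Lebesgue measurable functions need not be measurable for the product of the Lebesgue
\<open>\<sigma>\<close>-algebras used by Fubini's theorem. Both factors are replaced by Borel functions, which changes
the product only on a null set.\<close>

lemma lebesgue_integral_product:
  fixes F :: "'a::euclidean_space \<Rightarrow> real" and G :: "'b::euclidean_space \<Rightarrow> real"
  assumes F: "F \<in> borel_measurable lebesgue" "\<And>x. F x \<ge> 0"
    and G: "G \<in> borel_measurable lebesgue" "\<And>y. G y \<ge> 0"
  shows "(LINT z|lebesgue. F (fst z) * G (snd z)) = (LINT x|lebesgue. F x) * (LINT y|lebesgue. G y)"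
proof -
  obtain F0 where F0[measurable]: "F0 \<in> borel_measurable lborel" and aeF: "AE x in lborel. F x = F0 x"
    using completion_ex_borel_measurable_real[OF F(1)] by blast
  obtain G0 where G0[measurable]: "G0 \<in> borel_measurable lborel" and aeG: "AE y in lborel. G y = G0 y"
    using completion_ex_borel_measurable_real[OF G(1)] by blast
  obtain N1 where N1: "N1 \<in> null_sets lborel" "{x. F x \<noteq> F0 x} \<subseteq> N1"
    using aeF by (auto simp: eventually_ae_filter)
  obtain N2 where N2: "N2 \<in> null_sets lborel" "{y. G y \<noteq> G0 y} \<subseteq> N2"
    using aeG by (auto simp: eventually_ae_filter)
  have "N1 \<times> UNIV \<in> null_sets (lborel \<Otimes>\<^sub>M lborel)" "UNIV \<times> N2 \<in> null_sets (lborel \<Otimes>\<^sub>M lborel)"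
    using N1(1) N2(1) by (auto simp: null_sets_def lborel.emeasure_pair_measure_Times)
  then have null: "N1 \<times> UNIV \<union> UNIV \<times> N2 \<in> null_sets (lborel :: ('a \<times> 'b) measure)"
    unfolding lborel_prod by (rule null_sets.Un)
  have ae: "AE z in lborel. F (fst z) * G (snd z) = F0 (fst z) * G0 (snd z)"
  proof (rule AE_I'[OF null])
    show "{z \<in> space lborel. F (fst z) * G (snd z) \<noteq> F0 (fst z) * G0 (snd z)} \<subseteq> N1 \<times> UNIV \<union> UNIV \<times> N2"
    proof
      fix z assume "z \<in> {z \<in> space lborel. F (fst z) * G (snd z) \<noteq> F0 (fst z) * G0 (snd z)}"
      then have "F (fst z) \<noteq> F0 (fst z) \<or> G (snd z) \<noteq> G0 (snd z)" by auto
      then show "z \<in> N1 \<times> UNIV \<union> UNIV \<times> N2" using N1(2) N2(2) by (cases z) auto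
    qed
  qed
  have m0: "(\<lambda>z. F0 (fst z) * G0 (snd z)) \<in> borel_measurable (lborel :: ('a \<times> 'b) measure)"
    unfolding lborel_prod[symmetric] by measurable
  have m: "(\<lambda>z. F (fst z) * G (snd z)) \<in> borel_measurable lebesgue"
    by (rule borel_measurable_AE[OF measurable_completion[OF m0]])
       (use AE_completion[OF ae] in \<open>auto elim: eventually_mono\<close>)
  have "(\<integral>\<^sup>+z. F (fst z) * G (snd z) \<partial>lebesgue) = (\<integral>\<^sup>+z. F (fst z) * G (snd z) \<partial>lborel)"
    by (rule nn_integral_completion)
  also have "\<dots> = (\<integral>\<^sup>+z. ennreal (F0 (fst z)) * ennreal (G0 (snd z)) \<partial>lborel)"
  proof (rule nn_integral_cong_AE)
    have "x \<in> N1 \<or> F x = F0 x" "y \<in> N2 \<or> G y = G0 y" for x y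
      using N1(2) N2(2) by blast+
    then have pos: "F0 x \<ge> 0 \<or> x \<in> N1" "G0 y \<ge> 0 \<or> y \<in> N2" for x y
      using F(2)[of x] G(2)[of y] by metis+
    have "AE z in lborel. z \<notin> N1 \<times> UNIV \<union> UNIV \<times> N2" by (rule AE_not_in[OF null])
    then show "AE z in lborel. ennreal (F (fst z) * G (snd z)) = ennreal (F0 (fst z)) * ennreal (G0 (snd z))"
      using ae
    proof eventually_elim
      case (elim z)
      then show ?case using pos(1)[of "fst z"] pos(2)[of "snd z"]
        by (cases z) (auto simp: ennreal_mult)
    qed
  qed
  also have "\<dots> = (\<integral>\<^sup>+x. \<integral>\<^sup>+y. ennreal (F0 x) * ennreal (G0 y) \<partial>lborel \<partial>lborel)"
    unfolding lborel_prod[symmetric] by (subst lborel.nn_integral_fst[symmetric]) auto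
  also have "\<dots> = (\<integral>\<^sup>+x. ennreal (F0 x) \<partial>lborel) * (\<integral>\<^sup>+y. ennreal (G0 y) \<partial>lborel)"
    by (simp add: nn_integral_cmult nn_integral_multc)
  also have "(\<integral>\<^sup>+x. ennreal (F0 x) \<partial>lborel) = (\<integral>\<^sup>+x. ennreal (F x) \<partial>lborel)"
    by (rule nn_integral_cong_AE) (use aeF in \<open>auto elim: eventually_mono\<close>)
  also have "(\<integral>\<^sup>+y. ennreal (G0 y) \<partial>lborel) = (\<integral>\<^sup>+y. ennreal (G y) \<partial>lborel)"
    by (rule nn_integral_cong_AE) (use aeG in \<open>auto elim: eventually_mono\<close>)
  finally have "(\<integral>\<^sup>+z. F (fst z) * G (snd z) \<partial>lebesgue) =
      (\<integral>\<^sup>+x. ennreal (F x) \<partial>lebesgue) * (\<integral>\<^sup>+y. ennreal (G y) \<partial>lebesgue)"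
    by (simp add: nn_integral_completion)
  then show ?thesis
    using F G m by (subst (1 2 3) integral_eq_nn_integral) (auto simp: enn2real_mult)
qed

lemma L2_norm_product:
  fixes f :: "'a::euclidean_space \<Rightarrow> complex" and g :: "'b::euclidean_space \<Rightarrow> real"
  assumes "open A" "open B" and f: "f \<in> borel_measurable (lebesgue_on A)" and g: "g \<in> borel_measurable (lebesgue_on B)"
  shows "L2_norm (A \<times> B) (\<lambda>(x, y). f x * of_real (g y)) = L2_norm A f * L2_norm B g"
proof -
  have sets: "A \<in> sets lebesgue" "B \<in> sets lebesgue" "A \<times> B \<in> sets lebesgue"
    using assms open_Times[OF assms(1,2)] by auto
  define F where "F x = indicator A x *\<^sub>R (norm (f x))\<^sup>2" for x
  define G where "G y = indicator B y *\<^sub>R (norm (g y))\<^sup>2" for y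
  have m: "F \<in> borel_measurable lebesgue" "G \<in> borel_measurable lebesgue"
    using f g sets unfolding F_def G_def
    by (auto simp: borel_measurable_restrict_space_iff[symmetric] simp del: real_scaleR_def)
  have "(LINT z|lebesgue_on (A \<times> B). (norm (case z of (x, y) \<Rightarrow> f x * complex_of_real (g y)))\<^sup>2) =
      (LINT z|lebesgue. F (fst z) * G (snd z))"
    using sets by (subst integral_restrict_space)
     (auto intro!: Bochner_Integration.integral_cong simp: F_def G_def indicator_def norm_mult power_mult_distrib)
  also have "\<dots> = (LINT x|lebesgue. F x) * (LINT y|lebesgue. G y)"
    by (rule lebesgue_integral_product[OF m(1) _ m(2)]) (auto simp: F_def G_def)
  also have "(LINT x|lebesgue. F x) = (LINT x|lebesgue_on A. (norm (f x))\<^sup>2)"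
    unfolding F_def using sets by (simp add: integral_restrict_space)
  also have "(LINT y|lebesgue. G y) = (LINT y|lebesgue_on B. (norm (g y))\<^sup>2)"
    unfolding G_def using sets by (simp add: integral_restrict_space)
  finally show ?thesis by (simp add: L2_norm_def real_sqrt_mult)
qed

lemma L2_norm_mono:
  fixes f :: "'a::euclidean_space \<Rightarrow> 'b::euclidean_space"
  assumes "L2 B f" "A \<subseteq> B" "A \<in> sets lebesgue" "B \<in> sets lebesgue"
  shows "L2_norm A f \<le> L2_norm B f"
proof -
  have i: "integrable (lebesgue_on B) (\<lambda>x. (norm (f x))\<^sup>2)" using assms by (simp add: L2_def)
  then have "integrable (lebesgue_on A) (\<lambda>x. (norm (f x))\<^sup>2)"
    by (rule integrable_on_subdomain[OF _ assms(2,4,3)])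
  then have "(LINT x|lebesgue_on A. (norm (f x))\<^sup>2) \<le> (LINT x|lebesgue_on B. (norm (f x))\<^sup>2)"
  proof -
    assume iA: "integrable (lebesgue_on A) (\<lambda>x. (norm (f x))\<^sup>2)"
    have "indicator A x *\<^sub>R (norm (f x))\<^sup>2 \<le> indicator B x *\<^sub>R (norm (f x))\<^sup>2" for x
      using assms(2) by (auto simp: indicator_def)
    then have "(LINT x|lebesgue. indicator A x *\<^sub>R (norm (f x))\<^sup>2) \<le> (LINT x|lebesgue. indicator B x *\<^sub>R (norm (f x))\<^sup>2)"
      using iA i assms by (intro Bochner_Integration.integral_mono) (simp_all add: integrable_restrict_space)
    then show ?thesis
      using assms by (simp add: integral_restrict_space)
  qed
  then show ?thesis by (simp add: L2_norm_def)
qed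

text \<open>Non-concentration gives a positive lower bound for all large \<open>k\<close>. Each of the finitely many
remaining norms is positive by unique continuation, so the minimum is positive.\<close>

lemma dirichlet_eigenfunctions_uniform_mass:
  fixes \<Omega>' \<omega>' :: "'a::euclidean_space set" and \<phi> :: "nat \<Rightarrow> 'a \<Rightarrow> complex"
  assumes dom: "bounded_smooth_domain \<Omega>'" and sys: "dirichlet_eigensystem \<Omega>' \<mu> \<phi>"
    and \<omega>': "open \<omega>'" "\<omega>' \<noteq> {}" "\<omega>' \<subseteq> \<Omega>'" and nc: "\<omega>' \<noteq> \<Omega>' \<longrightarrow> does_not_concentrate \<Omega>' \<omega>' \<phi>"
  shows "L2_norm \<Omega>' (\<phi> k) = 1" and "\<exists>\<delta>>0. \<forall>k. \<delta> \<le> L2_norm \<omega>' (\<phi> k)"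
proof -
  have \<Omega>': "open \<Omega>'" "connected \<Omega>'" "bounded \<Omega>'" using dom by (auto simp: bounded_smooth_domain_def)
  have L2: "L2 \<Omega>' (\<phi> k)" and eq: "dirichlet_laplacian \<Omega>' (\<phi> k) (\<lambda>x. of_real ((\<mu> k)\<^sup>2) * \<phi> k x)" for k
    using sys by (auto simp: dirichlet_eigensystem_def orthonormal_basis_L2_def)
  have norm1: "(LINT x|lebesgue_on \<Omega>'. (norm (\<phi> k x))\<^sup>2) = 1" for k
  proof -
    have "L2_inner \<Omega>' (\<phi> k) (\<phi> k) = 1"
      using sys by (simp add: dirichlet_eigensystem_def orthonormal_basis_L2_def)
    then have "complex_of_real (LINT x|lebesgue_on \<Omega>'. (norm (\<phi> k x))\<^sup>2) = 1"
      unfolding L2_inner_def complex_norm_square[symmetric] integral_complex_of_real .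
    then show ?thesis by (metis of_real_1 of_real_eq_iff)
  qed
  show 1: "L2_norm \<Omega>' (\<phi> k) = 1" for k by (simp add: L2_norm_def norm1)
  have sets: "\<omega>' \<in> sets lebesgue" "\<Omega>' \<in> sets lebesgue" using \<omega>' \<Omega>' by auto
  have pos: "L2_norm \<omega>' (\<phi> k) > 0" for k
  proof (rule ccontr)
    assume "\<not> L2_norm \<omega>' (\<phi> k) > 0"
    then have "(LINT x|lebesgue_on \<omega>'. (norm (\<phi> k x))\<^sup>2) \<le> 0" by (simp add: L2_norm_def)
    then have "(LINT x|lebesgue_on \<omega>'. (norm (\<phi> k x))\<^sup>2) = 0"
      by (intro antisym) auto
    moreover have "integrable (lebesgue_on \<omega>') (\<lambda>x. (norm (\<phi> k x))\<^sup>2)"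
      by (rule integrable_on_subdomain[OF _ \<omega>'(3) sets(2,1)]) (use L2[of k] in \<open>simp add: L2_def\<close>)
    ultimately have "AE x in lebesgue_on \<omega>'. (norm (\<phi> k x))\<^sup>2 = 0"
      using integral_nonneg_eq_0_iff_AE[of "lebesgue_on \<omega>'" "\<lambda>x. (norm (\<phi> k x))\<^sup>2"] by simp
    then have "AE x in lebesgue. x \<in> \<omega>' \<longrightarrow> \<phi> k x = 0"
      using sets by (simp add: AE_restrict_space_iff)
    from unique_continuation[OF eq \<Omega>' \<omega>' this]
    have "AE x in lebesgue_on \<Omega>'. (norm (\<phi> k x))\<^sup>2 = 0"
      using sets by (simp add: AE_restrict_space_iff)
    then have "(LINT x|lebesgue_on \<Omega>'. (norm (\<phi> k x))\<^sup>2) = 0"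
      by (intro integral_eq_zero_AE)
    then show False using norm1 by simp
  qed
  show "\<exists>\<delta>>0. \<forall>k. \<delta> \<le> L2_norm \<omega>' (\<phi> k)"
  proof (cases "\<omega>' = \<Omega>'")
    case True
    then show ?thesis using 1 by (intro exI[of _ 1]) simp
  next
    case False
    then have "0 < liminf (\<lambda>k. ereal ((L2_norm \<omega>' (\<phi> k))\<^sup>2))"
      using nc by (simp add: does_not_concentrate_def 1)
    then obtain C where C: "0 < ereal C" "ereal C < liminf (\<lambda>k. ereal ((L2_norm \<omega>' (\<phi> k))\<^sup>2))"
      using ereal_dense2 by blast
    obtain N where N: "\<And>k. k \<ge> N \<Longrightarrow> C < (L2_norm \<omega>' (\<phi> k))\<^sup>2"
      using less_LiminfD[OF C(2)] by (auto simp: eventually_sequentially)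
    define \<delta> where "\<delta> = Min (insert (sqrt C) ((\<lambda>k. L2_norm \<omega>' (\<phi> k)) ` {..<N}))"
    have "\<delta> > 0" using C pos by (auto simp: \<delta>_def)
    moreover have "\<delta> \<le> L2_norm \<omega>' (\<phi> k)" for k
    proof (cases "k < N")
      case True
      then show ?thesis unfolding \<delta>_def by (intro Min_le) auto
    next
      case False
      have "\<delta> \<le> sqrt C" unfolding \<delta>_def by (intro Min_le) auto
      also have "\<dots> \<le> L2_norm \<omega>' (\<phi> k)"
        using N[of k] False pos[of k] by (intro real_le_lsqrt) auto
      finally show ?thesis .
    qed
    ultimately show ?thesis by blast
  qed
qed

theorem theorem2p7:
  fixes \<Omega>' \<omega>' :: "(real ^ 'd) set" and \<Omega> \<omega> :: "((real ^ 'd) \<times> real) set"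
    and H c\<^sub>m c\<^sub>M \<epsilon> a b :: real
    and \<mu> :: "nat \<Rightarrow> real" and \<phi> :: "nat \<Rightarrow> real ^ 'd \<Rightarrow> complex"
    and c :: "real \<Rightarrow> real"
    and \<beta> :: "nat \<Rightarrow> nat \<Rightarrow> real" and u :: "nat \<Rightarrow> real \<Rightarrow> real \<Rightarrow> real"
    and v :: "nat \<Rightarrow> real \<Rightarrow> (real ^ 'd) \<times> real \<Rightarrow> complex"
  assumes "bounded_smooth_domain \<Omega>'" and "H > 0" and "\<Omega> = \<Omega>' \<times> {0<..<H}"
    and "dirichlet_eigensystem \<Omega>' \<mu> \<phi>"
    and "0 < c\<^sub>m" and "c\<^sub>m < c\<^sub>M" and "c \<in> coeff_class H c\<^sub>m c\<^sub>M"
    and "\<And>k. strict_mono (\<beta> k)" and "\<And>k. range (\<beta> k) = eigenvalues_A H c (\<mu> k)"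
    and "\<And>k l. eigenfunction_A H c (\<mu> k) (\<beta> k l) (u k (\<beta> k l))"
    and "\<And>k l. L2_norm {0<..<H} (u k (\<beta> k l)) = 1"
    and "\<epsilon> > 0" and "minimal_amplitude_hypothesis H c \<mu> \<beta> u c\<^sub>M \<epsilon>"
    and "\<And>k lam. (\<mu> k, lam) \<in> spectral_pairs \<mu> \<beta> c\<^sub>M \<epsilon> \<Longrightarrow>
           v k lam = (\<lambda>(x', y). \<phi> k x' * of_real (u k lam y))"
    and "\<omega> = \<omega>' \<times> {a<..<b}" and "\<omega> \<subseteq> \<Omega>" and "\<omega> \<noteq> {}" and "open \<omega>"
    and "\<omega>' \<noteq> \<Omega>' \<longrightarrow> does_not_concentrate \<Omega>' \<omega>' \<phi>"
  shows "\<exists>C\<^sub>\<omega> :: real. 0 < C\<^sub>\<omega> \<and>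
      C\<^sub>\<omega> \<le> Inf {L2_norm \<omega> (v k lam) / L2_norm \<Omega> (v k lam)
             | k lam. (\<mu> k, lam) \<in> spectral_pairs \<mu> \<beta> c\<^sub>M \<epsilon>} \<and>
      Inf {L2_norm \<omega> (v k lam) / L2_norm \<Omega> (v k lam)
             | k lam. (\<mu> k, lam) \<in> spectral_pairs \<mu> \<beta> c\<^sub>M \<epsilon>} \<le> 1"
proof -
  note H = \<open>H > 0\<close> and eigensystem = \<open>dirichlet_eigensystem \<Omega>' \<mu> \<phi>\<close> and \<epsilon> = \<open>\<epsilon> > 0\<close>
  have cm: "0 < c\<^sub>m" "c\<^sub>m \<le> c\<^sub>M" using assms(5,6) by auto
  note bounds = coeff_class_bounds[OF assms(7)]
  have ab: "a < b" "\<omega>' \<noteq> {}" using assms(15,17) by auto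
  have sub: "\<omega>' \<subseteq> \<Omega>'" "{a<..<b} \<subseteq> {0<..<H}"
  proof -
    have "\<omega>' \<times> {a<..<b} \<subseteq> \<Omega>' \<times> {0<..<H}" using assms(3,15,16) by simp
    then show "\<omega>' \<subseteq> \<Omega>'" "{a<..<b} \<subseteq> {0<..<H}" using ab by (simp_all add: times_subset_iff)
  qed
  have ab': "0 \<le> a" "b \<le> H" using sub(2) ab(1) by (auto simp: greaterThanLessThan_subseteq_greaterThanLessThan)
  have "\<omega>' = fst ` \<omega>" using assms(15) ab by auto
  then have \<omega>'_open: "open \<omega>'" using open_image_fst[OF assms(18)] by simp
  have \<Omega>'_open: "open \<Omega>'" using assms(1) by (simp add: bounded_smooth_domain_def)
  have \<mu>: "\<mu> k > 0" "\<mu> 0 \<le> \<mu> k" for k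
    using eigensystem by (auto simp: dirichlet_eigensystem_def mono_def)

  define pairs where "pairs = spectral_pairs \<mu> \<beta> c\<^sub>M \<epsilon>"
  have pairsD: "lam \<in> range (\<beta> k)" "(c\<^sub>M + \<epsilon>) * (\<mu> k)\<^sup>2 \<le> lam" if p: "(\<mu> k, lam) \<in> pairs" for k lam
  proof -
    \<comment> \<open>A pair may stem from another index \<open>j\<close> with the same \<open>\<mu>\<close>, but then the eigenvalues coincide.\<close>
    obtain j where j: "\<mu> k = \<mu> j" "lam \<in> range (\<beta> j)" "(c\<^sub>M + \<epsilon>) * (\<mu> j)\<^sup>2 \<le> lam"
      using p unfolding pairs_def spectral_pairs_def by blast
    then show "lam \<in> range (\<beta> k)" "(c\<^sub>M + \<epsilon>) * (\<mu> k)\<^sup>2 \<le> lam" using assms(9)[of j] assms(9)[of k] by auto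
  qed
  have eig: "eigenfunction_A H c (\<mu> k) lam (u k lam)" "L2_norm {0<..<H} (u k lam) = 1"
    if "(\<mu> k, lam) \<in> pairs" for k lam
    using pairsD(1)[OF that] assms(10,11) by auto
  have L2u: "L2 {0<..<H} (u k lam)" if "(\<mu> k, lam) \<in> pairs" for k lam
    using eig(1)[OF that] by (auto simp: eigenfunction_A_def dom_A_def H10_def H1_def)
  have L2\<phi>: "L2 \<Omega>' (\<phi> k)" for k
    using eigensystem by (simp add: dirichlet_eigensystem_def orthonormal_basis_L2_def)
  \<comment> \<open>The infimum is over a nonempty set: the unbounded eigenvalues for \<open>\<mu> 0\<close> supply a pair.\<close>
  have "\<exists>l. \<beta> 0 l > (c\<^sub>M + \<epsilon>) * (\<mu> 0)\<^sup>2"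
    by (rule eigenvalues_unbounded[OF H cm(1) bounds strict_mono_imp_inj_on[OF assms(8)] assms(10) assms(11)])
  then obtain lam0 where nonempty: "(\<mu> 0, lam0) \<in> pairs"
    unfolding pairs_def spectral_pairs_def by (fastforce intro: less_imp_le)

  define r where "r = min_amplitude H c \<mu> \<beta> u c\<^sub>M \<epsilon>"
  have r: "r > 0" using assms(13) by (simp add: r_def minimal_amplitude_hypothesis_def)
  have amplitude: "r\<^sup>2 \<le> (continuous_rep H (u k lam) y)\<^sup>2 + (continuous_rep H (\<lambda>z. c z * wderiv H (u k lam) z) y)\<^sup>2"
    if "y \<in> {0..H}" "(\<mu> k, lam) \<in> pairs" for k lam y
  proof -
    let ?S = "{(continuous_rep H (u k lam) y)\<^sup>2 + (continuous_rep H (\<lambda>z. c z * wderiv H (u k lam) z) y)\<^sup>2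
               | y k lam. y \<in> {0..H} \<and> (\<mu> k, lam) \<in> spectral_pairs \<mu> \<beta> c\<^sub>M \<epsilon>}"
    have "Inf ?S > 0" using r by (simp add: r_def min_amplitude_def)
    then have "r\<^sup>2 = Inf ?S" by (simp add: r_def min_amplitude_def)
    also have "\<dots> \<le> (continuous_rep H (u k lam) y)\<^sup>2 + (continuous_rep H (\<lambda>z. c z * wderiv H (u k lam) z) y)\<^sup>2"
      using that unfolding pairs_def by (intro cInf_lower bdd_belowI[of _ 0]) auto
    finally show ?thesis .
  qed

  define \<kappa>0 where "\<kappa>0 = sqrt ((c\<^sub>M + \<epsilon>) * (\<mu> 0)\<^sup>2)"
  have \<kappa>0: "\<kappa>0 > 0" using cm \<epsilon> \<mu>(1)[of 0] by (simp add: \<kappa>0_def)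
  have "1 / c\<^sub>M > 0" "1 / c\<^sub>m > 0" "\<epsilon> / (c\<^sub>M + \<epsilon>) > 0" using cm \<epsilon> by auto
  then obtain C1 where C1: "C1 > 0"
    and mass: "\<And>\<kappa> U V. \<kappa>0 \<le> \<kappa> \<Longrightarrow> oscillator \<kappa> (1 / c\<^sub>M) (1 / c\<^sub>m) (\<epsilon> / (c\<^sub>M + \<epsilon>)) {a..b} U V \<Longrightarrow>
      \<forall>y\<in>{a..b}. r\<^sup>2 \<le> (U y)\<^sup>2 + (\<kappa> * V y)\<^sup>2 \<Longrightarrow> C1 \<le> integral {a..b} (\<lambda>y. (U y)\<^sup>2)"
    using oscillator_uniform_mass[OF _ _ _ r \<kappa>0 ab(1)] by metis
  have square_int: "integrable (lebesgue_on {a<..<b}) (\<lambda>y. (u k lam y)\<^sup>2)" if "(\<mu> k, lam) \<in> pairs" for k lam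
    by (rule integrable_on_subdomain[OF _ sub(2)]) (use L2u[OF that] in \<open>auto simp: L2_def\<close>)
  have u_mass: "sqrt C1 \<le> L2_norm {a<..<b} (u k lam)" if p: "(\<mu> k, lam) \<in> pairs" for k lam
  proof -
    define U where "U = continuous_rep H (u k lam)"
    define W where "W = continuous_rep H (\<lambda>z. c z * wderiv H (u k lam) z)"
    obtain c' where c': "\<And>y. c\<^sub>m \<le> c' y \<and> c' y \<le> c\<^sub>M"
      and cont: "continuous_on {0..H} U" "continuous_on {0..H} W"
      and UAE: "AE y in lebesgue_on {0..H}. U y = u k lam y"
      and Ui: "\<And>x y. 0 \<le> x \<Longrightarrow> x \<le> y \<Longrightarrow> y \<le> H \<Longrightarrow> ((\<lambda>t. W t / c' t) has_integral (U y - U x)) {x..y}"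
      and Wi: "\<And>x y. 0 \<le> x \<Longrightarrow> x \<le> y \<Longrightarrow> y \<le> H \<Longrightarrow>
        ((\<lambda>t. - ((lam - c' t * (\<mu> k)\<^sup>2) * U t)) has_integral (W y - W x)) {x..y}"
      using eigenfunction_first_order_system[OF eig(1)[OF p] H cm bounds] unfolding U_def W_def by blast
    have "(\<mu> 0)\<^sup>2 \<le> (\<mu> k)\<^sup>2" using \<mu>[of k] \<mu>(1)[of 0] by (intro power_mono) auto
    then have "(c\<^sub>M + \<epsilon>) * (\<mu> 0)\<^sup>2 \<le> (c\<^sub>M + \<epsilon>) * (\<mu> k)\<^sup>2" using cm \<epsilon> by (intro mult_left_mono) auto
    then have lam: "(c\<^sub>M + \<epsilon>) * (\<mu> 0)\<^sup>2 \<le> lam" using pairsD(2)[OF p] by linarith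
    moreover have "0 < (c\<^sub>M + \<epsilon>) * (\<mu> 0)\<^sup>2" using cm \<epsilon> \<mu>(1)[of 0] by simp
    ultimately have lam0: "lam > 0" by linarith
    have "oscillator (sqrt lam) (1 / c\<^sub>M) (1 / c\<^sub>m) (\<epsilon> / (c\<^sub>M + \<epsilon>)) {0..H} U (\<lambda>y. W y / sqrt lam)"
      by (rule eigenfunction_oscillator[OF cm \<epsilon> lam0 pairsD(2)[OF p] c' cont Ui Wi])
    then have "oscillator (sqrt lam) (1 / c\<^sub>M) (1 / c\<^sub>m) (\<epsilon> / (c\<^sub>M + \<epsilon>)) {a..b} U (\<lambda>y. W y / sqrt lam)"
      by (rule oscillator_subset) (use ab' in auto)
    moreover have "\<kappa>0 \<le> sqrt lam" using lam by (simp add: \<kappa>0_def)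
    moreover have "r\<^sup>2 \<le> (U y)\<^sup>2 + (sqrt lam * (W y / sqrt lam))\<^sup>2" if "y \<in> {a..b}" for y
      using amplitude[OF _ p, of y] that ab' lam0 by (simp add: U_def W_def)
    ultimately have "C1 \<le> integral {a..b} (\<lambda>y. (U y)\<^sup>2)" by (intro mass ballI) auto
    also have "\<dots> = (LINT y|lebesgue_on {a..b}. (U y)\<^sup>2)"
      using ab' by (intro lebesgue_integral_eq_integral[symmetric] continuous_imp_integrable_real
          continuous_intros continuous_on_subset[OF cont(1)]) auto
    also have "\<dots> = (LINT y|lebesgue_on {a..b}. (u k lam y)\<^sup>2)"
    proof (rule integral_cong_AE)
      show "(\<lambda>y. (u k lam y)\<^sup>2) \<in> borel_measurable (lebesgue_on {a..b})"
        by (intro borel_measurable_integrable lebesgue_on_open_to_closed(1) square_int p)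
      show "(\<lambda>y. (U y)\<^sup>2) \<in> borel_measurable (lebesgue_on {a..b})"
        using ab' by (intro borel_measurable_integrable continuous_imp_integrable_real
            continuous_intros continuous_on_subset[OF cont(1)]) auto
      have "AE y in lebesgue. y \<in> {0..H} \<longrightarrow> U y = u k lam y"
        using UAE by (simp add: AE_restrict_space_iff)
      then have "AE y in lebesgue. y \<in> {a..b} \<longrightarrow> (U y)\<^sup>2 = (u k lam y)\<^sup>2"
        by eventually_elim (use ab' in auto)
      then show "AE y in lebesgue_on {a..b}. (U y)\<^sup>2 = (u k lam y)\<^sup>2"
        by (simp add: AE_restrict_space_iff)
    qed
    also have "\<dots> = (LINT y|lebesgue_on {a<..<b}. (u k lam y)\<^sup>2)"
      by (intro lebesgue_on_open_to_closed(2) square_int p)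
    finally show ?thesis by (simp add: L2_norm_def)
  qed

  have \<phi>1: "L2_norm \<Omega>' (\<phi> k) = 1" for k
    by (rule dirichlet_eigenfunctions_uniform_mass(1)[OF assms(1) eigensystem \<omega>'_open ab(2) sub(1) assms(19)])
  obtain \<delta> where \<delta>: "\<delta> > 0" "\<And>k. \<delta> \<le> L2_norm \<omega>' (\<phi> k)"
    using dirichlet_eigenfunctions_uniform_mass(2)[OF assms(1) eigensystem \<omega>'_open ab(2) sub(1) assms(19)] by blast

  have ratio: "L2_norm \<omega> (v k lam) / L2_norm \<Omega> (v k lam) = L2_norm \<omega>' (\<phi> k) * L2_norm {a<..<b} (u k lam)"
    if p: "(\<mu> k, lam) \<in> pairs" for k lam
  proof -
    have v: "v k lam = (\<lambda>(x', y). \<phi> k x' * of_real (u k lam y))" using assms(14) p by (simp add: pairs_def)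
    have m: "\<phi> k \<in> borel_measurable (lebesgue_on \<Omega>')" "u k lam \<in> borel_measurable (lebesgue_on {0<..<H})"
      using L2\<phi>[of k] L2u[OF p] by (auto simp: L2_def)
    have m': "\<phi> k \<in> borel_measurable (lebesgue_on \<omega>')" "u k lam \<in> borel_measurable (lebesgue_on {a<..<b})"
      using m sub by (auto intro: measurable_restrict_mono)
    show ?thesis
      unfolding v assms(3,15)
      using L2_norm_product[OF \<Omega>'_open open_greaterThanLessThan m] L2_norm_product[OF \<omega>'_open open_greaterThanLessThan m']
        \<phi>1[of k] eig(2)[OF p] by simp
  qed
  let ?R = "{L2_norm \<omega> (v k lam) / L2_norm \<Omega> (v k lam) | k lam. (\<mu> k, lam) \<in> spectral_pairs \<mu> \<beta> c\<^sub>M \<epsilon>}"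
  have lower: "\<delta> * sqrt C1 \<le> x" if "x \<in> ?R" for x
  proof -
    obtain k lam where p: "(\<mu> k, lam) \<in> pairs" and x: "x = L2_norm \<omega> (v k lam) / L2_norm \<Omega> (v k lam)"
      using \<open>x \<in> ?R\<close> unfolding pairs_def by blast
    show ?thesis
      unfolding x ratio[OF p] using \<delta> C1 by (intro mult_mono u_mass p) (auto intro: order.trans[OF less_imp_le \<delta>(2)])
  qed
  have x0: "L2_norm \<omega> (v 0 lam0) / L2_norm \<Omega> (v 0 lam0) \<in> ?R" using nonempty unfolding pairs_def by blast
  have "L2_norm \<omega> (v 0 lam0) / L2_norm \<Omega> (v 0 lam0) \<le> 1"
  proof -
    have "L2_norm \<omega>' (\<phi> 0) \<le> 1"
      using L2_norm_mono[OF L2\<phi>[of 0] sub(1)] \<omega>'_open \<Omega>'_open \<phi>1[of 0] by simp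
    moreover have "L2_norm {a<..<b} (u 0 lam0) \<le> 1"
      using L2_norm_mono[OF L2u[OF nonempty] sub(2)] eig(2)[OF nonempty] by simp
    moreover have "0 \<le> L2_norm \<omega>' (\<phi> 0)" "0 \<le> L2_norm {a<..<b} (u 0 lam0)" by (auto simp: L2_norm_def)
    ultimately show ?thesis unfolding ratio[OF nonempty] by (intro mult_le_one) auto
  qed
  moreover have "bdd_below ?R" by (rule bdd_belowI[of _ "\<delta> * sqrt C1"]) (rule lower)
  ultimately have "Inf ?R \<le> 1" by (intro cInf_lower2[OF x0])
  moreover have "\<delta> * sqrt C1 \<le> Inf ?R" using x0 lower by (intro cInf_greatest) auto
  moreover have "\<delta> * sqrt C1 > 0" using \<delta>(1) C1 by simp
  ultimately show ?thesis by blast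
qed

end
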